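(* Let $a>0$. For any $\Sigma\in\mathcal{M}_a$, $$\mathrm{ar}(\Sigma)-4\pi \;=\; -\int_\Sigma\Big(1-(x\cdot\nu(x))^2+\tfrac12\,\big|x-(x\cdot\nu(x))\nu(x)\big|^2\Big)K(x)\,d\mathcal{H}^2(x).$$ In particular, if $K\ge 0$ on $\Sigma$, then $\mathrm{ar}(\Sigma)\le 4\pi$.
   Context: Let $B$ be the (closed) unit ball in $\mathbb{R}^3$ centred at the origin. For $a>0$, $\mathcal{M}_a$ denotes the class of smoothly embedded surfaces $\Sigma\subset B$ of sphere type (diffeomorphic to $S^2$) with surface area $\mathrm{ar}(\Sigma)=\mathcal{H}^2(\Sigma)=a$. $\nu:\Sigma\to\mathbb{R}^3$ is the outer unit normal field and $K=\kappa_1\kappa_2$ is the Gauss curvature of $\Sigma$ ($\kappa_1,\kappa_2$ the principal curvatures). *)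

theory Defs
  imports "HOL-Analysis.Analysis"
begin

fun Ck_on :: "nat \<Rightarrow> ('a::euclidean_space \<Rightarrow> 'b::euclidean_space) \<Rightarrow> 'a set \<Rightarrow> bool" where
  "Ck_on 0 f U \<longleftrightarrow> continuous_on U f"
| "Ck_on (Suc k) f U \<longleftrightarrow> (\<forall>x\<in>U. f differentiable (at x)) \<and>
     (\<forall>v. Ck_on k (\<lambda>x. frechet_derivative f (at x) v) U)"

text \<open>Smoothness on a set that need not be open: local extendability to a smooth map on an
  open subset of the ambient space.\<close>

definition smooth_on :: "('a::euclidean_space \<Rightarrow> 'b::euclidean_space) \<Rightarrow> 'a set \<Rightarrow> bool" where
  "smooth_on f S \<longleftrightarrow> (\<forall>x\<in>S. \<exists>U F. open U \<and> x \<in> U \<and> (\<forall>k. Ck_on k F U) \<and> (\<forall>y\<in>S \<inter> U. F y = f y))"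

definition diffeomorphic :: "'a::euclidean_space set \<Rightarrow> 'b::euclidean_space set \<Rightarrow> bool" where
  "diffeomorphic S T \<longleftrightarrow> (\<exists>f g. smooth_on f S \<and> smooth_on g T \<and> f ` S = T \<and> g ` T = S \<and>
     (\<forall>x\<in>S. g (f x) = x) \<and> (\<forall>y\<in>T. f (g y) = y))"

definition embedded_surface :: "(real^3) set \<Rightarrow> bool" where
  "embedded_surface S \<longleftrightarrow> (\<forall>p\<in>S. \<exists>W V. open W \<and> p \<in> W \<and> open (V :: (real^2) set) \<and>
     diffeomorphic (S \<inter> W) V)"

text \<open>The coefficient \<open>pi / 4\<close> is the area of a planar disc of diameter 1, so that the measure of
  a planar set is its Lebesgue measure. Boundedness of the covering sets is required because
  \<^const>\<open>diameter\<close> is only meaningful for bounded sets.\<close>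

definition hausdorff2_covers :: "real \<Rightarrow> 'a::metric_space set \<Rightarrow> (nat \<Rightarrow> 'a set) set" where
  "hausdorff2_covers \<delta> A = {C. A \<subseteq> (\<Union>i. C i) \<and> (\<forall>i. bounded (C i) \<and> diameter (C i) \<le> \<delta>)}"

definition hausdorff2_pre :: "real \<Rightarrow> 'a::metric_space set \<Rightarrow> ennreal" where
  "hausdorff2_pre \<delta> A =
     (INF C\<in>hausdorff2_covers \<delta> A. \<Sum>i. ennreal (pi / 4 * (diameter (C i))\<^sup>2))"

definition hausdorff2_outer :: "'a::metric_space set \<Rightarrow> ennreal" where
  "hausdorff2_outer A = (SUP \<delta>\<in>{0<..}. hausdorff2_pre \<delta> A)"

definition hausdorff2 :: "'a::metric_space measure" where
  "hausdorff2 = measure_of UNIV (sets borel) hausdorff2_outer"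

text \<open>The function \<^const>\<open>measure_of\<close> yields the null measure unless its argument is countably
  additive; \<open>emeasure_hausdorff2\<close> below shows that this does not happen here.\<close>

lemma hausdorff2_pre_le:
  "C \<in> hausdorff2_covers \<delta> A \<Longrightarrow>
    hausdorff2_pre \<delta> A \<le> (\<Sum>i. ennreal (pi / 4 * (diameter (C i))\<^sup>2))"
  unfolding hausdorff2_pre_def by (rule INF_lower)

lemma hausdorff2_pre_mono: "A \<subseteq> B \<Longrightarrow> hausdorff2_pre \<delta> A \<le> hausdorff2_pre \<delta> B"
  unfolding hausdorff2_pre_def hausdorff2_covers_def by (rule INF_superset_mono) auto

lemma hausdorff2_pre_antimono: "\<delta> \<le> \<epsilon> \<Longrightarrow> hausdorff2_pre \<epsilon> A \<le> hausdorff2_pre \<delta> A"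
  unfolding hausdorff2_pre_def hausdorff2_covers_def
  by (rule INF_superset_mono) (auto intro: order_trans)

lemma hausdorff2_pre_le_outer: "0 < \<delta> \<Longrightarrow> hausdorff2_pre \<delta> A \<le> hausdorff2_outer A"
  unfolding hausdorff2_outer_def by (rule SUP_upper) auto

lemma hausdorff2_outer_mono: "A \<subseteq> B \<Longrightarrow> hausdorff2_outer A \<le> hausdorff2_outer B"
  unfolding hausdorff2_outer_def by (rule SUP_mono) (auto intro: hausdorff2_pre_mono)

lemma hausdorff2_pre_empty: "0 < \<delta> \<Longrightarrow> hausdorff2_pre \<delta> {} = 0"
  using hausdorff2_pre_le[of "\<lambda>_. {}" \<delta> "{}"] by (simp add: hausdorff2_covers_def)

lemma hausdorff2_outer_empty [simp]: "hausdorff2_outer {} = 0"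
  unfolding hausdorff2_outer_def
  by (metis (mono_tags, lifting) SUP_least greaterThan_iff hausdorff2_pre_empty le_zero_eq order_refl)

lemma hausdorff2_pre_UN:
  assumes "0 < \<delta>"
  shows "hausdorff2_pre \<delta> (\<Union>n. A n) \<le> (\<Sum>n. hausdorff2_pre \<delta> (A n :: 'a::metric_space set))"
proof (rule ennreal_le_epsilon)
  fix e :: real
  assume fin: "(\<Sum>n. hausdorff2_pre \<delta> (A n)) < top" and e: "0 < e"
  let ?w = "\<lambda>C i. ennreal (pi / 4 * (diameter ((C :: nat \<Rightarrow> 'a set) i))\<^sup>2)"
  have "\<exists>C\<in>hausdorff2_covers \<delta> (A n).
      (\<Sum>i. ?w C i) < hausdorff2_pre \<delta> (A n) + e * (1/2)^Suc n" for n
  proof -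
    have "hausdorff2_pre \<delta> (A n) < top"
      using fin by (metis ennreal_suminf_lessD)
    moreover have "0 < ennreal (e * (1/2)^Suc n)"
      using e by simp
    ultimately have "hausdorff2_pre \<delta> (A n) < hausdorff2_pre \<delta> (A n) + e * (1/2)^Suc n"
      by auto
    then show ?thesis
      by (subst (asm) hausdorff2_pre_def) (simp add: INF_less_iff)
  qed
  then obtain C where C: "\<And>n. C n \<in> hausdorff2_covers \<delta> (A n)"
    "\<And>n. (\<Sum>i. ?w (C n) i) < hausdorff2_pre \<delta> (A n) + e * (1/2)^Suc n"
    by metis
  define D where "D = (\<lambda>k. case prod_decode k of (n, i) \<Rightarrow> C n i)"
  have "(\<Union>n. A n) \<subseteq> (\<Union>k. D k)"
  proof
    fix x assume "x \<in> (\<Union>n. A n)"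
    then obtain n i where "x \<in> C n i"
      using C(1) by (fastforce simp: hausdorff2_covers_def)
    then have "x \<in> D (prod_encode (n, i))"
      by (simp add: D_def)
    then show "x \<in> (\<Union>k. D k)" by blast
  qed
  then have "D \<in> hausdorff2_covers \<delta> (\<Union>n. A n)"
    using C(1) by (auto simp: hausdorff2_covers_def D_def split: prod.split)
  then have "hausdorff2_pre \<delta> (\<Union>n. A n) \<le> (\<Sum>k. ?w D k)"
    by (rule hausdorff2_pre_le)
  also have "\<dots> = (\<Sum>n. \<Sum>i. ?w (C n) i)"
  proof -
    have "(\<lambda>k. ?w D k) = (\<lambda>(n, i). ?w (C n) i) \<circ> prod_decode"
      by (auto simp: D_def fun_eq_iff split: prod.split)
    moreover have "suminf ((\<lambda>(n, i). ?w (C n) i) \<circ> prod_decode) = (\<Sum>n. \<Sum>i. ?w (C n) i)"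
      unfolding comp_def by (rule suminf_ennreal_2dimen) simp
    ultimately show ?thesis
      by (simp only:)
  qed
  also have "\<dots> \<le> (\<Sum>n. hausdorff2_pre \<delta> (A n) + e * (1/2)^Suc n)"
    by (rule suminf_le[OF less_imp_le[OF C(2)]]) simp_all
  also have "\<dots> = (\<Sum>n. hausdorff2_pre \<delta> (A n)) + (\<Sum>n. ennreal (e * (1/2)^Suc n))"
    by (rule suminf_add[symmetric]) auto
  also have "(\<Sum>n. ennreal (e * (1/2)^Suc n)) = ennreal e"
    using e sums_mult[OF power_half_series, of e] by (intro suminf_ennreal_eq) simp_all
  finally show "hausdorff2_pre \<delta> (\<Union>n. A n) \<le> (\<Sum>n. hausdorff2_pre \<delta> (A n)) + e" .
qed

lemma hausdorff2_outer_UN: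
  "hausdorff2_outer (\<Union>n. A n) \<le> (\<Sum>n. hausdorff2_outer (A n :: 'a::metric_space set))"
  unfolding hausdorff2_outer_def[of "\<Union>n. A n"]
proof (rule SUP_least)
  fix \<delta> :: real assume "\<delta> \<in> {0<..}"
  then have "hausdorff2_pre \<delta> (\<Union>n. A n) \<le> (\<Sum>n. hausdorff2_pre \<delta> (A n))"
    by (intro hausdorff2_pre_UN) simp
  also have "\<dots> \<le> (\<Sum>n. hausdorff2_outer (A n))"
    using \<open>\<delta> \<in> {0<..}\<close> by (intro suminf_le) (auto intro: hausdorff2_pre_le_outer)
  finally show "hausdorff2_pre \<delta> (\<Union>n. A n) \<le> (\<Sum>n. hausdorff2_outer (A n))" .
qed

lemma hausdorff2_outer_Un:
  "hausdorff2_outer (A \<union> B) \<le> hausdorff2_outer A + hausdorff2_outer B"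
proof -
  have "hausdorff2_outer (\<Union>n. binaryset A B n) \<le> (\<Sum>n. hausdorff2_outer (binaryset A B n))"
    by (rule hausdorff2_outer_UN)
  also have "\<dots> = hausdorff2_outer A + hausdorff2_outer B"
    by (rule suminf_binaryset_eq) simp
  finally show ?thesis
    by (simp add: UN_binaryset_eq)
qed

lemma hausdorff2_pre_separated:
  assumes "0 < \<delta>" "\<delta> < d" and sep: "\<And>x y. x \<in> A \<Longrightarrow> y \<in> B \<Longrightarrow> d \<le> dist x y"
  shows "hausdorff2_pre \<delta> A + hausdorff2_pre \<delta> B \<le> hausdorff2_pre \<delta> (A \<union> B)"
  unfolding hausdorff2_pre_def[of \<delta> "A \<union> B"]
proof (rule INF_greatest)
  fix C assume C: "C \<in> hausdorff2_covers \<delta> (A \<union> B)"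
  let ?w = "\<lambda>C i. ennreal (pi / 4 * (diameter ((C :: nat \<Rightarrow> 'a set) i))\<^sup>2)"
  define CA where "CA = (\<lambda>i. if C i \<inter> A = {} then {} else C i)"
  define CB where "CB = (\<lambda>i. if C i \<inter> B = {} then {} else C i)"
  have disj: "C i \<inter> A = {} \<or> C i \<inter> B = {}" for i
  proof (rule ccontr)
    assume "\<not> ?thesis"
    then obtain x y where xy: "x \<in> C i" "x \<in> A" "y \<in> C i" "y \<in> B" by blast
    moreover have "dist x y \<le> diameter (C i)"
      using C xy by (intro diameter_bounded_bound) (auto simp: hausdorff2_covers_def)
    ultimately show False
      using sep[of x y] C assms(2)
      by (auto simp: hausdorff2_covers_def dest!: spec[of _ i])
  qed
  have "CA \<in> hausdorff2_covers \<delta> A" "CB \<in> hausdorff2_covers \<delta> B"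
    using C assms(1) by (fastforce simp: hausdorff2_covers_def CA_def CB_def)+
  then have "hausdorff2_pre \<delta> A + hausdorff2_pre \<delta> B \<le> (\<Sum>i. ?w CA i) + (\<Sum>i. ?w CB i)"
    by (intro add_mono hausdorff2_pre_le)
  also have "\<dots> = (\<Sum>i. ?w CA i + ?w CB i)"
    by (simp add: suminf_add)
  also have "\<dots> \<le> (\<Sum>i. ?w C i)"
  proof (intro suminf_le)
    show "?w CA i + ?w CB i \<le> ?w C i" for i
      using disj[of i] by (auto simp: CA_def CB_def)
  qed auto
  finally show "hausdorff2_pre \<delta> A + hausdorff2_pre \<delta> B \<le> (\<Sum>i. ?w C i)" .
qed

lemma hausdorff2_outer_separated:
  assumes "0 < d" and sep: "\<And>x y. x \<in> A \<Longrightarrow> y \<in> B \<Longrightarrow> d \<le> dist x y"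
  shows "hausdorff2_outer A + hausdorff2_outer B = hausdorff2_outer (A \<union> B)"
proof (rule antisym[OF _ hausdorff2_outer_Un])
  have "hausdorff2_pre \<epsilon> A + hausdorff2_pre \<delta> B \<le> hausdorff2_outer (A \<union> B)"
    if "0 < \<epsilon>" "0 < \<delta>" for \<epsilon> \<delta>
  proof -
    define \<gamma> where "\<gamma> = min (min \<epsilon> \<delta>) (d / 2)"
    have \<gamma>: "0 < \<gamma>" "\<gamma> < d" "\<gamma> \<le> \<epsilon>" "\<gamma> \<le> \<delta>"
      using that \<open>0 < d\<close> by (auto simp: \<gamma>_def)
    have "hausdorff2_pre \<epsilon> A + hausdorff2_pre \<delta> B \<le> hausdorff2_pre \<gamma> A + hausdorff2_pre \<gamma> B"
      using \<gamma> by (intro add_mono hausdorff2_pre_antimono)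
    also have "\<dots> \<le> hausdorff2_pre \<gamma> (A \<union> B)"
      using \<gamma> sep by (intro hausdorff2_pre_separated)
    also have "\<dots> \<le> hausdorff2_outer (A \<union> B)"
      using \<gamma> by (intro hausdorff2_pre_le_outer)
    finally show ?thesis .
  qed
  then show "hausdorff2_outer A + hausdorff2_outer B \<le> hausdorff2_outer (A \<union> B)"
    unfolding hausdorff2_outer_def[of A] hausdorff2_outer_def[of B]
    by (subst ennreal_SUP_add_left[symmetric], simp, intro SUP_least,
        subst ennreal_SUP_add_right, simp, intro SUP_least) auto
qed

lemma hausdorff2_outer_shells:
  fixes R :: "nat \<Rightarrow> 'a::metric_space set"
  assumes sep: "\<And>i j. i < j \<Longrightarrow> \<exists>d>0. \<forall>x\<in>R i. \<forall>k\<ge>j. \<forall>y\<in>R k. d \<le> dist x y"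
  shows "(\<Sum>i. hausdorff2_outer (R i)) \<le> hausdorff2_outer (\<Union>i. R i)"
proof (rule suminf_le_const)
  show "(\<Sum>i<n. hausdorff2_outer (R i)) \<le> hausdorff2_outer (\<Union>i. R i)" for n
  proof -
    have "(\<Sum>i\<in>{m..<m+n}. hausdorff2_outer (R i)) \<le> hausdorff2_outer (\<Union>i\<in>{m..}. R i)" for m
    proof (induction n arbitrary: m)
      case (Suc n)
      obtain d where d: "d > 0" "\<And>x k y. x \<in> R m \<Longrightarrow> k \<ge> Suc m \<Longrightarrow> y \<in> R k \<Longrightarrow> d \<le> dist x y"
        using sep[of m "Suc m"] by blast
      have "(\<Sum>i\<in>{m..<m+Suc n}. hausdorff2_outer (R i)) =
          hausdorff2_outer (R m) + (\<Sum>i\<in>{Suc m..<Suc m+n}. hausdorff2_outer (R i))"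
        by (subst sum.atLeast_Suc_lessThan) auto
      also have "\<dots> \<le> hausdorff2_outer (R m) + hausdorff2_outer (\<Union>i\<in>{Suc m..}. R i)"
        by (intro add_left_mono Suc.IH)
      also have "\<dots> = hausdorff2_outer (R m \<union> (\<Union>i\<in>{Suc m..}. R i))"
        using d by (intro hausdorff2_outer_separated) auto
      also have "\<dots> \<le> hausdorff2_outer (\<Union>i\<in>{m..}. R i)"
        by (intro hausdorff2_outer_mono) (auto dest: Suc_leD)
      finally show ?case .
    qed simp
    from this[of 0] show ?thesis
      by (simp add: atLeast0LessThan)
  qed
qed simp

lemma hausdorff2_outer_closed:
  fixes F :: "'a::metric_space set"
  assumes "closed F"
  shows "hausdorff2_outer (X \<inter> F) + hausdorff2_outer (X - F) = hausdorff2_outer X"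
proof (cases "F = {} \<or> hausdorff2_outer X = top")
  case True
  moreover have "hausdorff2_outer X \<le> hausdorff2_outer (X \<inter> F) + hausdorff2_outer (X - F)"
    using hausdorff2_outer_Un[of "X \<inter> F" "X - F"] by (simp add: Int_Diff_Un)
  ultimately show ?thesis
    by (auto simp: top_unique)
next
  case False
  define q where "q = (\<lambda>n. inverse (real (Suc n)))"
  have q: "0 < q n" "i < j \<Longrightarrow> q j < q i" for n i j
    by (auto simp: q_def)
  have qle: "q j \<le> q i" if "i \<le> j" for i j
    using that by (auto simp: q_def)
  define Y where "Y = (\<lambda>n. {x\<in>X. q n \<le> infdist x F})"
  define R where "R = (\<lambda>n. {x\<in>X. q (Suc n) \<le> infdist x F \<and> infdist x F < q n})"
  have sep: "q i - q j \<le> dist x y" if "q i \<le> infdist x F" "infdist y F \<le> q j" for x y i j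
    using infdist_triangle[of x F y] that by linarith
  have half: "(\<Sum>i. hausdorff2_outer (R (2 * i + b))) \<le> hausdorff2_outer X" for b
  proof -
    have "(\<Sum>i. hausdorff2_outer (R (2 * i + b))) \<le> hausdorff2_outer (\<Union>i. R (2 * i + b))"
    proof (rule hausdorff2_outer_shells)
      fix i j :: nat assume ij: "i < j"
      show "\<exists>d>0. \<forall>x\<in>R (2 * i + b). \<forall>k\<ge>j. \<forall>y\<in>R (2 * k + b). d \<le> dist x y"
      proof (intro exI conjI ballI allI impI)
        show "0 < q (Suc (2 * i + b)) - q (2 * j + b)"
          using ij q(2)[of "Suc (2 * i + b)" "2 * j + b"] by simp
        fix x y k assume *: "x \<in> R (2 * i + b)" "j \<le> k" "y \<in> R (2 * k + b)"
        then show "q (Suc (2 * i + b)) - q (2 * j + b) \<le> dist x y"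
          using qle[of "2 * j + b" "2 * k + b"] by (intro sep) (auto simp: R_def)
      qed
    qed
    also have "\<dots> \<le> hausdorff2_outer X"
      by (intro hausdorff2_outer_mono) (auto simp: R_def)
    finally show ?thesis .
  qed
  have "(\<Sum>i<n. hausdorff2_outer (R i)) \<le> hausdorff2_outer X + hausdorff2_outer X" for n
  proof -
    have "(\<Sum>i<n. hausdorff2_outer (R i)) \<le> (\<Sum>i<2 * n. hausdorff2_outer (R i))"
      by (intro sum_mono2) auto
    also have "\<dots> = (\<Sum>i<n. hausdorff2_outer (R (2 * i + 0))) + (\<Sum>i<n. hausdorff2_outer (R (2 * i + 1)))"
      by (induction n) (auto simp: algebra_simps)
    also have "\<dots> \<le> (\<Sum>i. hausdorff2_outer (R (2 * i + 0))) + (\<Sum>i. hausdorff2_outer (R (2 * i + 1)))"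
      by (intro add_mono sum_le_suminf) auto
    also have "\<dots> \<le> hausdorff2_outer X + hausdorff2_outer X"
      by (rule add_mono[OF half[of 0] half[of 1]])
    finally show ?thesis .
  qed
  then have "(\<Sum>i. hausdorff2_outer (R i)) \<le> hausdorff2_outer X + hausdorff2_outer X"
    by (intro suminf_le_const) auto
  also have "\<dots> < top"
    using False by (simp add: less_top)
  finally have fin: "(\<Sum>i. hausdorff2_outer (R i)) \<noteq> top"
    by simp
  define T where "T = (\<lambda>n. \<Sum>i. hausdorff2_outer (R (i + n)))"
  have T0: "T \<longlonglongrightarrow> 0"
  proof -
    define r where "r = (\<lambda>i. enn2real (hausdorff2_outer (R i)))"
    have r: "hausdorff2_outer (R i) = ennreal (r i)" "0 \<le> r i" for i
      using fin ennreal_suminf_lessD[of "\<lambda>i. hausdorff2_outer (R i)" top i]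
      by (simp_all add: r_def less_top)
    have sm: "summable r"
      using fin r by (intro summable_suminf_not_top) auto
    then have "T n = ennreal (\<Sum>i. r (i + n))" for n
      by (simp add: T_def r summable_iff_shift suminf_ennreal2)
    moreover have "(\<lambda>n. \<Sum>i. r (i + n)) \<longlonglongrightarrow> 0"
      using suminf_exist_split2[OF sm] .
    ultimately show ?thesis
      using tendsto_ennrealI by (simp add: ext[of T "\<lambda>n. ennreal (\<Sum>i. r (i + n))"] flip: ennreal_0)
  qed
  have cover: "X - F \<subseteq> Y n \<union> (\<Union>i. R (i + n))" for n
  proof
    fix x assume x: "x \<in> X - F"
    then have pos: "0 < infdist x F"
      using False assms by (metis DiffD2 in_closed_iff_infdist_zero infdist_nonneg less_eq_real_def)
    show "x \<in> Y n \<union> (\<Union>i. R (i + n))"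
    proof (cases "q n \<le> infdist x F")
      case True
      then show ?thesis using x by (simp add: Y_def)
    next
      case nle: False
      obtain m where m: "q m < infdist x F"
        using reals_Archimedean[OF pos] by (auto simp: q_def)
      define l where "l = (LEAST l. q l \<le> infdist x F)"
      have l: "q l \<le> infdist x F"
        unfolding l_def using m by (rule LeastI[OF less_imp_le])
      have "n < l"
        using l nle qle[of l n] by linarith
      moreover have "\<not> q (l - 1) \<le> infdist x F"
        unfolding l_def by (rule not_less_Least) (use \<open>n < l\<close> in \<open>simp flip: l_def\<close>)
      ultimately have "x \<in> R ((l - 1 - n) + n)"
        using l x by (auto simp: R_def not_le)
      then show ?thesis by blast
    qed
  qed
  have "hausdorff2_outer (X \<inter> F) + hausdorff2_outer (X - F) \<le> hausdorff2_outer X + T n" for n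
  proof -
    have "hausdorff2_outer (X - F) \<le> hausdorff2_outer (Y n) + hausdorff2_outer (\<Union>i. R (i + n))"
      using hausdorff2_outer_mono[OF cover] hausdorff2_outer_Un by (rule order_trans)
    also have "\<dots> \<le> hausdorff2_outer (Y n) + T n"
      unfolding T_def by (intro add_left_mono hausdorff2_outer_UN)
    finally have "hausdorff2_outer (X \<inter> F) + hausdorff2_outer (X - F) \<le>
        (hausdorff2_outer (X \<inter> F) + hausdorff2_outer (Y n)) + T n"
      by (simp add: add.assoc add_left_mono)
    also have "hausdorff2_outer (X \<inter> F) + hausdorff2_outer (Y n) = hausdorff2_outer ((X \<inter> F) \<union> Y n)"
    proof (rule hausdorff2_outer_separated[OF q(1)])
      fix x y assume "x \<in> X \<inter> F" "y \<in> Y n"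
      then show "q n \<le> dist x y"
        using infdist_le[of x F y] by (simp add: Y_def dist_commute)
    qed
    also have "\<dots> \<le> hausdorff2_outer X"
      by (intro hausdorff2_outer_mono) (auto simp: Y_def)
    finally show ?thesis
      by (simp add: add_right_mono)
  qed
  moreover have "(\<lambda>n. hausdorff2_outer X + T n) \<longlonglongrightarrow> hausdorff2_outer X + 0"
    by (intro tendsto_add tendsto_const T0)
  ultimately have "hausdorff2_outer (X \<inter> F) + hausdorff2_outer (X - F) \<le> hausdorff2_outer X"
    by (intro LIMSEQ_le_const[of _ "hausdorff2_outer X"]) auto
  then show ?thesis
    using hausdorff2_outer_Un[of "X \<inter> F" "X - F"] by (simp add: Int_Diff_Un antisym)
qed

lemma measure_space_hausdorff2:
  "measure_space UNIV (sets borel) (hausdorff2_outer :: 'a::metric_space set \<Rightarrow> ennreal)"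
proof -
  let ?L = "lambda_system UNIV (Pow UNIV) (hausdorff2_outer :: 'a set \<Rightarrow> ennreal)"
  interpret P: sigma_algebra UNIV "Pow UNIV :: 'a set set"
    by (rule sigma_algebra_Pow)
  have "outer_measure_space (Pow UNIV) (hausdorff2_outer :: 'a set \<Rightarrow> ennreal)"
    by (auto simp: outer_measure_space_def positive_def increasing_def countably_subadditive_def
        intro: hausdorff2_outer_mono hausdorff2_outer_UN)
  then have L: "measure_space UNIV ?L hausdorff2_outer"
    by (rule P.caratheodory_lemma)
  have "Collect closed \<subseteq> ?L"
    unfolding P.lambda_system_eq by (auto simp: hausdorff2_outer_closed)
  then have "sigma_sets UNIV (Collect closed) \<subseteq> ?L"
    using L by (intro sigma_algebra.sigma_sets_subset) (auto simp: measure_space_def)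
  then have "sets (borel :: 'a measure) \<subseteq> ?L"
    by (simp add: borel_eq_closed)
  moreover have "sigma_algebra UNIV (sets (borel :: 'a measure))"
    using sets.sigma_algebra_axioms[of "borel :: 'a measure"] by simp
  ultimately show ?thesis
    using L by (metis measure_down)
qed

lemma sets_hausdorff2 [simp, measurable_cong]: "sets hausdorff2 = sets borel"
  unfolding hausdorff2_def by (metis sets.sets_measure_of_eq space_borel)

lemma space_hausdorff2 [simp]: "space hausdorff2 = UNIV"
  by (simp add: hausdorff2_def)

lemma emeasure_hausdorff2: "A \<in> sets borel \<Longrightarrow> emeasure hausdorff2 A = hausdorff2_outer A"
  unfolding hausdorff2_def
  using measure_space_hausdorff2
  by (intro emeasure_measure_of_sigma) (auto simp: measure_space_def)

abbreviation area :: "(real^3) set \<Rightarrow> real" where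
  "area S \<equiv> measure hausdorff2 S"

definition tangent_space :: "(real^3) set \<Rightarrow> real^3 \<Rightarrow> (real^3) set" where
  "tangent_space S x = {v. \<exists>\<gamma> \<epsilon>. 0 < \<epsilon> \<and> smooth_on \<gamma> {-\<epsilon><..<\<epsilon>} \<and> \<gamma> ` {-\<epsilon><..<\<epsilon>} \<subseteq> S \<and>
     \<gamma> 0 = x \<and> (\<gamma> has_vector_derivative v) (at (0::real))}"

text \<open>The set \<^term>\<open>outside S\<close> is the union of the unbounded components of the complement.\<close>

definition outer_normal :: "(real^3) set \<Rightarrow> real^3 \<Rightarrow> real^3" where
  "outer_normal S x = (THE n. norm n = 1 \<and> (\<forall>v\<in>tangent_space S x. n \<bullet> v = 0) \<and>
     (\<exists>\<epsilon>>0. \<forall>t\<in>{0<..<\<epsilon>}. x + t *\<^sub>R n \<in> outside S))"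

text \<open>Derivatives within \<open>S\<close> are not unique as linear maps on the ambient space, but their
  restrictions to the tangent space are; only these are used below.\<close>

definition shape_operator :: "(real^3) set \<Rightarrow> real^3 \<Rightarrow> real^3 \<Rightarrow> real^3" where
  "shape_operator S x = frechet_derivative (outer_normal S) (at x within S)"

text \<open>No minus sign in the shape operator: with the outer normal the unit sphere has principal
  curvatures 1. A pair of principal curvatures is a pair of eigenvalues counted with multiplicity.\<close>

definition principal_curvatures :: "(real^3) set \<Rightarrow> real^3 \<Rightarrow> real \<Rightarrow> real \<Rightarrow> bool" where
  "principal_curvatures S x \<kappa>1 \<kappa>2 \<longleftrightarrow> (\<exists>e1 e2. norm e1 = 1 \<and> norm e2 = 1 \<and> e1 \<bullet> e2 = 0 \<and>
     span {e1, e2} = tangent_space S x \<and>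
     shape_operator S x e1 = \<kappa>1 *\<^sub>R e1 \<and> shape_operator S x e2 = \<kappa>2 *\<^sub>R e2)"

definition gauss_curvature :: "(real^3) set \<Rightarrow> real^3 \<Rightarrow> real" where
  "gauss_curvature S x = (THE k. \<exists>\<kappa>1 \<kappa>2. principal_curvatures S x \<kappa>1 \<kappa>2 \<and> k = \<kappa>1 * \<kappa>2)"

definition confined_spheres :: "real \<Rightarrow> (real^3) set set" where
  "confined_spheres a = {S. S \<subseteq> cball 0 1 \<and> embedded_surface S \<and>
     diffeomorphic (sphere (0 :: real^3) 1) S \<and> emeasure hausdorff2 S = ennreal a}"

end

theory Submission
  imports Defs
begin

text \<open>
  Write \<open>u = x \<bullet> \<nu>\<close>, let \<open>x\<^sup>T\<close> be the tangential part of \<open>x\<close> and let \<open>dA\<close> be the area element. The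
  1-form \<open>x \<bullet> (\<nu> \<times> dx) + u (x \<bullet> (\<nu> \<times> d\<nu>))\<close> has exterior derivative
  \<open>(- 2 + (2 u\<^sup>2 - \<bar>x\<^sup>T\<bar>\<^sup>2) K) dA\<close>, so the area is the integral of \<open>(u\<^sup>2 - \<bar>x\<^sup>T\<bar>\<^sup>2 / 2) K\<close>, and the
  identity follows from Gauss-Bonnet. Both forms are integrated by Green's theorem over the
  rectangle of spherical coordinates, after pulling back along a diffeomorphism of the unit sphere.
  For Gauss-Bonnet the form is the connection form of the normalized derivative in the direction of
  the meridians; it is closed up by periodicity except at the two poles, around each of which the
  frame turns once.

  The Hausdorff measure enters through the area formula, whose constant is fixed by the
  isodiametric inequality in the plane (Steiner symmetrization) and the Vitali covering theorem. By
  Jordan-Brouwer separation, the outer normal is locally plus or minus the normal of the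
  parametrization; the sign is irrelevant because the integrand is even in \<open>\<nu>\<close>.
\<close>

section \<open>Functions of class \<open>C\<^sup>k\<close>\<close>

text \<open>The 1-form is built to eliminate the mean curvature \<open>H\<close>. The forms x . (nu
  x dx) and x . (nu x dnu) have the exterior derivatives (2 H u - 2) dA and (2 u K - 2 H) dA; these
  are the two classical Minkowski formulas. Multiplying the second form by u makes the terms 2 H u
  cancel, and du = x . dnu then produces the term with the tangential part. The obstacle is that nu
  and K are not given by formulas. The normal is a definite description that refers to the unbounded
  side of the surface, the shape operator is a derivative within \<open>S\<close> that is an
  arbitrary choice off the tangent plane, and K is a definite description over pairs of eigenvalues.
  All computations therefore use a normal field \<open>n\<close> obtained from the diffeomorphism,
  and the link to the defined objects is made pointwise. Spherical coordinates cover the surface up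
  to a null set by a single chart, so that neither a partition of unity nor a triangulation occurs;
  all boundary effects sit on the edges of one rectangle.\<close>

lemma Ck_on_subset: "Ck_on k f U \<Longrightarrow> V \<subseteq> U \<Longrightarrow> Ck_on k f V"
proof (induction k arbitrary: f)
  case 0 then show ?case by (auto intro: continuous_on_subset)
next
  case (Suc k) then show ?case by auto
qed

lemma Ck_on_SucD: "Ck_on (Suc k) f U \<Longrightarrow> Ck_on k f U"
proof (induction k arbitrary: f)
  case 0
  then show ?case by (auto intro!: continuous_at_imp_continuous_on differentiable_imp_continuous_within)
next
  case (Suc k)
  then show ?case by (metis Ck_on.simps(2))
qed

lemma Ck_on_le: "Ck_on k f U \<Longrightarrow> j \<le> k \<Longrightarrow> Ck_on j f U"
  by (induction k) (auto simp: le_Suc_eq simp del: Ck_on.simps dest: Ck_on_SucD)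

lemma Ck_on_imp_continuous_on: "Ck_on k f U \<Longrightarrow> continuous_on U f"
  using Ck_on_le[of k f U 0] by simp

lemma Ck_on_has_derivative:
  "Ck_on (Suc k) f U \<Longrightarrow> x \<in> U \<Longrightarrow> (f has_derivative frechet_derivative f (at x)) (at x)"
  by (simp add: frechet_derivative_works)

text \<open>\<open>frechet_derivative f (at x)\<close> sees \<open>f\<close> only near
  \<open>x\<close>, so on an open set the values determine the whole tower of derivatives.\<close>

lemma Ck_on_cong:
  assumes "open U" "\<And>x. x \<in> U \<Longrightarrow> f x = g x" "Ck_on k f U"
  shows "Ck_on k g U"
  using assms(2,3)
proof (induction k arbitrary: f g)
  case 0 then show ?case by (simp cong: continuous_on_cong)
next
  case (Suc k)
  have *: "(g has_derivative frechet_derivative f (at x)) (at x)" if "x \<in> U" for x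
    using has_derivative_transform_within_open[OF Ck_on_has_derivative[OF Suc.prems(2) that] \<open>open U\<close> that]
      Suc.prems(1) by auto
  have eq: "frechet_derivative f (at x) = frechet_derivative g (at x)" if "x \<in> U" for x
    using frechet_derivative_at[OF *[OF that]] .
  have "Ck_on k (\<lambda>x. frechet_derivative g (at x) v) U" for v
    by (rule Suc.IH[of "\<lambda>x. frechet_derivative f (at x) v"]) (use Suc.prems(2) eq in auto)
  then show ?case using * by (auto simp: differentiable_def)
qed

text \<open>Replaces the derivative selected by \<open>frechet_derivative\<close> by an explicit
  formula \<open>f'\<close>, which is the form in which the inductions below can apply their
  hypothesis.\<close>

lemma Ck_on_SucI:
  assumes "open U" "\<And>x. x \<in> U \<Longrightarrow> (f has_derivative f' x) (at x)" "\<And>v. Ck_on k (\<lambda>x. f' x v) U"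
  shows "Ck_on (Suc k) f U"
proof -
  have "Ck_on k (\<lambda>x. frechet_derivative f (at x) v) U" for v
    by (rule Ck_on_cong[OF assms(1) _ assms(3)[of v]]) (use frechet_derivative_at[OF assms(2)] in auto)
  then show ?thesis using assms(2) by (auto simp: differentiable_def)
qed

lemma Ck_on_local:
  assumes "\<And>x. x \<in> U \<Longrightarrow> \<exists>V. x \<in> V \<and> open V \<and> Ck_on k f V"
  shows "Ck_on k f U"
  using assms
proof (induction k arbitrary: f)
  case 0
  then have "isCont f x" if "x \<in> U" for x
    by (metis Ck_on.simps(1) continuous_on_eq_continuous_at that)
  then show ?case by (simp add: continuous_at_imp_continuous_on)
next
  case (Suc k)
  then show ?case by simp metis
qed

lemma Ck_on_const: "Ck_on k (\<lambda>x. c) U"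
  by (induction k arbitrary: c) auto

lemma Ck_on_bounded_linear: "bounded_linear h \<Longrightarrow> Ck_on k h U"
proof (cases k)
  case 0 then show "bounded_linear h \<Longrightarrow> Ck_on k h U" by (simp add: linear_continuous_on)
next
  case (Suc j)
  assume h: "bounded_linear h"
  have "Ck_on k h UNIV" unfolding Suc
    by (rule Ck_on_SucI[where f'="\<lambda>x. h"]) (use h in \<open>auto intro: bounded_linear_imp_has_derivative Ck_on_const\<close>)
  then show ?thesis by (rule Ck_on_subset) simp
qed

lemma Ck_on_id: "Ck_on k (\<lambda>x. x) U"
  by (rule Ck_on_bounded_linear) (rule bounded_linear_ident)

lemma Ck_on_add:
  assumes U: "open U"
  shows "Ck_on k f U \<Longrightarrow> Ck_on k g U \<Longrightarrow> Ck_on k (\<lambda>x. f x + g x) U"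
proof (induction k arbitrary: f g)
  case 0 then show ?case by (auto intro: continuous_on_add)
next
  case (Suc k)
  show ?case
    by (rule Ck_on_SucI[OF U has_derivative_add[OF Suc.prems[THEN Ck_on_has_derivative]] Suc.IH])
       (use Suc.prems in auto)
qed

lemma Ck_on_sum:
  assumes U: "open U" and I: "finite I" "\<And>i. i \<in> I \<Longrightarrow> Ck_on k (f i) U"
  shows "Ck_on k (\<lambda>x. \<Sum>i\<in>I. f i x) U"
  using I by (induction I rule: finite_induct) (auto intro: Ck_on_const Ck_on_add[OF U])

text \<open>The product rule turns a product into a sum of two products of the same kind, so the
  induction closes once \<open>f\<close> and \<open>g\<close> are generalized. Multiplication,
  scaling, inner and cross product are all instances.\<close>

lemma Ck_on_bounded_bilinear:
  assumes U: "open U" and p: "bounded_bilinear p"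
  shows "Ck_on k f U \<Longrightarrow> Ck_on k g U \<Longrightarrow> Ck_on k (\<lambda>x. p (f x) (g x)) U"
proof (induction k arbitrary: f g)
  case 0 then show ?case by (auto intro: bounded_bilinear.continuous_on[OF p])
next
  case (Suc k)
  have "Ck_on k f U" "Ck_on k g U" using Suc.prems[THEN Ck_on_SucD] .
  then show ?case
    by (intro Ck_on_SucI[OF U bounded_bilinear.FDERIV[OF p Suc.prems[THEN Ck_on_has_derivative]]]
        Ck_on_add[OF U] Suc.IH) (use Suc.prems in auto)
qed

lemmas Ck_on_mult = Ck_on_bounded_bilinear[OF _ bounded_bilinear_mult]
  and Ck_on_scaleR = Ck_on_bounded_bilinear[OF _ bounded_bilinear_scaleR]
  and Ck_on_inner = Ck_on_bounded_bilinear[OF _ bounded_bilinear_inner]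

lemma bounded_bilinear_cross3: "bounded_bilinear cross3"
  using bilinear_cross bilinear_conv_bounded_bilinear by blast

lemmas Ck_on_cross3 = Ck_on_bounded_bilinear[OF _ bounded_bilinear_cross3]

text \<open>\<open>Ck_on\<close> speaks of derivatives in a fixed direction, while the chain rule
  evaluates the outer derivative in a direction that moves with the point. Expanding that direction
  in \<open>Basis\<close> reconciles the two.\<close>

lemma frechet_derivative_euclidean_sum:
  assumes "f differentiable at x"
  shows "frechet_derivative f (at x) v = (\<Sum>b\<in>Basis. (v \<bullet> b) *\<^sub>R frechet_derivative f (at x) b)"
proof -
  interpret bounded_linear "frechet_derivative f (at x)"
    using assms frechet_derivative_works has_derivative_bounded_linear by blast
  have "frechet_derivative f (at x) (\<Sum>b\<in>Basis. (v \<bullet> b) *\<^sub>R b) = (\<Sum>b\<in>Basis. (v \<bullet> b) *\<^sub>R frechet_derivative f (at x) b)"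
    by (simp add: sum scaleR)
  then show ?thesis by (simp only: euclidean_representation)
qed

lemma Ck_on_compose:
  assumes U: "open U" and V: "open V"
  shows "Ck_on k f U \<Longrightarrow> Ck_on k g V \<Longrightarrow> f ` U \<subseteq> V \<Longrightarrow> Ck_on k (\<lambda>x. g (f x)) U"
proof (induction k arbitrary: g)
  case 0 then show ?case using continuous_on_compose2[of V g U f] by simp
next
  case (Suc k)
  let ?D = "\<lambda>x v. \<Sum>b\<in>Basis. (frechet_derivative f (at x) v \<bullet> b) *\<^sub>R frechet_derivative g (at (f x)) b"
  show ?case
  proof (rule Ck_on_SucI[OF U, where f'="?D"])
    fix x assume x: "x \<in> U"
    then have "f x \<in> V" using Suc.prems(3) by auto
    have "((\<lambda>x. g (f x)) has_derivative (\<lambda>v. frechet_derivative g (at (f x)) (frechet_derivative f (at x) v))) (at x)"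
      using diff_chain_at[OF Ck_on_has_derivative[OF Suc.prems(1) x] Ck_on_has_derivative[OF Suc.prems(2) \<open>f x \<in> V\<close>]]
      by (simp add: o_def)
    moreover have "g differentiable at (f x)" using \<open>f x \<in> V\<close> Suc.prems(2) by auto
    ultimately show "((\<lambda>x. g (f x)) has_derivative ?D x) (at x)"
      by (subst (asm) frechet_derivative_euclidean_sum) simp_all
  next
    fix v
    have f: "Ck_on k f U" by (rule Ck_on_SucD[OF Suc.prems(1)])
    have "Ck_on k (\<lambda>x. frechet_derivative g (at (f x)) b) U" for b
      using Suc.IH[OF f, of "\<lambda>y. frechet_derivative g (at y) b"] Suc.prems by auto
    then show "Ck_on k (\<lambda>x. ?D x v) U"
      using Suc.prems(1) by (intro Ck_on_sum Ck_on_scaleR Ck_on_inner Ck_on_const U) auto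
  qed
qed

section \<open>Reciprocal, square root, sine and cosine\<close>

lemma has_real_derivative_imp_has_derivative:
  "(f has_real_derivative D) (at x) \<Longrightarrow> (f has_derivative (\<lambda>v. v * D)) (at x)"
  unfolding has_field_derivative_def by (rule has_derivative_eq_rhs) (auto simp: fun_eq_iff)

lemma Ck_on_inverse_real: "Ck_on k (inverse :: real \<Rightarrow> real) {0<..}"
proof (induction k)
  case 0 show ?case using continuous_on_inverse[OF continuous_on_id, of "{0<..} :: real set"] by simp
next
  case (Suc k)
  show ?case
  proof (rule Ck_on_SucI)
    show "(inverse has_derivative (\<lambda>v. - (inverse x * v * inverse x))) (at x)" if "x \<in> {0<..}" for x :: real
      using has_derivative_inverse'[of x UNIV] that by simp
    show "Ck_on k (\<lambda>x. - (inverse x * v * inverse x)) {0<..}" for v :: real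
      using Ck_on_mult[OF _ Ck_on_const[of k "-1"] Ck_on_mult[OF _ Ck_on_mult[OF _ Suc Ck_on_const[of k v]] Suc]]
      by simp
  qed simp
qed

lemma Ck_on_sqrt: "Ck_on k sqrt {0<..}"
proof (induction k)
  case 0 show ?case using continuous_on_real_sqrt[OF continuous_on_id] by simp
next
  case (Suc k)
  show ?case
  proof (rule Ck_on_SucI)
    show "(sqrt has_derivative (\<lambda>v. v * (inverse (sqrt x) / 2))) (at x)" if "x \<in> {0<..}" for x :: real
      using has_real_derivative_imp_has_derivative[OF DERIV_real_sqrt[of x]] that by simp
    have "Ck_on k (\<lambda>x. inverse (sqrt x)) {0<..}"
      by (rule Ck_on_compose[OF _ _ Suc Ck_on_inverse_real]) auto
    then show "Ck_on k (\<lambda>x. v * (inverse (sqrt x) / 2)) {0<..}" for v :: real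
      using Ck_on_mult[OF _ Ck_on_const[of k "v/2"], of "{0<..}" "\<lambda>x. inverse (sqrt x)"] by simp
  qed simp
qed

text \<open>The two functions share one induction because each is, up to sign, the derivative of the
  other.\<close>

lemma Ck_on_sin_cos: "Ck_on k (sin :: real \<Rightarrow> real) UNIV \<and> Ck_on k (cos :: real \<Rightarrow> real) UNIV"
proof (induction k)
  case 0 show ?case
    using continuous_on_sin[OF continuous_on_id, of "UNIV :: real set"] continuous_on_cos[OF continuous_on_id, of "UNIV :: real set"]
    by simp
next
  case (Suc k)
  have "Ck_on (Suc k) (sin :: real \<Rightarrow> real) UNIV"
  proof (rule Ck_on_SucI)
    show "(sin has_derivative (\<lambda>v. v * cos x)) (at x)" for x :: real
      using has_real_derivative_imp_has_derivative[OF DERIV_sin[of x]] .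
    show "Ck_on k (\<lambda>x. v * cos x) UNIV" for v :: real
      using Suc by (intro Ck_on_mult Ck_on_const) auto
  qed simp
  moreover have "Ck_on (Suc k) (cos :: real \<Rightarrow> real) UNIV"
  proof (rule Ck_on_SucI)
    show "(cos has_derivative (\<lambda>v. (-v) * sin x)) (at x)" for x :: real
      using has_real_derivative_imp_has_derivative[OF DERIV_cos[of x]] by simp
    show "Ck_on k (\<lambda>x. (-v) * sin x) UNIV" for v :: real
      using Suc by (intro Ck_on_mult Ck_on_const) auto
  qed simp
  ultimately show ?case ..
qed

lemma Ck_on_inverse_norm:
  assumes "open U" "Ck_on k f U" "\<And>x. x \<in> U \<Longrightarrow> f x \<noteq> 0"
  shows "Ck_on k (\<lambda>x. inverse (norm (f x))) U"
proof -
  have "Ck_on k (\<lambda>x. sqrt (f x \<bullet> f x)) U"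
    by (rule Ck_on_compose[where V="{0<..}" and g=sqrt, OF assms(1) _ _ Ck_on_sqrt])
       (use assms in \<open>auto intro: Ck_on_inner\<close>)
  then have "Ck_on k (\<lambda>x. inverse (sqrt (f x \<bullet> f x))) U"
    using assms by (intro Ck_on_compose[where V="{0<..}" and g=inverse, OF assms(1) _ _ Ck_on_inverse_real]) auto
  then show ?thesis by (simp add: norm_eq_sqrt_inner)
qed

lemma Ck_on_normalize:
  assumes "open U" "Ck_on k f U" "\<And>x. x \<in> U \<Longrightarrow> f x \<noteq> 0"
  shows "Ck_on k (\<lambda>x. f x /\<^sub>R norm (f x)) U"
  using assms by (intro Ck_on_scaleR Ck_on_inverse_norm)

section \<open>Symmetry of the second derivative\<close>

abbreviation dir_deriv :: "('a::euclidean_space \<Rightarrow> 'b::euclidean_space) \<Rightarrow> 'a \<Rightarrow> 'a \<Rightarrow> 'b" where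
  "dir_deriv f v x \<equiv> frechet_derivative f (at x) v"

text \<open>Symmetry of the second derivative: the second difference over a small parallelogram
  is expressed by the mean value theorem in two ways.\<close>

lemma second_difference_mvt:
  fixes f :: "'a::euclidean_space \<Rightarrow> real"
  assumes f: "Ck_on 2 f U" and s: "0 < s"
    and U: "\<And>a b. 0 \<le> a \<Longrightarrow> a \<le> s \<Longrightarrow> 0 \<le> b \<Longrightarrow> b \<le> s \<Longrightarrow> x + a *\<^sub>R v + b *\<^sub>R w \<in> U"
  shows "\<exists>a b. 0 \<le> a \<and> a \<le> s \<and> 0 \<le> b \<and> b \<le> s \<and>
    f (x + s *\<^sub>R v + s *\<^sub>R w) - f (x + s *\<^sub>R v) - f (x + s *\<^sub>R w) + f x
     = s\<^sup>2 * dir_deriv (dir_deriv f v) w (x + a *\<^sub>R v + b *\<^sub>R w)"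
proof -
  have f1: "Ck_on (Suc 1) f U" and f2: "Ck_on (Suc 0) (dir_deriv f v) U"
    using f by (simp_all add: numeral_2_eq_2)
  let ?h = "\<lambda>a. f (x + a *\<^sub>R v + s *\<^sub>R w) - f (x + a *\<^sub>R v)"
  have line: "((\<lambda>a. g (y + a *\<^sub>R u)) has_real_derivative dir_deriv g u (y + a *\<^sub>R u)) (at a)"
    if g: "Ck_on (Suc k) g U" and yU: "y + a *\<^sub>R u \<in> U" for g :: "'a \<Rightarrow> real" and k y a u
  proof -
    have "((\<lambda>a. y + a *\<^sub>R u) has_derivative (\<lambda>h. h *\<^sub>R u)) (at a)"
      by (auto intro!: derivative_eq_intros)
    from diff_chain_at[OF this Ck_on_has_derivative[OF g yU]]
    have "((\<lambda>a. g (y + a *\<^sub>R u)) has_derivative (\<lambda>h. dir_deriv g (h *\<^sub>R u) (y + a *\<^sub>R u))) (at a)"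
      by (simp add: o_def)
    moreover have "dir_deriv g (h *\<^sub>R u) (y + a *\<^sub>R u) = dir_deriv g u (y + a *\<^sub>R u) * h" for h
      using linear_scale[OF has_derivative_linear[OF Ck_on_has_derivative[OF g yU]]] by (simp add: mult.commute)
    ultimately show ?thesis by (simp add: has_field_derivative_def)
  qed
  have "\<exists>a>0. a < s \<and> ?h s - ?h 0 = (s - 0) *
    (dir_deriv f v (x + a *\<^sub>R v + s *\<^sub>R w) - dir_deriv f v (x + a *\<^sub>R v))"
  proof (rule MVT2[OF s])
    fix a assume a: "0 \<le> a" "a \<le> s"
    show "(?h has_real_derivative dir_deriv f v (x + a *\<^sub>R v + s *\<^sub>R w) - dir_deriv f v (x + a *\<^sub>R v)) (at a)"
      using line[OF f1, of "x + s *\<^sub>R w" a v] line[OF f1, of x a v] U[of a s] U[of a 0] a s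
      by (intro DERIV_diff) (auto simp: algebra_simps)
  qed
  then obtain a where a: "0 < a" "a < s" "?h s - ?h 0 = s *
    (dir_deriv f v (x + a *\<^sub>R v + s *\<^sub>R w) - dir_deriv f v (x + a *\<^sub>R v))" by auto
  have "\<exists>b>0. b < s \<and> dir_deriv f v (x + a *\<^sub>R v + s *\<^sub>R w) - dir_deriv f v (x + a *\<^sub>R v + 0 *\<^sub>R w) =
    (s - 0) * dir_deriv (dir_deriv f v) w (x + a *\<^sub>R v + b *\<^sub>R w)"
    by (rule MVT2[OF s]) (use line[OF f2, of "x + a *\<^sub>R v" _ w] U a in auto)
  then obtain b where b: "0 < b" "b < s" "dir_deriv f v (x + a *\<^sub>R v + s *\<^sub>R w) - dir_deriv f v (x + a *\<^sub>R v) =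
    s * dir_deriv (dir_deriv f v) w (x + a *\<^sub>R v + b *\<^sub>R w)" by auto
  show ?thesis
    using a b by (intro exI[of _ a] exI[of _ b]) (auto simp: algebra_simps power2_eq_square)
qed

lemma second_difference_quotient_tendsto:
  fixes f :: "'a::euclidean_space \<Rightarrow> real"
  assumes U: "open U" "x \<in> U" and f: "Ck_on 2 f U"
  shows "((\<lambda>s. (f (x + s *\<^sub>R v + s *\<^sub>R w) - f (x + s *\<^sub>R v) - f (x + s *\<^sub>R w) + f x) / s\<^sup>2)
    \<longlongrightarrow> dir_deriv (dir_deriv f v) w x) (at_right 0)" (is "(?q \<longlongrightarrow> ?D x) _")
proof (rule tendstoI)
  fix e :: real assume e: "0 < e"
  have "continuous_on U ?D" using f by (simp add: numeral_2_eq_2)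
  then have "isCont ?D x" using U continuous_on_eq_continuous_at by blast
  from this[unfolded continuous_at_eps_delta, rule_format, OF e]
  obtain d1 where d1: "d1 > 0" "\<And>y. dist y x < d1 \<Longrightarrow> dist (?D y) (?D x) < e" by blast
  obtain d2 where d2: "d2 > 0" "\<And>y. dist y x < d2 \<Longrightarrow> y \<in> U" using U open_dist by metis
  have nn: "norm v + norm w + 1 > 0" using norm_ge_zero[of v] norm_ge_zero[of w] by linarith
  \<comment> \<open>A parallelogram with parameters below \<open>r\<close> stays within both
    distances of \<open>x\<close>. The summand 1 keeps the divisor positive when \<open>v\<close>
    and \<open>w\<close> vanish.\<close>
  define r where "r = min d1 d2 / (norm v + norm w + 1)"
  have r: "r > 0" "r * (norm v + norm w + 1) = min d1 d2" using d1(1) d2(1) nn by (simp_all add: r_def)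
  have "dist (?q s) (?D x) < e" if s: "0 < s" "s < r" for s
  proof -
    have near: "dist (x + a *\<^sub>R v + b *\<^sub>R w) x < min d1 d2" if "0 \<le> a" "a \<le> s" "0 \<le> b" "b \<le> s" for a b
    proof -
      have "dist (x + a *\<^sub>R v + b *\<^sub>R w) x = norm (a *\<^sub>R v + b *\<^sub>R w)" by (simp add: dist_norm algebra_simps)
      also have "\<dots> \<le> a * norm v + b * norm w" using norm_triangle_ineq[of "a *\<^sub>R v" "b *\<^sub>R w"] that by simp
      also have "\<dots> \<le> s * norm v + s * norm w" using that by (intro add_mono mult_right_mono) auto
      also have "\<dots> \<le> s * (norm v + norm w + 1)" using s by (simp add: algebra_simps)
      also have "\<dots> < r * (norm v + norm w + 1)" using s nn by (intro mult_strict_right_mono)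
      finally show ?thesis by (simp only: r)
    qed
    have "x + a *\<^sub>R v + b *\<^sub>R w \<in> U" if "0 \<le> a" "a \<le> s" "0 \<le> b" "b \<le> s" for a b
      using near[OF that] d2(2) by simp
    from second_difference_mvt[OF f s(1) this] obtain a b where
      ab: "0 \<le> a" "a \<le> s" "0 \<le> b" "b \<le> s" and "?q s * s\<^sup>2 = s\<^sup>2 * ?D (x + a *\<^sub>R v + b *\<^sub>R w)"
      using s(1) by auto
    then have "?q s = ?D (x + a *\<^sub>R v + b *\<^sub>R w)" using s(1) by simp
    then show ?thesis using d1(2) near[OF ab] by simp
  qed
  then show "\<forall>\<^sub>F s in at_right 0. dist (?q s) (?D x) < e"
    using eventually_at_right_real[OF r(1)] by (auto elim!: eventually_mono)
qed

lemma symmetric_second_derivative_real: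
  fixes f :: "'a::euclidean_space \<Rightarrow> real"
  assumes "open U" "x \<in> U" and "Ck_on 2 f U"
  shows "dir_deriv (dir_deriv f v) w x = dir_deriv (dir_deriv f w) v x"
proof (rule tendsto_unique)
  show "((\<lambda>s. (f (x + s *\<^sub>R v + s *\<^sub>R w) - f (x + s *\<^sub>R v) - f (x + s *\<^sub>R w) + f x) / s\<^sup>2)
    \<longlongrightarrow> dir_deriv (dir_deriv f w) v x) (at_right 0)"
    using second_difference_quotient_tendsto[OF assms, of w v]
    by (rule Lim_transform_eventually) (simp add: algebra_simps)
qed (use second_difference_quotient_tendsto[OF assms] in auto)

lemma frechet_derivative_inner_const:
  assumes "f differentiable at x"
  shows "dir_deriv (\<lambda>y. f y \<bullet> c) v x = dir_deriv f v x \<bullet> c"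
proof -
  have "((\<lambda>y. f y \<bullet> c) has_derivative (\<lambda>v. dir_deriv f v x \<bullet> c)) (at x)"
    using assms by (intro has_derivative_inner_left) (simp add: frechet_derivative_works)
  from frechet_derivative_at[OF this] show ?thesis by metis
qed

lemma symmetric_second_derivative:
  fixes f :: "'a::euclidean_space \<Rightarrow> 'b::euclidean_space"
  assumes U: "open U" "x \<in> U" and f: "Ck_on 2 f U"
  shows "dir_deriv (dir_deriv f v) w x =
         dir_deriv (dir_deriv f w) v x"
proof (rule euclidean_eqI)
  fix b :: 'b
  have f1: "Ck_on (Suc 1) f U" using f by (simp add: numeral_2_eq_2)
  have *: "dir_deriv (dir_deriv (\<lambda>z. f z \<bullet> b) v) w x
    = dir_deriv (dir_deriv f v) w x \<bullet> b" for v w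
  proof -
    have "((dir_deriv f v) has_derivative
       frechet_derivative (dir_deriv f v) (at x)) (at x)"
      using f1 U by (intro Ck_on_has_derivative[where k=0 and U=U]) auto
    then have "((\<lambda>y. dir_deriv f v y \<bullet> b) has_derivative
       (\<lambda>w. dir_deriv (dir_deriv f v) w x \<bullet> b)) (at x)"
      by (rule has_derivative_inner_left)
    then have "((\<lambda>y. dir_deriv (\<lambda>z. f z \<bullet> b) v y) has_derivative
       (\<lambda>w. dir_deriv (dir_deriv f v) w x \<bullet> b)) (at x)"
      by (rule has_derivative_transform_within_open[OF _ U])
         (use f1 in \<open>simp add: frechet_derivative_inner_const\<close>)
    from frechet_derivative_at[OF this] show ?thesis by metis
  qed
  have "Ck_on 2 (\<lambda>z. f z \<bullet> b) U" using U f by (intro Ck_on_inner Ck_on_const)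
  from symmetric_second_derivative_real[OF U this, of v w]
  show "dir_deriv (dir_deriv f v) w x \<bullet> b =
        dir_deriv (dir_deriv f w) v x \<bullet> b" by (simp add: *)
qed

section \<open>Isodiametric inequality and Hausdorff measure in the plane\<close>

text \<open>Otherwise, with \<open>l\<close> and \<open>u\<close> the infimum and supremum of
  \<open>B'\<close>, the set \<open>B\<close> lies between \<open>u - (s + s')\<close> and
  \<open>l + (s + s')\<close>. Since \<open>B\<close> is larger than \<open>2 * s\<close>, this
  forces \<open>u - l < 2 * s'\<close>, which is too short for \<open>B'\<close>. It is applied to
  two vertical slices of a planar set.\<close>

lemma spread_of_large_sets:
  fixes B B' :: "real set"
  assumes m: "ennreal (2 * s) < emeasure lborel B" "ennreal (2 * s') < emeasure lborel B'"
    and s: "0 \<le> s" "0 \<le> s'"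
  shows "\<exists>b\<in>B. \<exists>b'\<in>B'. s + s' < \<bar>b - b'\<bar>"
proof (rule ccontr)
  assume "\<not> ?thesis"
  then have le: "\<bar>b - b'\<bar> \<le> s + s'" if "b \<in> B" "b' \<in> B'" for b b'
    using that not_less by blast
  have ne: "B \<noteq> {}" "B' \<noteq> {}" using m by auto
  then obtain b0 b0' where b0: "b0 \<in> B" "b0' \<in> B'" by blast
  have bdd: "bdd_above B'" "bdd_below B'"
    using le[OF b0(1)] by (auto intro!: bdd_aboveI[of _ "b0 + (s + s')"] bdd_belowI[of _ "b0 - (s + s')"] simp: abs_le_iff) (smt (verit))+
  define l u where "l = Inf B'" and "u = Sup B'"
  have lu: "B' \<subseteq> {l..u}" using bdd by (auto simp: l_def u_def intro: cInf_lower cSup_upper)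
  have "b \<le> l + (s + s')" if "b \<in> B" for b
  proof -
    have "b - (s + s') \<le> l" unfolding l_def by (rule cInf_greatest[OF ne(2)]) (use le[OF that] in \<open>fastforce simp: abs_le_iff\<close>)
    then show ?thesis by simp
  qed
  moreover have "u - (s + s') \<le> b" if "b \<in> B" for b
  proof -
    have "u \<le> b + (s + s')" unfolding u_def by (rule cSup_least[OF ne(2)]) (use le[OF that] in \<open>fastforce simp: abs_le_iff\<close>)
    then show ?thesis by simp
  qed
  ultimately have "B \<subseteq> {u - (s + s')..l + (s + s')}" by auto
  then have "emeasure lborel B \<le> emeasure lborel {u - (s + s')..l + (s + s')}" by (intro emeasure_mono) auto
  with m(1) have 1: "ennreal (2 * s) < emeasure lborel {u - (s + s')..l + (s + s')}" by (rule order_less_le_trans)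
  have "emeasure lborel B' \<le> emeasure lborel {l..u}" using lu by (intro emeasure_mono) auto
  with m(2) have 2: "ennreal (2 * s') < emeasure lborel {l..u}" by (rule order_less_le_trans)
  have "2 * s < l + (s + s') - (u - (s + s'))"
    using 1 s by (cases "u - (s + s') \<le> l + (s + s')") (auto simp: ennreal_less_iff)
  moreover have "2 * s' < u - l"
    using 2 s by (cases "l \<le> u") (auto simp: ennreal_less_iff)
  ultimately show False by simp
qed

text \<open>Steiner symmetrization about the first axis: each vertical slice becomes a centred open
  interval of the same length. The strict inequality leaves null slices empty and supplies the
  strict bounds that \<open>spread_of_large_sets\<close> asks for.\<close>

definition steiner :: "(real \<times> real) set \<Rightarrow> (real \<times> real) set" where
  "steiner A = {p. ennreal (2 * \<bar>snd p\<bar>) < emeasure lborel (Pair (fst p) -` A)}"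

lemma section_measurable:
  assumes "A \<in> sets (borel :: (real \<times> real) measure)"
  shows "(\<lambda>x. emeasure lborel (Pair x -` A)) \<in> borel_measurable borel"
  using lborel.measurable_emeasure_Pair[of A lborel] assms by (simp add: lborel_prod borel_prod)

lemma steiner_borel [measurable]:
  assumes "A \<in> sets borel"
  shows "steiner A \<in> sets borel"
proof -
  note [measurable] = section_measurable[OF assms]
  have "(\<lambda>p. emeasure lborel (Pair (fst p) -` A)) \<in> borel_measurable (borel :: (real \<times> real) measure)"
    by (rule measurable_compose[OF _ section_measurable[OF assms]]) (simp add: borel_measurable_continuous_onI continuous_on_fst)
  moreover have "(\<lambda>p. ennreal (2 * \<bar>snd p\<bar>)) \<in> borel_measurable (borel :: (real \<times> real) measure)"
    by (intro measurable_compose[OF _ measurable_ennreal] borel_measurable_continuous_onI continuous_intros)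
  ultimately have "{p \<in> space borel. ennreal (2 * \<bar>snd p\<bar>) < emeasure lborel (Pair (fst p) -` A)} \<in> sets (borel :: (real \<times> real) measure)"
    by (intro borel_measurable_less)
  then show ?thesis by (simp add: steiner_def)
qed

lemma emeasure_abs_less: "emeasure lborel {y::real. ennreal (2 * \<bar>y\<bar>) < m} = m"
proof (cases m)
  case (real r)
  then have "{y::real. ennreal (2 * \<bar>y\<bar>) < m} = {-(r/2)<..<r/2}"
    by (auto simp: ennreal_less_iff abs_if)
  then show ?thesis using real by simp
qed simp

text \<open>Cavalieri's principle: by \<open>emeasure_abs_less\<close> every slice keeps its
  length.\<close>

lemma emeasure_steiner:
  assumes "A \<in> sets borel"
  shows "emeasure lborel (steiner A) = emeasure lborel A"
proof -
  have *: "emeasure lborel B = (\<integral>\<^sup>+ x. emeasure lborel (Pair x -` B) \<partial>lborel)"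
    if "B \<in> sets (borel :: (real \<times> real) measure)" for B
    using lborel.emeasure_pair_measure_alt[of B lborel] that unfolding lborel_prod by simp
  have "emeasure lborel (steiner A) = (\<integral>\<^sup>+ x. emeasure lborel (Pair x -` steiner A) \<partial>lborel)"
    by (rule *) (rule steiner_borel[OF assms])
  also have "\<dots> = (\<integral>\<^sup>+ x. emeasure lborel (Pair x -` A) \<partial>lborel)"
    by (simp add: steiner_def vimage_def emeasure_abs_less)
  also have "\<dots> = emeasure lborel A" using *[OF assms] ..
  finally show ?thesis .
qed

text \<open>The first coordinates are kept. The second coordinates of the two points differ by at
  most the sum of their absolute values, and \<open>spread_of_large_sets\<close> finds points of the
  two original slices that are even further apart.\<close>

lemma dist_steiner_le:
  assumes d: "\<And>p q. p \<in> A \<Longrightarrow> q \<in> A \<Longrightarrow> dist p q \<le> d" and pq: "p \<in> steiner A" "q \<in> steiner A"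
  shows "dist p q \<le> d"
proof -
  obtain b b' where b: "(fst p, b) \<in> A" "(fst q, b') \<in> A" "\<bar>snd p\<bar> + \<bar>snd q\<bar> < \<bar>b - b'\<bar>"
    using spread_of_large_sets[of "\<bar>snd p\<bar>" "Pair (fst p) -` A" "\<bar>snd q\<bar>" "Pair (fst q) -` A"] pq
    by (auto simp: steiner_def)
  have "\<bar>snd p - snd q\<bar> \<le> \<bar>b - b'\<bar>" using b(3) by linarith
  then have "(snd p - snd q)\<^sup>2 \<le> (b - b')\<^sup>2" by (simp add: abs_le_square_iff)
  then have "dist p q \<le> dist (fst p, b) (fst q, b')"
    by (simp add: dist_prod_def dist_real_def)
  also have "\<dots> \<le> d" using d b by blast
  finally show ?thesis .
qed

lemma steiner_uminus_snd: "(x, y) \<in> steiner A \<Longrightarrow> (x, - y) \<in> steiner A"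
  by (simp add: steiner_def)

text \<open>Symmetrizing in one coordinate does not destroy a reflection symmetry in the other, so
  two successive symmetrizations give a set that is invariant under negation.\<close>

lemma steiner_uminus_fst:
  assumes "\<And>x y. (x, y) \<in> A \<longleftrightarrow> (- x, y) \<in> A"
  shows "(x, y) \<in> steiner A \<Longrightarrow> (- x, y) \<in> steiner A"
proof -
  have "Pair (- x) -` A = Pair x -` A" using assms by auto
  then show "(x, y) \<in> steiner A \<Longrightarrow> (- x, y) \<in> steiner A" by (simp add: steiner_def)
qed

lemma emeasure_lborel_swap:
  assumes "A \<in> sets (borel :: (real \<times> real) measure)"
  shows "emeasure lborel (prod.swap -` A) = emeasure lborel A" "prod.swap -` A \<in> sets borel"
proof -
  have m: "prod.swap \<in> borel_measurable (borel :: (real \<times> real) measure)"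
    by (intro borel_measurable_continuous_onI continuous_on_swap)
  then show 1: "prod.swap -` A \<in> sets borel" using assms measurable_sets[OF m, of A] by simp
  have "lborel = distr lborel borel (\<lambda>(x, y). (y, x) :: real \<times> real)"
    using lborel_pair.distr_pair_swap[where ?'a=real and ?'b=real] unfolding lborel_prod
    by (metis distr_cong sets_lborel)
  also have "(\<lambda>(x, y). (y, x) :: real \<times> real) = prod.swap" by auto
  finally have "emeasure lborel A = emeasure (distr lborel borel prod.swap) A" by simp
  also have "\<dots> = emeasure lborel (prod.swap -` A)"
    using m assms by (subst emeasure_distr) auto
  finally show "emeasure lborel (prod.swap -` A) = emeasure lborel A" ..
qed

theorem isodiametric_inequality:
  fixes A :: "(real \<times> real) set"
  assumes A: "A \<in> sets borel" and d: "\<And>p q. p \<in> A \<Longrightarrow> q \<in> A \<Longrightarrow> dist p q \<le> d" "0 \<le> d"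
  shows "emeasure lborel A \<le> ennreal (pi / 4 * d\<^sup>2)"
proof -
  \<comment> \<open>\<open>steiner\<close> acts on second coordinates only; the swap makes the next
    application act on the other one.\<close>
  define B where "B = prod.swap -` steiner A"
  define C where "C = steiner B"
  note sA = steiner_borel[OF A]
  have B: "B \<in> sets borel" "emeasure lborel B = emeasure lborel A"
    using emeasure_lborel_swap[OF sA] emeasure_steiner[OF A] by (simp_all add: B_def)
  have C: "C \<in> sets borel" "emeasure lborel C = emeasure lborel A"
    using steiner_borel[OF B(1)] emeasure_steiner[OF B(1)] B by (simp_all add: C_def)
  have dB: "dist p q \<le> d" if "p \<in> B" "q \<in> B" for p q
    using dist_steiner_le[of A d "prod.swap p" "prod.swap q"] d that
    by (simp add: B_def dist_prod_def add.commute)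
  have dC: "dist p q \<le> d" if "p \<in> C" "q \<in> C" for p q
    using dist_steiner_le[OF dB] that by (simp add: C_def)
  have symB: "(x, y) \<in> B \<longleftrightarrow> (- x, y) \<in> B" for x y
    using steiner_uminus_snd[of y x A] steiner_uminus_snd[of y "-x" A] by (auto simp: B_def)
  have symC: "- p \<in> C" if "p \<in> C" for p
    using steiner_uminus_fst[of B "fst p" "snd p"] steiner_uminus_snd[of "- fst p" "snd p" B] symB that
    by (cases p) (simp add: C_def)
  \<comment> \<open>Central symmetry turns the bound on the diameter into a bound on the radius:
    \<open>p\<close> and \<open>- p\<close> are \<open>2 * norm p\<close> apart.\<close>
  have "C \<subseteq> cball 0 (d / 2)"
  proof
    fix p assume "p \<in> C"
    then have "dist p (- p) \<le> d" using dC symC by blast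
    moreover have "dist p (- p) = 2 * norm p" by (simp add: dist_norm flip: scaleR_2)
    ultimately show "p \<in> cball 0 (d / 2)" by simp
  qed
  then have "emeasure lborel C \<le> emeasure lborel (cball 0 (d / 2) :: (real \<times> real) set)"
    by (intro emeasure_mono) auto
  also have "\<dots> = ennreal (pi / 4 * d\<^sup>2)"
    using d(2) by (simp add: emeasure_cball unit_ball_vol_2 power_divide power2_eq_square)
  finally show ?thesis using C by simp
qed

section \<open>Covers of planar sets by discs\<close>

lemma hausdorff2_pre_single:
  assumes "bounded E" "diameter E \<le> \<delta>" "0 \<le> \<delta>"
  shows "hausdorff2_pre \<delta> E \<le> ennreal (pi / 4 * (diameter E)\<^sup>2)"
proof -
  let ?C = "\<lambda>i::nat. if i = 0 then E else {}"
  have "?C \<in> hausdorff2_covers \<delta> E" using assms by (auto simp: hausdorff2_covers_def)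
  then have "hausdorff2_pre \<delta> E \<le> (\<Sum>i. ennreal (pi / 4 * (diameter (?C i))\<^sup>2))" by (rule hausdorff2_pre_le)
  also have "\<dots> = (\<Sum>i\<in>{0}. ennreal (pi / 4 * (diameter (?C i))\<^sup>2))"
    by (rule suminf_finite) auto
  finally show ?thesis by simp
qed

text \<open>Combines the countable subadditivity of the premeasure with the countable additivity of
  Lebesgue measure. In the applications the \<open>D i\<close> are disjoint Vitali discs and the
  \<open>E i\<close> are these discs or their enlargements.\<close>

lemma hausdorff2_pre_disjoint_cover:
  fixes D E :: "'i \<Rightarrow> (real \<times> real) set"
  assumes \<delta>: "0 < \<delta>" and C: "countable C" "pairwise (\<lambda>i j. disjnt (D i) (D j)) C"
    and D: "\<And>i. i \<in> C \<Longrightarrow> D i \<in> sets borel" "\<And>i. i \<in> C \<Longrightarrow> hausdorff2_pre \<delta> (E i) \<le> c * emeasure lborel (D i)"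
  shows "hausdorff2_pre \<delta> (\<Union>i\<in>C. E i) \<le> c * emeasure lborel (\<Union>i\<in>C. D i)"
proof -
  have inj: "inj_on (to_nat_on C) C" using C(1) by (rule inj_on_to_nat_on)
  \<comment> \<open>\<open>K n\<close> holds at most one index and is empty for numbers that
    enumerate nothing, so finite and infinite \<open>C\<close> are treated alike.\<close>
  define K where "K n = {i \<in> C. to_nat_on C i = n}" for n
  define D' where "D' n = (\<Union>i\<in>K n. D i)" for n
  define E' where "E' n = (\<Union>i\<in>K n. E i)" for n
  have K: "K n = {} \<or> (\<exists>i\<in>C. K n = {i})" for n
  proof (cases "\<exists>i\<in>C. to_nat_on C i = n")
    case True
    then obtain i where i: "i \<in> C" "to_nat_on C i = n" by blast
    then have "K n = {i}" using inj by (auto simp: K_def inj_on_def)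
    then show ?thesis using i by blast
  qed (auto simp: K_def)
  have UD: "(\<Union>i\<in>C. D i) = (\<Union>n. D' n)" and UE: "(\<Union>i\<in>C. E i) = (\<Union>n. E' n)"
    unfolding D'_def E'_def K_def by blast+
  have "disjoint_family D'"
    unfolding disjoint_family_on_def
  proof (intro ballI impI)
    fix m n :: nat assume "m \<noteq> n"
    have "D i \<inter> D j = {}" if ij: "i \<in> K m" "j \<in> K n" for i j
    proof -
      have "i \<in> C" "j \<in> C" "i \<noteq> j" using ij \<open>m \<noteq> n\<close> by (auto simp: K_def)
      then show ?thesis using pairwiseD[OF C(2), of i j] by (simp add: disjnt_def)
    qed
    then show "D' m \<inter> D' n = {}" unfolding D'_def by blast
  qed
  moreover have D'b: "D' n \<in> sets borel" for n using D(1) K[of n] by (auto simp: D'_def)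
  ultimately have eq: "(\<Sum>n. emeasure lborel (D' n)) = emeasure lborel (\<Union>n. D' n)"
    by (intro suminf_emeasure) auto
  have "hausdorff2_pre \<delta> (E' n) \<le> c * emeasure lborel (D' n)" for n
    using K[of n] D(2) hausdorff2_pre_empty[OF \<delta>] by (auto simp: D'_def E'_def)
  then have "(\<Sum>n. hausdorff2_pre \<delta> (E' n)) \<le> (\<Sum>n. c * emeasure lborel (D' n))"
    by (intro suminf_le) auto
  with hausdorff2_pre_UN[OF \<delta>, of E'] have "hausdorff2_pre \<delta> (\<Union>n. E' n) \<le> (\<Sum>n. c * emeasure lborel (D' n))"
    by (rule order_trans)
  also have "\<dots> = c * (\<Sum>n. emeasure lborel (D' n))" by simp
  finally show ?thesis unfolding UD UE eq .
qed

text \<open>The coefficient in the premeasure makes a disc weigh exactly its area, so an enlargement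
  of the radius by \<open>k\<close> costs \<open>k\<^sup>2\<close>. It is used with
  \<open>k = 5\<close> and \<open>k = 1\<close>.\<close>

lemma hausdorff2_pre_cball:
  fixes x :: "real \<times> real"
  assumes "0 < r" "0 < k" "2 * (k * r) \<le> \<delta>"
  shows "hausdorff2_pre \<delta> (cball x (k * r)) \<le> ennreal (k\<^sup>2) * emeasure lborel (cball x r)"
proof -
  have kr: "0 < k * r" using assms by simp
  have "hausdorff2_pre \<delta> (cball x (k * r)) \<le> ennreal (pi / 4 * (2 * (k * r))\<^sup>2)"
    using hausdorff2_pre_single[of "cball x (k * r)" \<delta>] kr assms by (simp add: diameter_cball)
  also have "\<dots> = ennreal (k\<^sup>2) * emeasure lborel (cball x r)"
    using assms by (simp add: emeasure_cball unit_ball_vol_2 power_mult_distrib power2_eq_square algebra_simps flip: ennreal_mult)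
  finally show ?thesis .
qed

text \<open>Disjoint discs inside an open neighbourhood of small measure have small total area, and
  their fivefold enlargements, which can be made to cover \<open>N\<close>, cost only the factor
  25.\<close>

lemma hausdorff2_pre_negligible:
  fixes N :: "(real \<times> real) set"
  assumes N: "negligible N" and \<delta>: "0 < \<delta>"
  shows "hausdorff2_pre \<delta> N = 0"
proof -
  have "hausdorff2_pre \<delta> N \<le> ennreal (25 * e)" if e: "0 < e" for e
  proof -
    have "N \<in> sets lebesgue" "emeasure lebesgue N = 0"
      using N by (auto simp: negligible_iff_null_sets)
    then obtain T where T: "open T" "N \<subseteq> T" "emeasure lebesgue (T - N) < ennreal e"
      using sets_lebesgue_outer_open[OF _ e, of N] by metis
    have "emeasure lebesgue T = emeasure lebesgue (T - N)"
      using N T by (intro emeasure_Diff_null_set[symmetric]) (auto simp: negligible_iff_null_sets)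
    then have eT: "emeasure lborel T < ennreal e" using T by simp
    \<comment> \<open>The bound \<open>\<delta> / 10\<close> keeps the diameter of the fivefold disc
      at most \<open>\<delta>\<close>.\<close>
    define K where "K = {(x, r). x \<in> N \<and> 0 < r \<and> r \<le> \<delta> / 10 \<and> cball x r \<subseteq> T}"
    have r: "\<And>i. i \<in> K \<Longrightarrow> 0 < snd i \<and> snd i \<le> \<delta> / 10" by (auto simp: K_def)
    have cov: "N \<subseteq> (\<Union>i\<in>K. cball (fst i) (snd i))"
    proof
      fix x assume x: "x \<in> N"
      then obtain r where "0 < r" "cball x r \<subseteq> T" using T open_contains_cball by blast
      then have "(x, min r (\<delta> / 10)) \<in> K" using x \<delta> by (auto simp: K_def)
      then show "x \<in> (\<Union>i\<in>K. cball (fst i) (snd i))" using \<open>0 < r\<close> \<delta> by force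
    qed
    obtain C where C: "countable C" "C \<subseteq> K"
      "pairwise (\<lambda>i j. disjnt (cball (fst i) (snd i)) (cball (fst j) (snd j))) C"
      "N \<subseteq> (\<Union>i\<in>C. cball (fst i) (5 * snd i))"
      by (rule Vitali_covering_lemma_cballs[OF cov r]) (assumption | rule that)+
    have "hausdorff2_pre \<delta> N \<le> hausdorff2_pre \<delta> (\<Union>i\<in>C. cball (fst i) (5 * snd i))"
      by (rule hausdorff2_pre_mono[OF C(4)])
    also have "\<dots> \<le> ennreal (5\<^sup>2) * emeasure lborel (\<Union>i\<in>C. cball (fst i) (snd i))"
      using C(2) by (intro hausdorff2_pre_disjoint_cover[OF \<delta> C(1,3)] hausdorff2_pre_cball) (auto simp: K_def)
    also have "\<dots> \<le> ennreal (5\<^sup>2) * emeasure lborel T"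
    proof -
      have "cball (fst i) (snd i) \<subseteq> T" if "i \<in> K" for i using that by (auto simp: K_def)
      then have "(\<Union>i\<in>C. cball (fst i) (snd i)) \<subseteq> T" using C(2) by blast
      then show ?thesis using T by (intro mult_left_mono emeasure_mono) auto
    qed
    also have "\<dots> \<le> ennreal (5\<^sup>2) * ennreal e" using eT by (intro mult_left_mono) auto
    also have "\<dots> = ennreal (25 * e)" using e by (subst ennreal_mult[symmetric]) auto
    finally show ?thesis .
  qed
  from this[of "e / 25" for e] have "hausdorff2_pre \<delta> N \<le> 0 + ennreal e" if "0 < e" for e using that by simp
  then have "hausdorff2_pre \<delta> N \<le> 0" by (rule ennreal_le_epsilon)
  then show ?thesis by simp
qed

text \<open>By Vitali's covering theorem, disjoint discs of diameter at most \<open>\<delta>\<close>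
  fill \<open>U\<close> up to a negligible remainder. The discs weigh their area and the remainder
  nothing.\<close>

lemma hausdorff2_pre_open_le:
  fixes U :: "(real \<times> real) set"
  assumes U: "open U" and \<delta>: "0 < \<delta>"
  shows "hausdorff2_pre \<delta> U \<le> emeasure lborel U"
proof -
  define K where "K = {(x, r). 0 < r \<and> r \<le> \<delta> / 2 \<and> cball x r \<subseteq> U}"
  have r: "0 < snd i" if "i \<in> K" for i using that by (auto simp: K_def)
  have ex: "\<exists>i. i \<in> K \<and> x \<in> cball (fst i) (snd i) \<and> snd i < d" if x: "x \<in> U" and d: "0 < d" for x d
  proof -
    obtain r where "0 < r" "cball x r \<subseteq> U" using U x open_contains_cball by blast
    then show ?thesis using d \<delta>
      by (intro exI[of _ "(x, min r (min (\<delta> / 2) (d / 2)))"]) (auto simp: K_def)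
  qed
  obtain C where C: "countable C" "C \<subseteq> K"
     "pairwise (\<lambda>i j. disjnt (cball (fst i) (snd i)) (cball (fst j) (snd j))) C"
     "negligible (U - (\<Union>i \<in> C. cball (fst i) (snd i)))"
    by (rule Vitali_covering_theorem_cballs[where K=K and S=U and a=fst and r=snd, OF r ex]) (assumption | rule that)+
  let ?V = "\<Union>i \<in> C. cball (fst i) (snd i)"
  have "hausdorff2_pre \<delta> U \<le> hausdorff2_pre \<delta> (\<Union>n. binaryset ?V (U - ?V) n)"
    by (rule hausdorff2_pre_mono) (auto simp: UN_binaryset_eq)
  also have "\<dots> \<le> (\<Sum>n. hausdorff2_pre \<delta> (binaryset ?V (U - ?V) n))" using \<delta> by (rule hausdorff2_pre_UN)
  also have "\<dots> = hausdorff2_pre \<delta> ?V + hausdorff2_pre \<delta> (U - ?V)"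
    by (rule suminf_binaryset_eq) (rule hausdorff2_pre_empty[OF \<delta>])
  also have "\<dots> = hausdorff2_pre \<delta> ?V" by (simp add: hausdorff2_pre_negligible[OF C(4) \<delta>])
  also have "\<dots> \<le> ennreal (1\<^sup>2) * emeasure lborel ?V"
    by (rule hausdorff2_pre_disjoint_cover[OF \<delta> C(1,3)])
       (use hausdorff2_pre_cball[of _ 1 \<delta>] C(2) in \<open>auto simp: K_def\<close>)
  also have "\<dots> \<le> emeasure lborel U"
  proof -
    have "cball (fst i) (snd i) \<subseteq> U" if "i \<in> K" for i using that by (auto simp: K_def)
    then have "?V \<subseteq> U" using C(2) by blast
    then show ?thesis using U by (simp add: emeasure_mono)
  qed
  finally show ?thesis .
qed

theorem hausdorff2_outer_eq_lborel:
  fixes A :: "(real \<times> real) set"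
  assumes A: "A \<in> sets borel"
  shows "hausdorff2_outer A = emeasure lborel A"
proof (rule antisym)
  show "hausdorff2_outer A \<le> emeasure lborel A"
    unfolding hausdorff2_outer_def
  proof (rule SUP_least)
    fix \<delta> :: real assume \<delta>: "\<delta> \<in> {0<..}"
    show "hausdorff2_pre \<delta> A \<le> emeasure lborel A"
    proof (rule ennreal_le_epsilon)
      fix e :: real assume e: "0 < e"
      obtain U where U: "open U" "A \<subseteq> U" "emeasure lborel (U - A) < ennreal e"
        using outer_regular_lborel[OF A e] by metis
      have "hausdorff2_pre \<delta> A \<le> hausdorff2_pre \<delta> U" by (rule hausdorff2_pre_mono[OF U(2)])
      also have "\<dots> \<le> emeasure lborel U" using \<delta> U by (intro hausdorff2_pre_open_le) auto
      also have "\<dots> = emeasure lborel (A \<union> (U - A))" using U by (simp add: Un_absorb1)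
      also have "\<dots> \<le> emeasure lborel A + emeasure lborel (U - A)" using A U by (intro emeasure_subadditive) auto
      also have "\<dots> \<le> emeasure lborel A + ennreal e" using U by (intro add_left_mono) auto
      finally show "hausdorff2_pre \<delta> A \<le> emeasure lborel A + ennreal e" .
    qed
  qed
  \<comment> \<open>Scale 1 is already enough for the lower bound, because the isodiametric
    inequality holds for covering sets of any size. Passing to closures makes them Borel without
    changing their diameters.\<close>
  have "emeasure lborel A \<le> hausdorff2_pre 1 A"
    unfolding hausdorff2_pre_def
  proof (rule INF_greatest)
    fix C assume C: "C \<in> hausdorff2_covers 1 A"
    have "A \<subseteq> (\<Union>i. C i)" using C by (simp add: hausdorff2_covers_def)
    also have "\<dots> \<subseteq> (\<Union>i. closure (C i))" by (intro UN_mono closure_subset subset_refl)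
    finally have "A \<subseteq> (\<Union>i. closure (C i))" .
    then have "emeasure lborel A \<le> emeasure lborel (\<Union>i. closure (C i))" by (intro emeasure_mono) auto
    also have "\<dots> \<le> (\<Sum>i. emeasure lborel (closure (C i)))" by (intro emeasure_subadditive_countably) auto
    also have "\<dots> \<le> (\<Sum>i. ennreal (pi / 4 * (diameter (C i))\<^sup>2))"
    proof (intro suminf_le)
      fix i
      have b: "bounded (C i)" using C by (simp add: hausdorff2_covers_def)
      then show "emeasure lborel (closure (C i)) \<le> ennreal (pi / 4 * (diameter (C i))\<^sup>2)"
        using diameter_bounded_bound[OF bounded_closure[OF b]]
        by (intro isodiametric_inequality) (auto simp: diameter_closure diameter_ge_0)
    qed auto
    finally show "emeasure lborel A \<le> (\<Sum>i. ennreal (pi / 4 * (diameter (C i))\<^sup>2))" .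
  qed
  also have "\<dots> \<le> hausdorff2_outer A" by (rule hausdorff2_pre_le_outer) simp
  finally show "emeasure lborel A \<le> hausdorff2_outer A" .
qed

text \<open>A cover of \<open>A\<close> of mesh \<open>\<delta> / L\<close> is carried to a cover of
  the image of mesh \<open>\<delta>\<close>, and squared diameters grow at most by
  \<open>L\<^sup>2\<close>.\<close>

lemma hausdorff2_outer_lipschitz:
  fixes f :: "'a::metric_space \<Rightarrow> 'b::metric_space"
  assumes L: "0 < L" and f: "\<And>x y. x \<in> A \<Longrightarrow> y \<in> A \<Longrightarrow> dist (f x) (f y) \<le> L * dist x y"
  shows "hausdorff2_outer (f ` A) \<le> ennreal (L\<^sup>2) * hausdorff2_outer A"
  unfolding hausdorff2_outer_def[of "f ` A"]
proof (rule SUP_least)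
  fix \<delta> :: real assume \<delta>: "\<delta> \<in> {0<..}"
  have "hausdorff2_pre \<delta> (f ` A) \<le> ennreal (L\<^sup>2) * (\<Sum>i. ennreal (pi / 4 * (diameter (C i))\<^sup>2))"
    if C: "C \<in> hausdorff2_covers (\<delta> / L) A" for C
  proof -
    have Cb: "bounded (C i)" "diameter (C i) \<le> \<delta> / L" for i using C by (auto simp: hausdorff2_covers_def)
    have fC: "dist x y \<le> L * diameter (C i)" if "x \<in> f ` (C i \<inter> A)" "y \<in> f ` (C i \<inter> A)" for i x y
    proof -
      obtain u v where uv: "u \<in> C i" "u \<in> A" "v \<in> C i" "v \<in> A" "x = f u" "y = f v" using \<open>x \<in> _\<close> \<open>y \<in> _\<close> by auto
      then have "dist x y \<le> L * dist u v" using f by simp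
      also have "\<dots> \<le> L * diameter (C i)" using diameter_bounded_bound[OF Cb(1)] uv L by (intro mult_left_mono) auto
      finally show ?thesis .
    qed
    have bd: "bounded (f ` (C i \<inter> A))" for i
      unfolding bounded_two_points using fC by blast
    have dm: "diameter (f ` (C i \<inter> A)) \<le> L * diameter (C i)" for i
      using fC diameter_ge_0[OF Cb(1), of i] L
      by (auto simp: diameter_def[of "f ` (C i \<inter> A)"] split_beta intro!: cSUP_least)
    \<comment> \<open>The covering sets are cut down to \<open>A\<close> because \<open>f\<close> is
      controlled only there.\<close>
    have "(\<lambda>i. f ` (C i \<inter> A)) \<in> hausdorff2_covers \<delta> (f ` A)"
    proof -
      have "L * diameter (C i) \<le> \<delta>" for i using Cb(2)[of i] L by (simp add: field_simps)
      then have "diameter (f ` (C i \<inter> A)) \<le> \<delta>" for i using dm order_trans by blast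
      moreover have "A \<subseteq> (\<Union>i. C i)" using C by (simp add: hausdorff2_covers_def)
      then have "f ` A \<subseteq> (\<Union>i. f ` (C i \<inter> A))" by blast
      ultimately show ?thesis using bd by (simp add: hausdorff2_covers_def)
    qed
    then have "hausdorff2_pre \<delta> (f ` A) \<le> (\<Sum>i. ennreal (pi / 4 * (diameter (f ` (C i \<inter> A)))\<^sup>2))"
      by (rule hausdorff2_pre_le)
    also have "\<dots> \<le> (\<Sum>i. ennreal (L\<^sup>2) * ennreal (pi / 4 * (diameter (C i))\<^sup>2))"
    proof (intro suminf_le)
      fix i
      have "(diameter (f ` (C i \<inter> A)))\<^sup>2 \<le> (L * diameter (C i))\<^sup>2"
        using dm diameter_ge_0[OF bd] by (intro power_mono)
      then show "ennreal (pi / 4 * (diameter (f ` (C i \<inter> A)))\<^sup>2) \<le> ennreal (L\<^sup>2) * ennreal (pi / 4 * (diameter (C i))\<^sup>2)"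
        by (simp add: power_mult_distrib mult.left_commute flip: ennreal_mult)
    qed auto
    finally show ?thesis by simp
  qed
  \<comment> \<open>The constant is moved to the left, so that the right side is the bare sum whose
    infimum over covers is the premeasure.\<close>
  then have "ennreal (1 / L\<^sup>2) * hausdorff2_pre \<delta> (f ` A) \<le> ennreal (1 / L\<^sup>2) * (ennreal (L\<^sup>2) * (\<Sum>i. ennreal (pi / 4 * (diameter (C i))\<^sup>2)))"
    if "C \<in> hausdorff2_covers (\<delta> / L) A" for C using that by (intro mult_left_mono) auto
  moreover have cancel: "ennreal (1 / L\<^sup>2) * (ennreal (L\<^sup>2) * x) = x" "ennreal (L\<^sup>2) * (ennreal (1 / L\<^sup>2) * x) = x" for x
    using L by (simp_all flip: mult.assoc ennreal_mult)
  ultimately have "ennreal (1 / L\<^sup>2) * hausdorff2_pre \<delta> (f ` A) \<le> hausdorff2_pre (\<delta> / L) A"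
    unfolding hausdorff2_pre_def[of "\<delta> / L"] by (intro INF_greatest) simp
  then have "ennreal (L\<^sup>2) * (ennreal (1 / L\<^sup>2) * hausdorff2_pre \<delta> (f ` A)) \<le> ennreal (L\<^sup>2) * hausdorff2_pre (\<delta> / L) A"
    by (intro mult_left_mono) auto
  then have "hausdorff2_pre \<delta> (f ` A) \<le> ennreal (L\<^sup>2) * hausdorff2_pre (\<delta> / L) A" by (simp only: cancel)
  also have "\<dots> \<le> ennreal (L\<^sup>2) * hausdorff2_outer A"
    using \<delta> L by (intro mult_left_mono hausdorff2_pre_le_outer) auto
  finally show "hausdorff2_pre \<delta> (f ` A) \<le> ennreal (L\<^sup>2) * hausdorff2_outer A" .
qed

section \<open>The area formula for immersed surfaces\<close>

text \<open>On \<open>A\<close> the map \<open>f\<close> factors through \<open>g\<close> by an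
  \<open>L\<close>-Lipschitz map, since equal values of \<open>g\<close> force equal values of
  \<open>f\<close>. This serves to compare a parametrization with its linearization in both
  directions.\<close>

lemma hausdorff2_outer_lipschitz_images:
  fixes f :: "'c \<Rightarrow> 'a::metric_space" and g :: "'c \<Rightarrow> 'b::metric_space"
  assumes L: "0 < L" and fg: "\<And>x y. x \<in> A \<Longrightarrow> y \<in> A \<Longrightarrow> dist (f x) (f y) \<le> L * dist (g x) (g y)"
  shows "hausdorff2_outer (f ` A) \<le> ennreal (L\<^sup>2) * hausdorff2_outer (g ` A)"
proof -
  let ?i = "inv_into A g"
  have i: "?i (g x) \<in> A" "g (?i (g x)) = g x" if "x \<in> A" for x
    using that by (auto simp: inv_into_into f_inv_into_f)
  have fi: "f (?i (g x)) = f x" if "x \<in> A" for x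
    using fg[OF i(1)[OF that] that] i(2)[OF that] by simp
  have "(\<lambda>u. f (?i u)) ` (g ` A) = f ` A"
    using fi by (auto simp: image_iff)
  moreover have "hausdorff2_outer ((\<lambda>u. f (?i u)) ` (g ` A)) \<le> ennreal (L\<^sup>2) * hausdorff2_outer (g ` A)"
    by (rule hausdorff2_outer_lipschitz[OF L]) (use fi fg in auto)
  ultimately show ?thesis by simp
qed

text \<open>A triangular map can be undone by an affine substitution in one variable at a time, so
  Tonelli's theorem gives the determinant. By \<open>norm_triangular_eq\<close> this is enough for
  every injective linear map of the plane into space.\<close>

lemma emeasure_lborel_triangular_image:
  fixes \<alpha> \<beta> \<gamma> :: real
  defines "T \<equiv> \<lambda>h. (\<alpha> * fst h + \<beta> * snd h, \<gamma> * snd h)"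
  assumes pos: "0 < \<alpha>" "0 < \<gamma>" and E: "E \<in> sets borel"
  shows "T ` E \<in> sets borel" "emeasure lborel (T ` E) = ennreal (\<alpha> * \<gamma>) * emeasure lborel E"
proof -
  \<comment> \<open>The inverse of \<open>T\<close>; it exhibits the image as a preimage and hence
    as a Borel set.\<close>
  define S where "S w = ((fst w - \<beta> * snd w / \<gamma>) / \<alpha>, snd w / \<gamma>)" for w :: "real \<times> real"
  have ST: "S (T h) = h" "T (S h) = h" for h using pos by (simp_all add: S_def T_def field_simps)
  then have TE: "T ` E = S -` E" by (auto simp: image_iff) (metis ST)
  have S: "S \<in> borel_measurable borel"
    unfolding S_def using pos by (intro borel_measurable_continuous_onI continuous_intros) auto
  show TEb: "T ` E \<in> sets borel" using measurable_sets[OF S E] by (simp add: TE)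
  have I: "emeasure lborel B = (\<integral>\<^sup>+ v. (\<integral>\<^sup>+ u. indicator B (u, v) \<partial>lborel) \<partial>lborel)"
    if B: "B \<in> sets (borel :: (real \<times> real) measure)" for B
  proof -
    have "indicator B \<in> borel_measurable (lborel \<Otimes>\<^sub>M lborel :: (real \<times> real) measure)"
      using B unfolding lborel_prod by simp
    from lborel_pair.nn_integral_snd[OF this] show ?thesis
      using B unfolding lborel_prod by simp
  qed
  have m1: "(\<lambda>u. indicator (T ` E) (u, v)) \<in> borel_measurable (borel :: real measure)" for v
    by (rule measurable_compose[OF _ borel_measurable_indicator[OF TEb]])
       (intro borel_measurable_continuous_onI continuous_intros)
  have snd_measurable: "(\<lambda>v. \<integral>\<^sup>+ u. indicator B (u, v) \<partial>lborel) \<in> borel_measurable (borel :: real measure)"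
    if B: "B \<in> sets (borel :: (real \<times> real) measure)" for B
  proof -
    have "(\<lambda>w. indicator B (snd w, fst w)) \<in> borel_measurable (borel :: (real \<times> real) measure)"
      by (rule measurable_compose[OF _ borel_measurable_indicator[OF B]])
         (intro borel_measurable_continuous_onI continuous_intros)
    then have "case_prod (\<lambda>v u. indicator B (u, v)) \<in> borel_measurable (lborel \<Otimes>\<^sub>M lborel :: (real \<times> real) measure)"
      unfolding lborel_prod by (simp add: split_beta')
    from lborel.borel_measurable_nn_integral[OF this] show ?thesis by simp
  qed
  note m3 = snd_measurable[OF TEb] and m4 = snd_measurable[OF E]
  have ind: "indicator (T ` E) (\<beta> * v + \<alpha> * u, \<gamma> * v) = (indicator E (u, v) :: ennreal)" for u v
    using pos by (simp add: TE S_def indicator_def)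
  have "emeasure lborel (T ` E) = (\<integral>\<^sup>+ v. (\<integral>\<^sup>+ u. indicator (T ` E) (u, v) \<partial>lborel) \<partial>lborel)"
    by (rule I[OF TEb])
  also have "\<dots> = \<bar>\<gamma>\<bar> * (\<integral>\<^sup>+ v. (\<integral>\<^sup>+ u. indicator (T ` E) (u, 0 + \<gamma> * v) \<partial>lborel) \<partial>lborel)"
    using pos by (intro nn_integral_real_affine m3) auto
  also have "(\<lambda>v. \<integral>\<^sup>+ u. indicator (T ` E) (u, 0 + \<gamma> * v) \<partial>lborel) = (\<lambda>v. \<bar>\<alpha>\<bar> * (\<integral>\<^sup>+ u. indicator E (u, v) \<partial>lborel))"
  proof
    fix v
    have "(\<integral>\<^sup>+ u. indicator (T ` E) (u, 0 + \<gamma> * v) \<partial>lborel) =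
      \<bar>\<alpha>\<bar> * (\<integral>\<^sup>+ u. indicator (T ` E) (\<beta> * v + \<alpha> * u, 0 + \<gamma> * v) \<partial>lborel)"
      using pos by (intro nn_integral_real_affine m1) auto
    then show "(\<integral>\<^sup>+ u. indicator (T ` E) (u, 0 + \<gamma> * v) \<partial>lborel) = \<bar>\<alpha>\<bar> * (\<integral>\<^sup>+ u. indicator E (u, v) \<partial>lborel)"
      by (simp add: ind)
  qed
  also have "\<bar>\<gamma>\<bar> * (\<integral>\<^sup>+ v. \<bar>\<alpha>\<bar> * (\<integral>\<^sup>+ u. indicator E (u, v) \<partial>lborel) \<partial>lborel) = ennreal (\<alpha> * \<gamma>) * emeasure lborel E"
    using pos m4 by (subst nn_integral_cmult) (simp_all add: I[OF E] ennreal_mult mult_ac)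
  finally show "emeasure lborel (T ` E) = ennreal (\<alpha> * \<gamma>) * emeasure lborel E" .
qed

text \<open>The QR factorization of the matrix with columns \<open>p\<close> and \<open>q\<close>:
  up to an isometry onto the plane, the linear map with these columns is triangular, and its
  determinant is \<open>norm (cross3 p q)\<close>.\<close>

lemma norm_triangular_eq:
  fixes p q :: "real^3"
  assumes "p \<noteq> 0"
  shows "norm (norm p * a + (p \<bullet> q) / norm p * b, norm (cross3 p q) / norm p * b) = norm (a *\<^sub>R p + b *\<^sub>R q)"
proof -
  have n: "norm p \<noteq> 0" "(norm p)\<^sup>2 = p \<bullet> p" using assms by (simp_all add: power2_norm_eq_inner)
  have "(norm p * a + (p \<bullet> q) / norm p * b)\<^sup>2 + (norm (cross3 p q) / norm p * b)\<^sup>2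
     = (norm p)\<^sup>2 * a\<^sup>2 + 2 * a * b * (p \<bullet> q) + ((p \<bullet> q)\<^sup>2 + (norm (cross3 p q))\<^sup>2) / (norm p)\<^sup>2 * b\<^sup>2"
    using n(1) by (simp add: power2_eq_square field_simps)
  also have "((p \<bullet> q)\<^sup>2 + (norm (cross3 p q))\<^sup>2) / (norm p)\<^sup>2 = (norm q)\<^sup>2"
    using n(1) by (simp add: norm_cross)
  also have "(norm p)\<^sup>2 * a\<^sup>2 + 2 * a * b * (p \<bullet> q) + (norm q)\<^sup>2 * b\<^sup>2 = (norm (a *\<^sub>R p + b *\<^sub>R q))\<^sup>2"
    unfolding power2_norm_eq_inner
    by (simp add: inner_add_left inner_add_right inner_commute[of q p] power2_eq_square algebra_simps)
  finally have "sqrt ((norm p * a + (p \<bullet> q) / norm p * b)\<^sup>2 + (norm (cross3 p q) / norm p * b)\<^sup>2) = norm (a *\<^sub>R p + b *\<^sub>R q)"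
    by simp
  then show ?thesis unfolding norm_prod_def fst_conv snd_conv real_norm_def power2_abs .
qed

section \<open>Injective immersions of a planar open set\<close>

locale immersion_parametrization =
  fixes P p q :: "real \<times> real \<Rightarrow> real^3" and R :: "(real \<times> real) set"
  assumes open_R: "open R" and inj_P: "inj_on P R"
    and deriv_P: "\<And>z. z \<in> R \<Longrightarrow> (P has_derivative (\<lambda>h. fst h *\<^sub>R p z + snd h *\<^sub>R q z)) (at z)"
    and cont_p: "continuous_on R p" and cont_q: "continuous_on R q"
    and immersion: "\<And>z. z \<in> R \<Longrightarrow> cross3 (p z) (q z) \<noteq> 0"
begin

abbreviation J :: "real \<times> real \<Rightarrow> real" where "J z \<equiv> norm (cross3 (p z) (q z))"

text \<open>Surface area pulled back to the parameters; the indicator extends it by zero to the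
  whole plane.\<close>

definition \<mu> :: "(real \<times> real) measure" where
  "\<mu> = density lborel (\<lambda>z. ennreal (indicator R z * J z))"

lemma continuous_on_J: "continuous_on R J"
  by (intro continuous_on_norm continuous_on_cross cont_p cont_q)

lemma R_borel: "R \<in> sets borel" using open_R by simp

lemma J_measurable [measurable]: "(\<lambda>z. indicator R z * J z) \<in> borel_measurable borel"
  using borel_measurable_continuous_on_indicator[OF _ continuous_on_J] R_borel by simp

lemma continuous_on_P: "continuous_on R P"
  by (meson continuous_at_imp_continuous_on deriv_P has_derivative_continuous)

lemma sets_\<mu> [simp]: "sets \<mu> = sets borel" by (simp add: \<mu>_def)

lemma emeasure_\<mu>: "A \<in> sets borel \<Longrightarrow> emeasure \<mu> A = (\<integral>\<^sup>+ z. ennreal (indicator R z * J z) * indicator A z \<partial>lborel)"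
  unfolding \<mu>_def by (rule emeasure_density) auto

text \<open>Open subsets of \<open>R\<close> are countable unions of compact sets, so their images
  are Borel. Injectivity carries complements to relative complements, which makes the sets with
  Borel image a sigma-algebra.\<close>

lemma image_borel:
  assumes "E \<in> sets borel"
  shows "P ` (E \<inter> R) \<in> sets borel"
proof -
  have op: "P ` (E \<inter> R) \<in> sets borel" if "open E" for E :: "(real \<times> real) set"
  proof -
    have "open (E \<inter> R)" using that open_R by (rule open_Int)
    then obtain C :: "nat \<Rightarrow> (real \<times> real) set" where C: "\<And>n. compact (C n)" "\<And>n. C n \<subseteq> E \<inter> R" "(\<Union>n. C n) = E \<inter> R"
      by (rule open_Union_compact_subsets) blast
    have "compact (P ` C n)" for n
      using C by (intro compact_continuous_image continuous_on_subset[OF continuous_on_P]) auto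
    then have "P ` C n \<in> sets borel" for n by (simp add: borel_closed compact_imp_closed)
    then have "(\<Union>n. P ` C n) \<in> sets borel" by auto
    also have "(\<Union>n. P ` C n) = P ` (E \<inter> R)" using C(3) by blast
    finally show ?thesis .
  qed
  have R: "P ` R \<in> sets borel" using op[of UNIV] by simp
  from assms have "E \<in> sigma_sets UNIV {S. open S}" by (simp add: sets_borel)
  then show ?thesis
  proof induction
    case (Basic a) then show ?case using op by simp
  next
    case (Compl a)
    have "P ` ((UNIV - a) \<inter> R) = P ` R - P ` (a \<inter> R)"
      using inj_P by (auto simp: inj_on_def)
    then show ?case using Compl R by simp
  next
    case (Union a)
    have "P ` (\<Union> (range a) \<inter> R) = (\<Union>i. P ` (a i \<inter> R))" by blast
    then show ?case using Union by simp
  qed simp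
qed

text \<open>Near \<open>z0\<close> the map \<open>P\<close> distorts distances by at most the factor
  \<open>c\<close> compared with the planar map \<open>T\<close>, which contributes
  \<open>c\<^sup>2\<close> to areas, and the density \<open>J\<close> is within a factor
  \<open>c\<close> of its value at \<open>z0\<close>.\<close>

lemma local_area_estimate:
  assumes z0: "z0 \<in> R" and c: "1 < c"
  shows "\<exists>r>0. ball z0 r \<subseteq> R \<and> (\<forall>A\<in>sets borel. A \<subseteq> ball z0 r \<longrightarrow>
    hausdorff2_outer (P ` A) \<le> ennreal (c ^ 3) * emeasure \<mu> A \<and>
    emeasure \<mu> A \<le> ennreal (c ^ 3) * hausdorff2_outer (P ` A))"
proof -
  define p0 q0 where "p0 = p z0" and "q0 = q z0"
  define \<alpha> \<beta> \<gamma> where "\<alpha> = norm p0" and "\<beta> = (p0 \<bullet> q0) / norm p0" and "\<gamma> = norm (cross3 p0 q0) / norm p0"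
  define T where "T h = (\<alpha> * fst h + \<beta> * snd h, \<gamma> * snd h)" for h
  define L where "L h = fst h *\<^sub>R p0 + snd h *\<^sub>R q0" for h :: "real \<times> real"
  have cr: "cross3 p0 q0 \<noteq> 0" using immersion[OF z0] by (simp add: p0_def q0_def)
  then have p0: "p0 \<noteq> 0" by auto
  have pos: "0 < \<alpha>" "0 < \<gamma>" using p0 cr by (simp_all add: \<alpha>_def \<gamma>_def)
  have J0: "J z0 = \<alpha> * \<gamma>" "0 < J z0" using p0 cr by (simp_all add: \<alpha>_def \<gamma>_def flip: p0_def q0_def)
  have TL: "norm (T h) = norm (L h)" for h
    using norm_triangular_eq[OF p0, of "fst h" q0 "snd h"] by (simp add: T_def L_def \<alpha>_def \<beta>_def \<gamma>_def)
  have linT: "linear T" unfolding T_def by (rule linearI) (auto simp: algebra_simps)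
  have blL: "bounded_linear L" unfolding L_def
    by (intro bounded_linear_add bounded_linear_scaleR_const bounded_linear_fst bounded_linear_snd)
  have injT: "inj T" using pos by (auto simp: inj_on_def T_def prod_eq_iff)
  obtain m where m: "m > 0" "\<And>h. m * norm h \<le> norm (T h)"
    using linear_inj_bounded_below_pos[OF linT injT] by blast
  \<comment> \<open>Each partial derivative errs by at most \<open>e\<close>, so the linearization
    errs by \<open>2 * e\<close> per unit length. The two entries of the minimum make this at most
    \<open>c - 1\<close> and \<open>1 - 1 / c\<close> times the norm of \<open>T h\<close>, as the
    upper and the lower Lipschitz bound require.\<close>
  define e where "e = m * min (c - 1) (1 - 1 / c) / 2"
  have e: "0 < e" "2 * e \<le> m * (c - 1)" "2 * e \<le> m * (1 - 1 / c)" 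
  proof -
    have "2 * e = m * min (c - 1) (1 - 1 / c)" by (simp add: e_def)
    moreover have "m * min (c - 1) (1 - 1 / c) \<le> m * (c - 1)" "m * min (c - 1) (1 - 1 / c) \<le> m * (1 - 1 / c)"
      using m by (auto intro!: mult_left_mono)
    ultimately show "2 * e \<le> m * (c - 1)" "2 * e \<le> m * (1 - 1 / c)" by simp_all
    show "0 < e" using m c by (simp add: e_def)
  qed
  define e' where "e' = min (c - 1) (1 - 1 / c) * J z0"
  have e': "0 < e'" using c J0(2) by (simp add: e'_def min_def)
  have lim: "(f \<longlongrightarrow> f z0) (nhds z0)" if "continuous_on R f" for f :: "real \<times> real \<Rightarrow> 'z::metric_space"
    using that z0 open_R by (simp add: continuous_on_eq_continuous_at continuous_at tendsto_at_iff_tendsto_nhds)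
  have "\<forall>\<^sub>F z in nhds z0. z \<in> R \<and> dist (p z) p0 < e \<and> dist (q z) q0 < e \<and> dist (J z) (J z0) < e'"
    unfolding p0_def q0_def
    by (intro eventually_conj eventually_nhds_in_open open_R z0 tendstoD[OF lim] cont_p cont_q continuous_on_J e(1) e')
  then obtain r where r0: "r > 0" "\<And>z. dist z z0 < r \<Longrightarrow>
      z \<in> R \<and> dist (p z) p0 < e \<and> dist (q z) q0 < e \<and> dist (J z) (J z0) < e'"
    unfolding eventually_nhds_metric by blast
  have r: "r > 0" "ball z0 r \<subseteq> R" using r0 by (auto simp: dist_commute)
  have near: "norm (p z - p0) < e" "norm (q z - q0) < e" "J z0 / c \<le> J z" "J z \<le> c * J z0" if "z \<in> ball z0 r" for z
  proof -
    have "dist z z0 < r" using that by (simp add: dist_commute)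
    note near = r0(2)[OF this]
    show "norm (p z - p0) < e" "norm (q z - q0) < e" using near by (auto simp: dist_norm)
    have *: "\<bar>J z - J z0\<bar> < min (c - 1) (1 - 1 / c) * J z0" using near by (simp add: dist_real_def e'_def)
    have "min (c - 1) (1 - 1 / c) * J z0 \<le> (c - 1) * J z0" "min (c - 1) (1 - 1 / c) * J z0 \<le> (1 - 1 / c) * J z0"
      using J0 by (auto intro!: mult_right_mono)
    with * have "\<bar>J z - J z0\<bar> \<le> (c - 1) * J z0" "\<bar>J z - J z0\<bar> \<le> (1 - 1 / c) * J z0" by linarith+
    then show "J z0 / c \<le> J z" "J z \<le> c * J z0" by (auto simp: algebra_simps)
  qed
  \<comment> \<open>Bounding the derivative of the difference on a ball, rather than expanding
    \<open>P\<close> at \<open>z0\<close>, gives an estimate for arbitrary pairs of points.\<close>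
  have PL: "norm ((P x - L x) - (P y - L y)) \<le> 2 * e * norm (x - y)" if "x \<in> ball z0 r" "y \<in> ball z0 r" for x y
  proof (rule differentiable_bound[OF convex_ball _ _ that])
    fix z assume z: "z \<in> ball z0 r"
    show "((\<lambda>x. P x - L x) has_derivative (\<lambda>h. fst h *\<^sub>R p z + snd h *\<^sub>R q z - L h)) (at z within ball z0 r)"
      using z r by (intro has_derivative_at_withinI[OF has_derivative_diff[OF deriv_P bounded_linear_imp_has_derivative[OF blL]]]) auto
    show "onorm (\<lambda>h. fst h *\<^sub>R p z + snd h *\<^sub>R q z - L h) \<le> 2 * e"
    proof (rule onorm_le)
      fix h :: "real \<times> real"
      have "fst h *\<^sub>R p z + snd h *\<^sub>R q z - L h = fst h *\<^sub>R (p z - p0) + snd h *\<^sub>R (q z - q0)"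
        by (simp add: L_def algebra_simps)
      also have "norm \<dots> \<le> \<bar>fst h\<bar> * norm (p z - p0) + \<bar>snd h\<bar> * norm (q z - q0)"
        using norm_triangle_ineq[of "fst h *\<^sub>R (p z - p0)" "snd h *\<^sub>R (q z - q0)"] by simp
      also have "\<dots> \<le> norm h * e + norm h * e"
        using near[OF z] norm_fst_le[of "fst h" "snd h"] norm_snd_le[of "snd h" "fst h"] by (intro add_mono mult_mono) auto
      finally show "norm (fst h *\<^sub>R p z + snd h *\<^sub>R q z - L h) \<le> 2 * e * norm h" by simp
    qed
  qed
  have bi: "dist (P x) (P y) \<le> c * dist (T x) (T y)" "dist (T x) (T y) \<le> c * dist (P x) (P y)"
    if xy: "x \<in> ball z0 r" "y \<in> ball z0 r" for x y
  proof -
    have T: "dist (T x) (T y) = norm (L x - L y)"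
      using TL[of "x - y"] linear_diff[OF linT, of x y] linear_diff[OF bounded_linear.linear[OF blL], of x y] by (simp add: dist_norm)
    have tri: "\<bar>norm (P x - P y) - norm (L x - L y)\<bar> \<le> norm ((P x - L x) - (P y - L y))"
      using norm_triangle_ineq3[of "P x - P y" "L x - L y"] by (simp add: algebra_simps)
    have mm: "m * norm (x - y) \<le> dist (T x) (T y)" using m(2)[of "x - y"] linear_diff[OF linT, of x y] by (simp add: dist_norm)
    have "\<bar>norm (P x - P y) - dist (T x) (T y)\<bar> \<le> k * dist (T x) (T y)" if "2 * e \<le> m * k" "0 \<le> k" for k
    proof -
      have "\<bar>norm (P x - P y) - dist (T x) (T y)\<bar> \<le> 2 * e * norm (x - y)"
        using tri PL[OF xy] T by linarith
      also have "\<dots> \<le> m * k * norm (x - y)" using that by (intro mult_right_mono) auto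
      also have "\<dots> = k * (m * norm (x - y))" by simp
      also have "\<dots> \<le> k * dist (T x) (T y)" using mm that by (intro mult_left_mono) auto
      finally show ?thesis .
    qed
    from this[OF e(2)] this[OF e(3)] c
    have "\<bar>norm (P x - P y) - dist (T x) (T y)\<bar> \<le> (c - 1) * dist (T x) (T y)"
      "\<bar>norm (P x - P y) - dist (T x) (T y)\<bar> \<le> (1 - 1 / c) * dist (T x) (T y)" by auto
    then have "norm (P x - P y) \<le> c * dist (T x) (T y)" "dist (T x) (T y) / c \<le> norm (P x - P y)"
      by (auto simp: algebra_simps)
    then show "dist (P x) (P y) \<le> c * dist (T x) (T y)" "dist (T x) (T y) \<le> c * dist (P x) (P y)"
      using c by (auto simp: dist_norm[of "P x"] field_simps)
  qed
  have "hausdorff2_outer (P ` A) \<le> ennreal (c ^ 3) * emeasure \<mu> A \<and> emeasure \<mu> A \<le> ennreal (c ^ 3) * hausdorff2_outer (P ` A)"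
    if A: "A \<in> sets borel" "A \<subseteq> ball z0 r" for A
  proof -
    have TA: "hausdorff2_outer (T ` A) = ennreal (J z0) * emeasure lborel A"
      using emeasure_lborel_triangular_image[OF pos A(1), of \<beta>] hausdorff2_outer_eq_lborel J0
      by (simp add: T_def[abs_def])
    have c0: "0 < c" using c by simp
    have AB: "x \<in> ball z0 r" if "x \<in> A" for x using A(2) that by blast
    have H1: "hausdorff2_outer (P ` A) \<le> ennreal (c\<^sup>2) * hausdorff2_outer (T ` A)"
      by (rule hausdorff2_outer_lipschitz_images[OF c0 bi(1)[OF AB AB]])
    have H2: "hausdorff2_outer (T ` A) \<le> ennreal (c\<^sup>2) * hausdorff2_outer (P ` A)"
      by (rule hausdorff2_outer_lipschitz_images[OF c0 bi(2)[OF AB AB]])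
    have const: "(\<integral>\<^sup>+ z. ennreal k * indicator A z \<partial>lborel) = ennreal k * emeasure lborel A" for k
      using A by (simp add: nn_integral_cmult_indicator)
    have "ennreal (J z0 / c) * emeasure lborel A \<le> emeasure \<mu> A"
      unfolding emeasure_\<mu>[OF A(1)] const[symmetric]
      using near(3) A(2) r(2) by (intro nn_integral_mono) (auto simp: indicator_def intro!: ennreal_leI)
    then have "ennreal c * (ennreal (J z0 / c) * emeasure lborel A) \<le> ennreal c * emeasure \<mu> A"
      by (intro mult_left_mono) auto
    moreover have "ennreal c * (ennreal (J z0 / c) * emeasure lborel A) = ennreal (J z0) * emeasure lborel A"
      using c J0 by (simp add: mult.assoc[symmetric] ennreal_mult[symmetric])
    ultimately have M1: "hausdorff2_outer (T ` A) \<le> ennreal c * emeasure \<mu> A" by (simp add: TA)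
    have "emeasure \<mu> A \<le> ennreal (c * J z0) * emeasure lborel A"
      unfolding emeasure_\<mu>[OF A(1)] const[symmetric]
      using near(4) A(2) r(2) by (intro nn_integral_mono) (auto simp: indicator_def intro!: ennreal_leI)
    then have M2: "emeasure \<mu> A \<le> ennreal c * hausdorff2_outer (T ` A)"
      using c J0 by (simp add: TA ennreal_mult mult.assoc)
    have c3: "ennreal (c\<^sup>2) * (ennreal c * x) = ennreal (c ^ 3) * x" "ennreal c * (ennreal (c\<^sup>2) * x) = ennreal (c ^ 3) * x" for x
      using c by (simp_all add: mult.assoc[symmetric] ennreal_mult[symmetric] power2_eq_square power3_eq_cube)
    have "hausdorff2_outer (P ` A) \<le> ennreal (c\<^sup>2) * (ennreal c * emeasure \<mu> A)"
      by (rule order_trans[OF H1 mult_left_mono[OF M1 zero_le]])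
    moreover have "emeasure \<mu> A \<le> ennreal c * (ennreal (c\<^sup>2) * hausdorff2_outer (P ` A))"
      by (rule order_trans[OF M2 mult_left_mono[OF H2 zero_le]])
    ultimately show ?thesis by (simp add: c3)
  qed
  with r show ?thesis by blast
qed

lemma ennreal_le_of_le_mult_cube:
  assumes "\<And>c. 1 < c \<Longrightarrow> x \<le> ennreal (c ^ 3) * y"
  shows "x \<le> y"
proof (cases "y = top")
  case False
  have "(\<lambda>n. (1 + inverse (real (Suc n))) ^ 3) \<longlonglongrightarrow> (1 + 0) ^ 3"
    by (intro tendsto_intros LIMSEQ_inverse_real_of_nat)
  then have "(\<lambda>n. ennreal ((1 + inverse (real (Suc n))) ^ 3)) \<longlonglongrightarrow> ennreal 1"
    by (intro tendsto_ennrealI) simp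
  then have "(\<lambda>n. y * ennreal ((1 + inverse (real (Suc n))) ^ 3)) \<longlonglongrightarrow> y * ennreal 1"
    using False by (intro ennreal_tendsto_cmult) (auto simp: less_top)
  moreover have "x \<le> y * ennreal ((1 + inverse (real (Suc n))) ^ 3)" for n
    using assms[of "1 + inverse (real (Suc n))"] by (simp add: mult.commute)
  ultimately have "x \<le> y * ennreal 1" by (intro LIMSEQ_le_const) auto
  then show ?thesis by simp
qed simp

text \<open>Countably many open sets with the local estimate cover \<open>R\<close>. Made disjoint,
  they split \<open>E\<close> into pieces over which the estimate is summed with one fixed
  \<open>c\<close>, and then \<open>c\<close> tends to 1.\<close>

lemma emeasure_hausdorff2_image:
  assumes E: "E \<in> sets borel" "E \<subseteq> R"
  shows "emeasure hausdorff2 (P ` E) = emeasure \<mu> E"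
proof -
  have both: "emeasure hausdorff2 (P ` E) \<le> ennreal (c ^ 3) * emeasure \<mu> E \<and>
    emeasure \<mu> E \<le> ennreal (c ^ 3) * emeasure hausdorff2 (P ` E)" if c: "1 < c" for c
  proof (cases "R = {}")
    case True then show ?thesis using E by simp
  next
    case False
    let ?good = "\<lambda>U. \<forall>A\<in>sets borel. A \<subseteq> U \<longrightarrow>
      hausdorff2_outer (P ` A) \<le> ennreal (c ^ 3) * emeasure \<mu> A \<and>
      emeasure \<mu> A \<le> ennreal (c ^ 3) * hausdorff2_outer (P ` A)"
    define F where "F = {U. open U \<and> ?good U}"
    have RF: "R \<subseteq> \<Union>F"
    proof
      fix z assume "z \<in> R"
      from local_area_estimate[OF this c] obtain r where "r > 0" "?good (ball z r)" by blast
      then have "ball z r \<in> F" "z \<in> ball z r" by (auto simp: F_def)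
      then show "z \<in> \<Union>F" by blast
    qed
    obtain F' where F': "F' \<subseteq> F" "countable F'" "\<Union>F' = \<Union>F"
      by (rule Lindelof[of F]) (auto simp: F_def)
    have ne: "F' \<noteq> {}" 
    proof
      assume "F' = {}"
      then have "\<Union>F = {}" using F'(3) by simp
      then show False using RF False by blast
    qed
    define B where "B = from_nat_into F'"
    have B: "B n \<in> F" for n using from_nat_into[OF ne] F'(1) by (auto simp: B_def)
    have UB: "(\<Union>n. B n) = \<Union>F" using range_from_nat_into[OF ne F'(2)] F'(3) by (simp add: B_def)
    define D where "D n = E \<inter> disjointed B n" for n
    have Bb: "range B \<subseteq> sets borel" using B by (auto simp: F_def)
    have Db: "D n \<in> sets borel" for n using sets.range_disjointed_sets[OF Bb] E by (auto simp: D_def)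
    have DU: "(\<Union>n. D n) = E"
      using E RF UB by (auto simp: D_def UN_disjointed_eq simp flip: Int_UN_distrib)
    have dD: "disjoint_family D" using disjoint_family_disjointed[of B] unfolding D_def disjoint_family_on_def by blast
    have DR: "D n \<subseteq> R" for n using E by (auto simp: D_def)
    have PD: "P ` D n \<in> sets borel" for n
      using image_borel[OF Db[of n]] DR[of n] by (simp add: Int_absorb2)
    have dP: "disjoint_family (\<lambda>n. P ` D n)"
    proof -
      have "P ` D m \<inter> P ` D n = {}" if "D m \<inter> D n = {}" for m n
        using inj_on_image_Int[OF inj_P DR DR, of m n] that by simp
      then show ?thesis using dD unfolding disjoint_family_on_def by blast
    qed
    have est: "emeasure hausdorff2 (P ` D n) \<le> ennreal (c ^ 3) * emeasure \<mu> (D n)"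
      "emeasure \<mu> (D n) \<le> ennreal (c ^ 3) * emeasure hausdorff2 (P ` D n)" for n
    proof -
      have "?good (B n)" "D n \<subseteq> B n" using B[of n] disjointed_subset[of B n] by (auto simp: F_def D_def)
      then show "emeasure hausdorff2 (P ` D n) \<le> ennreal (c ^ 3) * emeasure \<mu> (D n)"
        "emeasure \<mu> (D n) \<le> ennreal (c ^ 3) * emeasure hausdorff2 (P ` D n)"
        using Db[of n] emeasure_hausdorff2[OF PD[of n]] by simp_all
    qed
    have s1: "emeasure hausdorff2 (P ` E) = (\<Sum>n. emeasure hausdorff2 (P ` D n))"
    proof -
      have "(\<Sum>n. emeasure hausdorff2 (P ` D n)) = emeasure hausdorff2 (\<Union>n. P ` D n)"
        using PD dP by (intro suminf_emeasure) auto
      also have "(\<Union>n. P ` D n) = P ` E" using DU by blast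
      finally show ?thesis ..
    qed
    have s2: "emeasure \<mu> E = (\<Sum>n. emeasure \<mu> (D n))"
    proof -
      have "(\<Sum>n. emeasure \<mu> (D n)) = emeasure \<mu> (\<Union>n. D n)"
        using Db dD by (intro suminf_emeasure) auto
      then show ?thesis by (simp add: DU)
    qed
    show ?thesis
      unfolding s1 s2 ennreal_suminf_cmult[symmetric]
      by (intro conjI suminf_le est) auto
  qed
  show ?thesis
    using both by (blast intro: antisym[OF ennreal_le_of_le_mult_cube ennreal_le_of_le_mult_cube])
qed

lemma image_R_borel: "P ` R \<in> sets borel"
  using image_borel[of UNIV] by simp

text \<open>Restricted to the image of \<open>R\<close>, the Hausdorff measure is the push-forward
  of \<open>\<mu>\<close>; the integral formula is the change of variables for that
  push-forward.\<close>

theorem integral_hausdorff2_image: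
  fixes h :: "real^3 \<Rightarrow> real"
  assumes P: "P \<in> borel_measurable borel" and h: "h \<in> borel_measurable borel"
  shows "(LINT x:P ` R|hausdorff2. h x) = (LINT z:R|lborel. J z * h (P z))"
proof -
  have eq: "density hausdorff2 (\<lambda>x. ennreal (indicator (P ` R) x)) = distr \<mu> borel P"
  proof (rule measure_eqI)
    fix B :: "(real^3) set" assume "B \<in> sets (density hausdorff2 (\<lambda>x. ennreal (indicator (P ` R) x)))"
    then have B: "B \<in> sets borel" by simp
    have PB: "P -` B \<in> sets borel" using measurable_sets[OF P B] by simp
    have "emeasure (distr \<mu> borel P) B = emeasure \<mu> (P -` B)"
      using P B by (subst emeasure_distr) (auto simp: \<mu>_def)
    also have "\<dots> = emeasure \<mu> (P -` B \<inter> R)"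
      using PB R_borel by (subst (1 2) emeasure_\<mu>) (auto intro!: nn_integral_cong simp: indicator_def)
    also have "\<dots> = emeasure hausdorff2 (P ` (P -` B \<inter> R))"
      using PB R_borel by (intro emeasure_hausdorff2_image[symmetric]) auto
    also have "P ` (P -` B \<inter> R) = P ` R \<inter> B" by auto
    also have "emeasure hausdorff2 (P ` R \<inter> B) = emeasure (density hausdorff2 (indicator (P ` R))) B"
      using image_R_borel B by (intro emeasure_restricted[symmetric]) auto
    also have "\<dots> = emeasure (density hausdorff2 (\<lambda>x. ennreal (indicator (P ` R) x))) B"
      by (simp add: ennreal_indicator)
    finally show "emeasure (density hausdorff2 (\<lambda>x. ennreal (indicator (P ` R) x))) B = emeasure (distr \<mu> borel P) B" ..
  qed simp
  have "(LINT x:P ` R|hausdorff2. h x) = integral\<^sup>L (density hausdorff2 (\<lambda>x. ennreal (indicator (P ` R) x))) h"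
    unfolding set_lebesgue_integral_def
    using h image_R_borel by (subst integral_real_density) (auto simp: borel_measurable_indicator)
  also have "\<dots> = integral\<^sup>L \<mu> (\<lambda>z. h (P z))"
    unfolding eq using P h by (subst integral_distr) (auto simp: \<mu>_def)
  also have "\<dots> = (LINT z:R|lborel. J z * h (P z))"
    unfolding \<mu>_def set_lebesgue_integral_def
    using measurable_compose[OF P h] J_measurable
    by (subst integral_real_density) (auto simp: mult.assoc)
  finally show ?thesis .
qed

end

section \<open>Smoothly parametrized spheres\<close>

unbundle cross3_syntax

text \<open>Cramer's rule in the basis \<open>p\<close>, \<open>q\<close>,
  \<open>p \<times> q\<close>, cleared of its denominator so that it is a polynomial identity valid
  for dependent vectors as well.\<close>

lemma cross3_decomposition:
  fixes p q v :: "real^3"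
  shows "((p \<times> q) \<bullet> (p \<times> q)) *\<^sub>R v =
    ((v \<times> q) \<bullet> (p \<times> q)) *\<^sub>R p + ((p \<times> v) \<bullet> (p \<times> q)) *\<^sub>R q + (v \<bullet> (p \<times> q)) *\<^sub>R (p \<times> q)"
  by (simp add: vec_eq_iff forall_3 cross_components inner_vec_def sum_3 algebra_simps)

lemma orthonormal_pair_expansion:
  fixes p q v :: "real^3"
  assumes "norm p = 1" "norm q = 1" "p \<bullet> q = 0"
  shows "v = (v \<bullet> p) *\<^sub>R p + (v \<bullet> q) *\<^sub>R q + (v \<bullet> (p \<times> q)) *\<^sub>R (p \<times> q)" "norm (p \<times> q) = 1"
proof -
  have u: "p \<bullet> p = 1" "q \<bullet> q = 1" "q \<bullet> p = 0" using assms by (simp_all add: norm_eq_1 inner_commute)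
  have "(p \<times> q) \<bullet> (p \<times> q) = 1" by (simp add: dot_cross u assms)
  then show "v = (v \<bullet> p) *\<^sub>R p + (v \<bullet> q) *\<^sub>R q + (v \<bullet> (p \<times> q)) *\<^sub>R (p \<times> q)" "norm (p \<times> q) = 1"
    using cross3_decomposition[of p q v] assms by (simp_all add: dot_cross u norm_eq_1 inner_commute)
qed

lemma exists_orthonormal_complement:
  fixes y :: "real^3"
  assumes y: "norm y = 1"
  obtains a b where "norm a = 1" "norm b = 1" "a \<bullet> b = 0" "a \<bullet> y = 0" "b \<bullet> y = 0" "a \<times> b = y"
proof -
  obtain e where e: "y \<times> e \<noteq> 0" using cross_basis_nonzero[of y] y by (metis norm_zero zero_neq_one)
  define a where "a = (y \<times> e) /\<^sub>R norm (y \<times> e)"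
  define b where "b = y \<times> a"
  have a: "norm a = 1" "a \<bullet> y = 0" using e by (simp_all add: a_def dot_cross_self)
  have yy: "y \<bullet> y = 1" "a \<bullet> a = 1" using y a by (simp_all add: norm_eq_1)
  have "a \<times> b = y" by (simp add: b_def Lagrange yy a)
  moreover have "norm b = 1" using a yy by (simp add: b_def norm_eq_1 dot_cross inner_commute)
  moreover have "a \<bullet> b = 0" "b \<bullet> y = 0" by (simp_all add: b_def dot_cross_self)
  ultimately show thesis using that a by blast
qed

text \<open>The cofactor matrix of \<open>A\<close> applied to \<open>u\<close>. It expresses the
  cross product of two images through the cross product of the arguments alone.\<close>

definition cofactor3 :: "(real^3 \<Rightarrow> real^3) \<Rightarrow> real^3 \<Rightarrow> real^3" where
  "cofactor3 A u = u$1 *\<^sub>R (A (axis 2 1) \<times> A (axis 3 1)) + u$2 *\<^sub>R (A (axis 3 1) \<times> A (axis 1 1))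
     + u$3 *\<^sub>R (A (axis 1 1) \<times> A (axis 2 1))"

lemma cross3_linear_image_eq_cofactor3:
  assumes "linear A"
  shows "A a \<times> A b = cofactor3 A (a \<times> b)"
proof -
  have *: "A v = v$1 *\<^sub>R A (axis 1 1) + v$2 *\<^sub>R A (axis 2 1) + v$3 *\<^sub>R A (axis 3 1)" for v
  proof -
    have "v = v$1 *\<^sub>R axis 1 1 + v$2 *\<^sub>R axis 2 1 + v$3 *\<^sub>R axis 3 1"
      by (simp add: vec_eq_iff forall_3 axis_def)
    then have "A v = A (v$1 *\<^sub>R axis 1 1 + v$2 *\<^sub>R axis 2 1 + v$3 *\<^sub>R axis 3 1)" by simp
    then show ?thesis by (simp only: linear_add[OF assms] linear_scale[OF assms])
  qed
  show ?thesis
    unfolding *[of a] *[of b] cofactor3_def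
    by (simp add: vec_eq_iff forall_3 cross_components algebra_simps)
qed

lemma cofactor3_scaleR: "cofactor3 A (c *\<^sub>R u) = c *\<^sub>R cofactor3 A u"
  by (simp add: cofactor3_def algebra_simps)

text \<open>The off-diagonal entry of a symmetric form in the frame rotated by an angle changes sign over a
  quarter turn.\<close>

lemma symmetric_plane_eigenvectors:
  fixes A :: "real^3 \<Rightarrow> real^3" and n :: "real^3"
  assumes n: "norm n = 1" and A: "linear A"
    and inv: "\<And>u. u \<bullet> n = 0 \<Longrightarrow> A u \<bullet> n = 0"
    and sym: "\<And>u v. u \<bullet> n = 0 \<Longrightarrow> v \<bullet> n = 0 \<Longrightarrow> A u \<bullet> v = A v \<bullet> u"
  obtains e1 e2 \<kappa>1 \<kappa>2 where "norm e1 = 1" "norm e2 = 1" "e1 \<bullet> e2 = 0" "span {e1, e2} = {v. v \<bullet> n = 0}"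
    "A e1 = \<kappa>1 *\<^sub>R e1" "A e2 = \<kappa>2 *\<^sub>R e2"
proof -
  obtain p q where pq: "norm p = 1" "norm q = 1" "p \<bullet> q = 0" "p \<bullet> n = 0" "q \<bullet> n = 0" "p \<times> q = n"
    by (rule exists_orthonormal_complement[OF n])
  have u: "p \<bullet> p = 1" "q \<bullet> q = 1" "q \<bullet> p = 0" using pq by (simp_all add: norm_eq_1 inner_commute)
  define x where "x t = cos t *\<^sub>R p + sin t *\<^sub>R q" for t
  define y where "y t = - sin t *\<^sub>R p + cos t *\<^sub>R q" for t
  have Ax: "A (x t) = cos t *\<^sub>R A p + sin t *\<^sub>R A q" for t
    by (simp add: x_def linear_add[OF A] linear_scale[OF A])
  define F where "F t = A (x t) \<bullet> y t" for t
  have F: "F t = cos t * (cos t * (A p \<bullet> q)) - sin t * (sin t * (A p \<bullet> q)) + cos t * (sin t * (A q \<bullet> q - A p \<bullet> p))" for t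
    using sym[OF pq(4,5)]
    by (simp add: F_def Ax y_def inner_add_left inner_add_right algebra_simps)
  have "continuous_on {0..pi/2} F" unfolding F by (intro continuous_intros)
  moreover have "F 0 = A p \<bullet> q" "F (pi/2) = - (A p \<bullet> q)" by (simp_all add: F)
  ultimately obtain t where t: "F t = 0"
    using IVT'[of F 0 0 "pi/2"] IVT2'[of F "pi/2" 0 0] pi_ge_zero by (cases "A p \<bullet> q \<le> 0") force+
  have sc: "cos t * cos t + sin t * sin t = 1" "sin t * sin t + cos t * cos t = 1"
    using sin_cos_squared_add[of t] by (simp_all add: power2_eq_square add.commute)
  have xn: "x t \<bullet> n = 0" "y t \<bullet> n = 0" by (simp_all add: x_def y_def inner_add_left inner_diff_left pq)
  have xy: "norm (x t) = 1" "norm (y t) = 1" "x t \<bullet> y t = 0"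
    by (simp_all add: norm_eq_1 x_def y_def inner_add_left inner_add_right inner_diff_left inner_diff_right u pq sc)
  have xyn: "x t \<times> y t = n"
  proof -
    have "x t \<times> y t = (cos t * cos t) *\<^sub>R (p \<times> q) + (sin t * sin t) *\<^sub>R (p \<times> q)"
      unfolding x_def y_def cross_add_left cross_add_right cross_mult_left cross_mult_right
      by (simp add: cross_skew[of q p])
    also have "\<dots> = (cos t * cos t + sin t * sin t) *\<^sub>R (p \<times> q)" by (rule scaleR_add_left[symmetric])
    finally show ?thesis by (simp add: sc pq)
  qed
  have ex: "v = (v \<bullet> x t) *\<^sub>R x t + (v \<bullet> y t) *\<^sub>R y t" if "v \<bullet> n = 0" for v
    using orthonormal_pair_expansion(1)[OF xy, of v] that by (simp add: xyn)
  have "span {x t, y t} = {v. v \<bullet> n = 0}"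
  proof
    show "span {x t, y t} \<subseteq> {v. v \<bullet> n = 0}"
      using xn by (intro span_minimal) (auto simp: subspace_def inner_add_left)
    show "{v. v \<bullet> n = 0} \<subseteq> span {x t, y t}"
    proof
      fix v assume "v \<in> {v. v \<bullet> n = 0}"
      then have "v = (v \<bullet> x t) *\<^sub>R x t + (v \<bullet> y t) *\<^sub>R y t" using ex by simp
      also have "\<dots> \<in> span {x t, y t}" by (intro span_add span_scale span_base) auto
      finally show "v \<in> span {x t, y t}" .
    qed
  qed
  moreover have "A (x t) = (A (x t) \<bullet> x t) *\<^sub>R x t"
    using ex[OF inv[OF xn(1)]] t by (simp add: F_def)
  moreover have "A (y t) = (A (y t) \<bullet> y t) *\<^sub>R y t"
    using ex[OF inv[OF xn(2)]] t sym[OF xn] by (simp add: F_def)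
  ultimately show thesis using that[OF xy] by blast
qed

section \<open>The homogeneous extension of the diffeomorphism and its normal field\<close>

locale smooth_sphere =
  fixes f g :: "real^3 \<Rightarrow> real^3" and S :: "(real^3) set"
  assumes smooth_f: "smooth_on f (sphere 0 1)" and smooth_g: "smooth_on g S"
    and f_image: "f ` sphere 0 1 = S" and g_image: "g ` S = sphere 0 1"
    and gf: "\<And>y. y \<in> sphere 0 1 \<Longrightarrow> g (f y) = y" and fg: "\<And>x. x \<in> S \<Longrightarrow> f (g x) = x"
begin

abbreviation nrm :: "real^3 \<Rightarrow> real^3" where "nrm x \<equiv> x /\<^sub>R norm x"

text \<open>The extension by homogeneity of degree 0 is smooth on an open set, so that its derivatives are
  determined by \<open>f\<close>; \<open>N\<close> is the cross product of the images of an oriented orthonormal tangent frame,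
  written without choosing the frame.\<close>

definition \<Phi> :: "real^3 \<Rightarrow> real^3" where "\<Phi> x = f (nrm x)"

definition D :: "real^3 \<Rightarrow> real^3 \<Rightarrow> real^3" where "D x v = frechet_derivative \<Phi> (at x) v"

definition N :: "real^3 \<Rightarrow> real^3" where "N x = cofactor3 (D (nrm x)) (nrm x)"

definition n :: "real^3 \<Rightarrow> real^3" where "n x = N x /\<^sub>R norm (N x)"

definition dn :: "real^3 \<Rightarrow> real^3 \<Rightarrow> real^3" where "dn x v = frechet_derivative n (at x) v"

lemma open_punctured: "open (- {0::real^3})" by auto

lemma nrm_sphere: "x \<noteq> 0 \<Longrightarrow> nrm x \<in> sphere 0 1" by simp

lemma Ck_on_nrm: "Ck_on k nrm (- {0})"
  by (rule Ck_on_normalize[OF open_punctured Ck_on_id]) simp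

lemma \<Phi>_sphere: "norm y = 1 \<Longrightarrow> \<Phi> y = f y" by (simp add: \<Phi>_def)

lemma \<Phi>_scale: "0 < c \<Longrightarrow> \<Phi> (c *\<^sub>R x) = \<Phi> x"
proof -
  assume c: "0 < c"
  then have "inverse c * inverse (norm x) * c = inverse (norm x)" by (simp add: field_simps)
  moreover have "nrm (c *\<^sub>R x) = (inverse c * inverse (norm x) * c) *\<^sub>R x" using c by simp
  ultimately show "\<Phi> (c *\<^sub>R x) = \<Phi> x" by (simp only: \<Phi>_def)
qed

lemma \<Phi>_in_S: "x \<noteq> 0 \<Longrightarrow> \<Phi> x \<in> S"
  using f_image nrm_sphere by (auto simp: \<Phi>_def)

lemma Ck_on_\<Phi>: "Ck_on k \<Phi> (- {0})"
proof (rule Ck_on_local)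
  fix x :: "real^3" assume "x \<in> - {0}"
  then have x: "x \<noteq> 0" by simp
  obtain U F where UF: "open U" "nrm x \<in> U" "\<And>k. Ck_on k F U" "\<And>y. y \<in> sphere 0 1 \<inter> U \<Longrightarrow> F y = f y"
    using smooth_f nrm_sphere[OF x] unfolding smooth_on_def by metis
  define V where "V = - {0} \<inter> nrm -` U"
  have V: "open V" unfolding V_def
    by (intro continuous_open_preimage[OF _ open_punctured UF(1)] Ck_on_imp_continuous_on[OF Ck_on_nrm])
  have "Ck_on k (\<lambda>x. F (nrm x)) V"
    by (rule Ck_on_compose[OF V UF(1) Ck_on_subset[OF Ck_on_nrm] UF(3)]) (auto simp: V_def)
  then have "Ck_on k \<Phi> V"
    by (rule Ck_on_cong[OF V, rotated]) (use UF(4) nrm_sphere in \<open>auto simp: V_def \<Phi>_def\<close>)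
  then show "\<exists>V. x \<in> V \<and> open V \<and> Ck_on k \<Phi> V"
    using V x UF(2) by (intro exI[of _ V]) (auto simp: V_def)
qed

lemma \<Phi>_has_derivative: "x \<noteq> 0 \<Longrightarrow> (\<Phi> has_derivative D x) (at x)"
  unfolding D_def by (rule Ck_on_has_derivative[OF Ck_on_\<Phi>]) simp

lemma linear_D: "x \<noteq> 0 \<Longrightarrow> linear (D x)"
  using \<Phi>_has_derivative has_derivative_linear by blast

lemmas D_linear = linear_add[OF linear_D] linear_diff[OF linear_D] linear_scale[OF linear_D]

text \<open>\<open>\<Phi>\<close> is constant on the open ray through \<open>x\<close>.\<close>

lemma D_self: assumes "x \<noteq> 0" shows "D x x = 0"
proof -
  have "((\<lambda>t. t *\<^sub>R x) has_derivative (\<lambda>t. t *\<^sub>R x)) (at 1)"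
    by (rule bounded_linear_imp_has_derivative) (rule bounded_linear_scaleR_left)
  from diff_chain_at[OF this, of \<Phi> "D x"] assms \<Phi>_has_derivative
  have 1: "((\<lambda>t. \<Phi> (t *\<^sub>R x)) has_derivative (\<lambda>t. D x (t *\<^sub>R x))) (at 1)" by (simp add: o_def)
  have "((\<lambda>t::real. \<Phi> x) has_derivative (\<lambda>t. 0)) (at 1)" by simp
  then have "((\<lambda>t. \<Phi> (t *\<^sub>R x)) has_derivative (\<lambda>t. 0)) (at 1)"
    by (rule has_derivative_transform_within_open[OF _ open_greaterThan[of 0]]) (auto simp: \<Phi>_scale)
  from fun_cong[OF has_derivative_unique[OF 1 this], of 1] show ?thesis by simp
qed

text \<open>Homogeneity of degree 0 of \<open>\<Phi>\<close> makes its derivative homogeneous of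
  degree -1. This carries facts about \<open>D\<close> from the sphere to the punctured
  space.\<close>

lemma D_nrm: assumes x: "x \<noteq> 0" shows "D x v = D (nrm x) v /\<^sub>R norm x"
proof -
  have c: "0 < inverse (norm x)" using x by simp
  have "((\<lambda>z. inverse (norm x) *\<^sub>R z) has_derivative (\<lambda>v. inverse (norm x) *\<^sub>R v)) (at x)"
    by (rule bounded_linear_imp_has_derivative) (rule bounded_linear_scaleR_right)
  from diff_chain_at[OF this, of \<Phi> "D (nrm x)"] x \<Phi>_has_derivative[of "nrm x"]
  have "((\<lambda>z. \<Phi> (inverse (norm x) *\<^sub>R z)) has_derivative (\<lambda>v. D (nrm x) (inverse (norm x) *\<^sub>R v))) (at x)"
    by (simp add: o_def)
  then have "(\<Phi> has_derivative (\<lambda>v. D (nrm x) (inverse (norm x) *\<^sub>R v))) (at x)"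
    by (simp only: \<Phi>_scale[OF c])
  from has_derivative_unique[OF \<Phi>_has_derivative[OF x] this]
  show ?thesis using x by (simp add: linear_scale[OF linear_D])
qed

lemma g_local_extension:
  assumes "norm y = 1"
  obtains W G where "open W" "f y \<in> W" "\<And>k. Ck_on k G W" "\<And>x. x \<in> S \<Longrightarrow> x \<in> W \<Longrightarrow> G x = g x"
proof -
  have "f y \<in> S" using f_image assms by auto
  then show thesis using smooth_g that unfolding smooth_on_def by (metis IntI)
qed

text \<open>Near \<open>y\<close> a smooth local extension \<open>G\<close> of the inverse satisfies
  \<open>G (\<Phi> x) = nrm x\<close>, and the derivative of \<open>nrm\<close> at a unit vector is
  the projection off that vector. Smoothness of the inverse thus makes \<open>f\<close> an
  immersion.\<close>

lemma D_left_inverse: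
  assumes y: "norm y = 1"
  obtains L where "linear L" "\<And>w. L (D y w) = w - (w \<bullet> y) *\<^sub>R y"
proof -
  have y0: "y \<noteq> 0" using y by auto
  obtain W G where W: "open W" "f y \<in> W" "\<And>k. Ck_on k G W" "\<And>x. x \<in> S \<Longrightarrow> x \<in> W \<Longrightarrow> G x = g x"
    by (rule g_local_extension[OF y]) (rule that)
  let ?L = "frechet_derivative G (at (f y))"
  have G: "(G has_derivative ?L) (at (\<Phi> y))" using Ck_on_has_derivative[OF W(3) W(2)] y by (simp add: \<Phi>_sphere)
  have 1: "((\<lambda>x. G (\<Phi> x)) has_derivative (\<lambda>w. ?L (D y w))) (at y)"
    using diff_chain_at[OF \<Phi>_has_derivative[OF y0] G] by (simp add: o_def)
  have op: "open (- {0} \<inter> \<Phi> -` W)"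
    by (intro continuous_open_preimage[OF _ open_punctured W(1)] Ck_on_imp_continuous_on[OF Ck_on_\<Phi>])
  have "(nrm has_derivative (\<lambda>w. ?L (D y w))) (at y)"
  proof (rule has_derivative_transform_within_open[OF 1 op])
    show "y \<in> - {0} \<inter> \<Phi> -` W" using y0 y W by (simp add: \<Phi>_sphere)
    fix x assume x: "x \<in> - {0} \<inter> \<Phi> -` W"
    then have "G (\<Phi> x) = g (\<Phi> x)" using W(4) \<Phi>_in_S by auto
    also have "\<dots> = nrm x" using gf[OF nrm_sphere[of x]] x by (simp add: \<Phi>_def)
    finally show "G (\<Phi> x) = nrm x" .
  qed
  moreover have "(nrm has_derivative (\<lambda>w. w - (w \<bullet> y) *\<^sub>R y)) (at y)"
  proof -
    have "(norm has_derivative (\<lambda>h. h \<bullet> y)) (at y)"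
      using has_derivative_norm[OF y0] y by (simp add: sgn_div_norm)
    from has_derivative_scaleR[OF Deriv.has_derivative_inverse[OF _ this] has_derivative_ident]
    show ?thesis using y y0 by (auto intro: has_derivative_eq_rhs simp: algebra_simps)
  qed
  ultimately have "(\<lambda>w. ?L (D y w)) = (\<lambda>w. w - (w \<bullet> y) *\<^sub>R y)"
    by (rule has_derivative_unique)
  then have "?L (D y w) = w - (w \<bullet> y) *\<^sub>R y" for w
    by (rule fun_cong)
  then show thesis using that has_derivative_linear[OF G] by blast
qed

lemma D_eq_0:
  assumes "norm y = 1" "w \<bullet> y = 0" "D y w = 0"
  shows "w = 0"
proof -
  obtain L where "linear L" "\<And>w. L (D y w) = w - (w \<bullet> y) *\<^sub>R y" by (rule D_left_inverse[OF assms(1)]) (rule that)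
  then show ?thesis using assms by (metis diff_zero linear_0 scaleR_zero_left)
qed

lemma N_sphere: "norm y = 1 \<Longrightarrow> N y = cofactor3 (D y) y" by (simp add: N_def)

lemma N_nrm: "x \<noteq> 0 \<Longrightarrow> N (nrm x) = N x" by (simp add: N_def)

lemma n_nrm: "x \<noteq> 0 \<Longrightarrow> n (nrm x) = n x" by (simp add: n_def N_nrm)

text \<open>Both arguments are orthogonal to \<open>y\<close>, so their cross product is a multiple
  of \<open>y\<close>, and the cross product of the images depends on nothing else.\<close>

lemma D_cross:
  assumes y: "norm y = 1" and ab: "a \<bullet> y = 0" "b \<bullet> y = 0"
  shows "D y a \<times> D y b = ((a \<times> b) \<bullet> y) *\<^sub>R N y"
proof -
  have y0: "y \<noteq> 0" using y by auto
  have "a \<times> b = ((a \<times> b) \<bullet> y) *\<^sub>R y"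
  proof -
    have "y \<times> (a \<times> b) = 0" using ab by (simp add: Lagrange inner_commute)
    moreover have "y \<times> (y \<times> (a \<times> b)) = (y \<bullet> (a \<times> b)) *\<^sub>R y - (y \<bullet> y) *\<^sub>R (a \<times> b)" by (rule Lagrange)
    ultimately show ?thesis using y by (simp add: norm_eq_1 inner_commute)
  qed
  then show ?thesis
    using cross3_linear_image_eq_cofactor3[OF linear_D[OF y0], of a b] N_sphere[OF y] cofactor3_scaleR by metis
qed

lemma tangent_frame:
  assumes y: "norm y = 1"
  obtains a b where "norm a = 1" "a \<bullet> y = 0" "b \<bullet> y = 0" "a \<times> b = y" "D y a \<times> D y b = N y"
proof -
  obtain a b where ab: "norm a = 1" "norm b = 1" "a \<bullet> b = 0" "a \<bullet> y = 0" "b \<bullet> y = 0" "a \<times> b = y"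
    by (rule exists_orthonormal_complement[OF y])
  moreover have "D y a \<times> D y b = N y" using D_cross[OF y ab(4,5)] ab(6) y by (simp add: norm_eq_1)
  ultimately show thesis using that by blast
qed

text \<open>Dependent images of a tangent frame would put a nonzero tangent vector into the kernel
  of \<open>D y\<close>.\<close>

lemma N_nonzero_sphere: assumes y: "norm y = 1" shows "N y \<noteq> 0"
proof
  assume 0: "N y = 0"
  have y0: "y \<noteq> 0" using y by auto
  obtain a b where ab: "norm a = 1" "a \<bullet> y = 0" "b \<bullet> y = 0" "a \<times> b = y" and DN: "D y a \<times> D y b = N y"
    by (rule tangent_frame[OF y])
  have "D y a \<times> D y b = 0" using DN 0 by simp
  then have col: "collinear {0, D y a, D y b}" by (simp add: cross_eq_0)
  have nz: "D y a \<noteq> 0" using D_eq_0[OF y ab(2)] ab(1) by auto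
  then obtain c where "D y b = c *\<^sub>R D y a" using col collinear_lemma[of "D y a" "D y b"] by (metis scaleR_zero_left)
  then have "D y (b - c *\<^sub>R a) = 0" by (simp add: D_linear[OF y0])
  then have "b - c *\<^sub>R a = 0" by (rule D_eq_0[OF y, rotated]) (use ab in \<open>simp add: inner_diff_left\<close>)
  then have "b = c *\<^sub>R a" by simp
  then have "a \<times> b = 0" by (simp add: cross_mult_right)
  with ab(4) y0 show False by simp
qed

lemma N_nonzero: "x \<noteq> 0 \<Longrightarrow> N x \<noteq> 0"
  using N_nonzero_sphere[of "nrm x"] N_nrm[of x] by simp

lemma norm_n: "x \<noteq> 0 \<Longrightarrow> norm (n x) = 1"
  using N_nonzero by (simp add: n_def)

lemma n_dot_D_sphere: assumes y: "norm y = 1" shows "n y \<bullet> D y w = 0"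
proof -
  have y0: "y \<noteq> 0" using y by auto
  have yy: "y \<bullet> y = 1" using y by (simp add: norm_eq_1)
  define u where "u = w - (w \<bullet> y) *\<^sub>R y"
  have u: "u \<bullet> y = 0" by (simp add: u_def inner_diff_left yy)
  have Dw: "D y w = D y u"
    by (simp add: u_def D_linear[OF y0] D_self[OF y0])
  \<comment> \<open>Pairing \<open>u\<close> with its quarter turn \<open>y \<times> u\<close>
    exhibits the multiple \<open>u \<bullet> u\<close> of \<open>N y\<close> as a cross product that
    has \<open>D y u\<close> as a factor.\<close>
  have "D y u \<times> D y (y \<times> u) = ((u \<times> (y \<times> u)) \<bullet> y) *\<^sub>R N y"
    by (rule D_cross[OF y u]) (simp add: dot_cross_self)
  also have "(u \<times> (y \<times> u)) \<bullet> y = u \<bullet> u" by (simp add: Lagrange inner_diff_left yy u)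
  finally have "(u \<bullet> u) *\<^sub>R N y \<bullet> D y u = 0" by (metis dot_cross_self(1) inner_commute)
  then have "N y \<bullet> D y u = 0"
    using linear_0[OF linear_D[OF y0]] by (cases "u = 0") auto
  then show ?thesis by (simp add: n_def Dw)
qed

lemma n_dot_D: "x \<noteq> 0 \<Longrightarrow> n x \<bullet> D x w = 0"
  using n_dot_D_sphere[of "nrm x" w] by (simp add: D_nrm[of x] n_nrm)

lemma Ck_on_D: "Ck_on k (\<lambda>x. D x v) (- {0})"
  unfolding D_def using Ck_on_\<Phi>[of "Suc k"] by simp

lemma Ck_on_N: "Ck_on k N (- {0})"
proof -
  have "Ck_on k (\<lambda>x. cofactor3 (D x) x) (- {0})"
    unfolding cofactor3_def
    by (intro Ck_on_add Ck_on_scaleR Ck_on_cross3 Ck_on_D open_punctured Ck_on_bounded_linear bounded_linear_vec_nth)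
  then show ?thesis
    unfolding N_def by (rule Ck_on_compose[OF open_punctured open_punctured Ck_on_nrm]) auto
qed

lemma Ck_on_n: "Ck_on k n (- {0})"
  unfolding n_def using N_nonzero by (intro Ck_on_normalize[OF open_punctured Ck_on_N]) auto

lemma n_has_derivative: "x \<noteq> 0 \<Longrightarrow> (n has_derivative dn x) (at x)"
  unfolding dn_def by (rule Ck_on_has_derivative[OF Ck_on_n]) simp

lemma linear_dn: "x \<noteq> 0 \<Longrightarrow> linear (dn x)"
  using n_has_derivative has_derivative_linear by blast

lemma n_dot_dn: assumes x: "x \<noteq> 0" shows "n x \<bullet> dn x w = 0"
proof -
  have 1: "((\<lambda>z. n z \<bullet> n z) has_derivative (\<lambda>w. n x \<bullet> dn x w + dn x w \<bullet> n x)) (at x)"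
    by (intro has_derivative_inner n_has_derivative x)
  have "((\<lambda>z::real^3. 1::real) has_derivative (\<lambda>w. 0)) (at x)" by simp
  then have 2: "((\<lambda>z. n z \<bullet> n z) has_derivative (\<lambda>w. 0)) (at x)"
    by (rule has_derivative_transform_within_open[OF _ open_punctured])
       (use x norm_n in \<open>auto simp: norm_eq_1\<close>)
  from fun_cong[OF has_derivative_unique[OF 1 this], of w] show ?thesis by (simp add: inner_commute)
qed

text \<open>\<open>cross3_decomposition\<close> is applied to the images of a tangent frame; the
  coefficient of the normal vanishes and linearity of \<open>D y\<close> collects the rest.\<close>

lemma D_surj_tangent:
  assumes y: "norm y = 1" and v: "v \<bullet> n y = 0"
  obtains w where "w \<bullet> y = 0" "v = D y w"
proof -
  have y0: "y \<noteq> 0" using y by auto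
  obtain a b where ab: "norm a = 1" "a \<bullet> y = 0" "b \<bullet> y = 0" "a \<times> b = y" and DN: "D y a \<times> D y b = N y"
    by (rule tangent_frame[OF y])
  let ?p = "D y a" and ?q = "D y b"
  define c where "c = N y \<bullet> N y"
  have c: "c \<noteq> 0" using N_nonzero[OF y0] by (simp add: c_def)
  have "v \<bullet> N y = 0" using v N_nonzero[OF y0] by (simp add: n_def)
  with cross3_decomposition[of ?p ?q v]
  have "c *\<^sub>R v = ((v \<times> ?q) \<bullet> N y) *\<^sub>R ?p + ((?p \<times> v) \<bullet> N y) *\<^sub>R ?q" by (simp add: DN c_def)
  also have "\<dots> = D y (((v \<times> ?q) \<bullet> N y) *\<^sub>R a + ((?p \<times> v) \<bullet> N y) *\<^sub>R b)"
    by (simp add: D_linear[OF y0])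
  finally have "(1/c) *\<^sub>R (c *\<^sub>R v) = (1/c) *\<^sub>R D y (((v \<times> ?q) \<bullet> N y) *\<^sub>R a + ((?p \<times> v) \<bullet> N y) *\<^sub>R b)" by simp
  then have "v = D y ((1/c) *\<^sub>R (((v \<times> ?q) \<bullet> N y) *\<^sub>R a + ((?p \<times> v) \<bullet> N y) *\<^sub>R b))"
    using c by (simp only: linear_scale[OF linear_D[OF y0]]) simp
  then show thesis by (rule that[rotated]) (simp add: inner_add_left ab)
qed

text \<open>Self-adjointness of the shape operator. Differentiating
  \<open>n x \<bullet> D x b = 0\<close> expresses either side by the second derivative of
  \<open>\<Phi>\<close>, which is symmetric.\<close>

lemma dn_dot_D_commute:
  assumes x: "x \<noteq> 0" shows "dn x a \<bullet> D x b = dn x b \<bullet> D x a"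
proof -
  let ?DD = "\<lambda>a b. frechet_derivative (\<lambda>x. D x b) (at x) a"
  have *: "dn x a \<bullet> D x b = - (n x \<bullet> ?DD a b)" for a b
  proof -
    have "((\<lambda>x. D x b) has_derivative frechet_derivative (\<lambda>x. D x b) (at x)) (at x)"
      by (rule Ck_on_has_derivative[OF Ck_on_D]) (use x in simp)
    from has_derivative_inner[OF n_has_derivative[OF x] this]
    have 1: "((\<lambda>x. n x \<bullet> D x b) has_derivative (\<lambda>a. n x \<bullet> ?DD a b + dn x a \<bullet> D x b)) (at x)" .
    have "((\<lambda>z::real^3. 0::real) has_derivative (\<lambda>w. 0)) (at x)" by simp
    then have 2: "((\<lambda>x. n x \<bullet> D x b) has_derivative (\<lambda>w. 0)) (at x)"
      by (rule has_derivative_transform_within_open[OF _ open_punctured]) (use x n_dot_D in auto)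
    from fun_cong[OF has_derivative_unique[OF 1 this], of a] show ?thesis by simp
  qed
  have "?DD a b = ?DD b a"
    unfolding D_def by (rule symmetric_second_derivative[OF open_punctured _ Ck_on_\<Phi>]) (use x in simp)
  then show ?thesis by (simp add: *)
qed

end

text \<open>The local injectivity criterion wants a derivative that is continuous in operator norm,
  whereas \<open>Ck_on\<close> gives continuity for each fixed direction. The sum over
  \<open>Basis\<close> dominates the operator norm.\<close>

lemma Ck_on_locally_injective:
  fixes f :: "'a::euclidean_space \<Rightarrow> 'b::euclidean_space"
  assumes U: "open U" "a \<in> U" and f: "Ck_on (Suc 0) f U"
    and inj: "\<And>w. frechet_derivative f (at a) w = 0 \<Longrightarrow> w = 0"
  obtains r where "r > 0" "ball a r \<subseteq> U" "inj_on f (ball a r)"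
proof -
  let ?f' = "\<lambda>x. frechet_derivative f (at x)"
  have d: "(f has_derivative ?f' x) (at x)" if "x \<in> U" for x using Ck_on_has_derivative[OF f that] .
  have lin: "linear (?f' x)" if "x \<in> U" for x using d[OF that] has_derivative_linear by blast
  have "inj (?f' a)" using linear_injective_0[OF lin[OF U(2)]] inj by blast
  then obtain g' where g': "linear g'" "g' \<circ> ?f' a = id"
    using linear_injective_left_inverse[OF lin[OF U(2)]] by blast
  have on: "\<exists>d>0. \<forall>x. dist a x < d \<longrightarrow> onorm (\<lambda>v. ?f' x v - ?f' a v) < e" if e: "e > 0" for e
  proof -
    let ?h = "\<lambda>x. \<Sum>b\<in>Basis. norm (?f' x b - ?f' a b)"
    have "continuous_on U ?h"
      using f by (intro continuous_intros) auto
    then have "continuous (at a) ?h" using U continuous_on_eq_continuous_at by blast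
    from this[unfolded continuous_at_eps_delta, rule_format, OF e]
    obtain d1 where d1: "d1 > 0" "\<And>x. dist x a < d1 \<Longrightarrow> dist (?h x) (?h a) < e" by blast
    obtain d2 where d2: "d2 > 0" "ball a d2 \<subseteq> U" using U open_contains_ball by blast
    have "onorm (\<lambda>v. ?f' x v - ?f' a v) < e" if x: "dist a x < min d1 d2" for x
    proof -
      have xU: "x \<in> U" using x d2 by auto
      have "dist (?h x) (?h a) < e" by (rule d1(2)) (use x in \<open>simp add: dist_commute\<close>)
      then have hx: "?h x < e" by (simp add: dist_real_def sum_nonneg)
      have "onorm (\<lambda>v. ?f' x v - ?f' a v) \<le> ?h x"
      proof (rule onorm_le)
        fix v
        have "?f' x v - ?f' a v = (\<Sum>b\<in>Basis. (v \<bullet> b) *\<^sub>R ?f' x b) - (\<Sum>b\<in>Basis. (v \<bullet> b) *\<^sub>R ?f' a b)"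
          using frechet_derivative_euclidean_sum[OF differentiableI[OF d[OF xU]], of v]
            frechet_derivative_euclidean_sum[OF differentiableI[OF d[OF U(2)]], of v] by simp
        also have "\<dots> = (\<Sum>b\<in>Basis. (v \<bullet> b) *\<^sub>R (?f' x b - ?f' a b))"
          by (simp add: sum_subtractf scaleR_diff_right)
        also have "norm \<dots> \<le> (\<Sum>b\<in>Basis. norm ((v \<bullet> b) *\<^sub>R (?f' x b - ?f' a b)))" by (rule norm_sum)
        also have "\<dots> \<le> (\<Sum>b\<in>Basis. norm (?f' x b - ?f' a b) * norm v)"
        proof (rule sum_mono)
          fix b :: 'a assume b: "b \<in> Basis"
          have "\<bar>v \<bullet> b\<bar> \<le> norm v" using Basis_le_norm[OF b] .
          then show "norm ((v \<bullet> b) *\<^sub>R (?f' x b - ?f' a b)) \<le> norm (?f' x b - ?f' a b) * norm v"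
            by (simp add: mult.commute mult_right_mono)
        qed
        also have "\<dots> = ?h x * norm v" by (simp add: sum_distrib_right)
        finally show "norm (?f' x v - ?f' a v) \<le> ?h x * norm v" .
      qed
      then show ?thesis using hx by simp
    qed
    then show ?thesis using d1(1) d2(1) by (intro exI[of _ "min d1 d2"]) simp
  qed
  show thesis
    by (rule has_derivative_locally_injective[OF U(2) U(1) _ g'(2) d on])
       (use g'(1) that in \<open>simp_all add: linear_conv_bounded_linear\<close>)
qed

section \<open>Tangent spaces and the two sides of the surface\<close>

context smooth_sphere
begin

text \<open>A vector orthogonal to the normal is some \<open>D y w\<close>, the velocity of the
  image of a line. Conversely, a curve in \<open>S\<close> is unchanged near 0 when sent through the
  extended inverse and back by \<open>\<Phi>\<close>, so its velocity is a value of
  \<open>D y\<close>.\<close>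

lemma tangent_space_eq:
  assumes y: "norm y = 1"
  shows "tangent_space S (f y) = {v. v \<bullet> n y = 0}"
proof
  have y0: "y \<noteq> 0" using y by auto
  show "{v. v \<bullet> n y = 0} \<subseteq> tangent_space S (f y)"
  proof
    fix v assume "v \<in> {v. v \<bullet> n y = 0}"
    then have "v \<bullet> n y = 0" by simp
    then obtain w where w: "w \<bullet> y = 0" "v = D y w" by (rule D_surj_tangent[OF y])
    define \<gamma> where "\<gamma> t = \<Phi> (y + t *\<^sub>R w)" for t :: real
    \<comment> \<open>The line lies in the plane tangent to the sphere at \<open>y\<close>, which
      misses the origin, so the curve is smooth for all times.\<close>
    have nz: "y + t *\<^sub>R w \<noteq> 0" for t
    proof
      assume "y + t *\<^sub>R w = 0"
      then have "(y + t *\<^sub>R w) \<bullet> y = 0" by simp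
      then show False using w y by (simp add: inner_add_left norm_eq_1)
    qed
    have "Ck_on k (\<lambda>t::real. y + t *\<^sub>R w) UNIV" for k
      by (intro Ck_on_add Ck_on_const Ck_on_bounded_linear bounded_linear_scaleR_left) simp
    then have "Ck_on k \<gamma> UNIV" for k
      unfolding \<gamma>_def by (rule Ck_on_compose[OF open_UNIV open_punctured _ Ck_on_\<Phi>]) (use nz in auto)
    then have "smooth_on \<gamma> {-1<..<1}"
      unfolding smooth_on_def by (intro ballI exI[of _ UNIV] exI[of _ \<gamma>]) auto
    moreover have "\<gamma> ` {-1<..<1} \<subseteq> S" using \<Phi>_in_S[OF nz] by (auto simp: \<gamma>_def)
    moreover have "\<gamma> 0 = f y" using y by (simp add: \<gamma>_def \<Phi>_sphere)
    moreover have "(\<gamma> has_vector_derivative v) (at 0)"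
    proof -
      have 1: "((\<lambda>t::real. y + t *\<^sub>R w) has_derivative (\<lambda>t. t *\<^sub>R w)) (at 0)"
        by (auto intro!: derivative_eq_intros)
      have 2: "(\<Phi> has_derivative D y) (at (y + 0 *\<^sub>R w))" using \<Phi>_has_derivative[OF y0] by simp
      show ?thesis
        using diff_chain_at[OF 1 2] by (simp add: has_vector_derivative_def o_def \<gamma>_def[abs_def] linear_scale[OF linear_D[OF y0]] w)
    qed
    ultimately show "v \<in> tangent_space S (f y)"
      unfolding tangent_space_def by (intro CollectI exI[of _ \<gamma>] exI[of _ 1]) auto
  qed
  show "tangent_space S (f y) \<subseteq> {v. v \<bullet> n y = 0}"
  proof
    fix v assume "v \<in> tangent_space S (f y)"
    then obtain \<gamma> :: "real \<Rightarrow> real^3" and \<epsilon> where \<gamma>: "0 < \<epsilon>" "\<gamma> ` {-\<epsilon><..<\<epsilon>} \<subseteq> S" "\<gamma> 0 = f y" "(\<gamma> has_vector_derivative v) (at 0)"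
      unfolding tangent_space_def by blast
    obtain W G where W: "open W" "f y \<in> W" "\<And>k. Ck_on k G W" "\<And>x. x \<in> S \<Longrightarrow> x \<in> W \<Longrightarrow> G x = g x"
      by (rule g_local_extension[OF y]) (rule that)
    let ?L = "frechet_derivative G (at (f y))"
    have d\<gamma>: "(\<gamma> has_derivative (\<lambda>t. t *\<^sub>R v)) (at 0)" using \<gamma>(4) by (simp add: has_vector_derivative_def)
    have dG: "(G has_derivative ?L) (at (\<gamma> 0))" using Ck_on_has_derivative[OF W(3) W(2)] \<gamma>(3) by simp
    have Gy: "G (\<gamma> 0) = y" using W(2,4) \<gamma>(3) gf[of y] f_image y by auto
    have d\<Phi>: "(\<Phi> has_derivative D y) (at (G (\<gamma> 0)))" using \<Phi>_has_derivative[OF y0] Gy by simp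
    have 1: "((\<lambda>t. \<Phi> (G (\<gamma> t))) has_derivative (\<lambda>t. D y (?L (t *\<^sub>R v)))) (at 0)"
      using diff_chain_at[OF diff_chain_at[OF d\<gamma> dG], of \<Phi> "D y"] d\<Phi> by (simp add: o_def)
    have "\<forall>\<^sub>F t in at 0. \<gamma> t \<in> W"
      using has_derivative_continuous[OF d\<gamma>] W(1,2) \<gamma>(3) unfolding continuous_at by (intro topological_tendstoD) auto
    then obtain d where d: "d > 0" "\<And>t. t \<noteq> 0 \<Longrightarrow> dist t 0 < d \<Longrightarrow> \<gamma> t \<in> W"
      unfolding eventually_at by blast
    have "(\<gamma> has_derivative (\<lambda>t. D y (?L (t *\<^sub>R v)))) (at 0)"
    proof (rule has_derivative_transform_within[OF 1, of "min d \<epsilon>"])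
      fix t :: real assume "dist t 0 < min d \<epsilon>"
      then have t: "\<gamma> t \<in> W" "\<gamma> t \<in> S" using d(2)[of t] W(2) \<gamma> by (cases "t = 0"; force simp: dist_real_def abs_less_iff)+
      then have "G (\<gamma> t) = g (\<gamma> t)" using W(4) by blast
      moreover have "norm (g (\<gamma> t)) = 1" using g_image t(2) by auto
      ultimately show "\<Phi> (G (\<gamma> t)) = \<gamma> t" using fg[OF t(2)] by (simp add: \<Phi>_sphere)
    qed (use d \<gamma> in auto)
    from fun_cong[OF has_derivative_unique[OF d\<gamma> this], of 1] have "v = D y (?L v)" by simp
    then have "v \<bullet> n y = D y (?L v) \<bullet> n y" by (rule arg_cong)
    also have "\<dots> = 0" using n_dot_D[OF y0, of "?L v"] by (simp add: inner_commute)
    finally show "v \<in> {v. v \<bullet> n y = 0}" by simp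
  qed
qed

lemma continuous_on_f: "continuous_on (sphere 0 1) f"
proof -
  have "continuous_on (sphere 0 1) \<Phi>"
    by (rule continuous_on_subset[OF Ck_on_imp_continuous_on[OF Ck_on_\<Phi>]]) auto
  then show ?thesis by (rule continuous_on_eq) (simp add: \<Phi>_sphere)
qed

lemma continuous_on_g: "continuous_on S g"
proof (clarsimp simp: continuous_on_eq_continuous_within)
  fix x assume x: "x \<in> S"
  then obtain y where y: "norm y = 1" "x = f y" using f_image by auto
  obtain W G where W: "open W" "f y \<in> W" "\<And>k. Ck_on k G W" "\<And>x. x \<in> S \<Longrightarrow> x \<in> W \<Longrightarrow> G x = g x"
    by (rule g_local_extension[OF y(1)]) (rule that)
  have "continuous (at x within S) G"
    using Ck_on_imp_continuous_on[OF W(3)] W(1,2) y(2) continuous_on_eq_continuous_at continuous_at_imp_continuous_at_within by blast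
  moreover have "\<forall>\<^sub>F z in at x within S. G z = g z"
    unfolding eventually_at_topological using W y by (intro exI[of _ W]) auto
  moreover have "G x = g x" using W x y by auto
  ultimately show "continuous (at x within S) g"
    unfolding continuous_within by (metis (mono_tags, lifting) tendsto_cong)
qed

lemma compact_S: "compact S"
  using compact_continuous_image[OF continuous_on_f compact_sphere] f_image by simp

lemma S_homeomorphic: "S homeomorphic sphere (0::real^3) 1"
proof -
  have "homeomorphism S (sphere 0 1) g f"
    unfolding homeomorphism_def using continuous_on_f continuous_on_g f_image g_image fg gf by auto
  then show ?thesis unfolding homeomorphic_def by blast
qed

lemma dim3: "2 \<le> DIM(real^3)" by simp

text \<open>By the Jordan-Brouwer theorem \<open>S\<close> is the frontier of each component of its
  complement. The outside is one component, being connected in dimension 3, and the inside contains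
  another because the complement is not connected.\<close>

lemma frontier_sides:
  assumes x: "x \<in> S" and U: "open U" "x \<in> U"
  shows "U \<inter> outside S \<noteq> {}" "U \<inter> inside S \<noteq> {}"
proof -
  have meets: "U \<inter> T \<noteq> {}" if "T \<in> components (- S)" for T
  proof -
    have "x \<in> closure T" using Jordan_Brouwer_frontier[OF S_homeomorphic that dim3] x by (auto simp: frontier_def)
    then show ?thesis using U by (auto simp: closure_iff_nhds_not_empty)
  qed
  have bS: "bounded S" using compact_S compact_imp_bounded by blast
  have con: "connected (outside S)" by (rule connected_outside[OF bS dim3])
  have "outside S \<in> components (- S)"
    using outside_in_components[of S] con outside_bounded_nonempty[OF bS] by blast
  then show "U \<inter> outside S \<noteq> {}" by (rule meets)
  have "inside S \<noteq> {}"
  proof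
    assume "inside S = {}"
    then have "- S = outside S" using inside_Un_outside[of S] by auto
    then show False using Jordan_Brouwer_separation[OF S_homeomorphic] con by simp
  qed
  then obtain z where z: "z \<in> inside S" by blast
  then have zS: "z \<in> - S" using inside_Un_outside[of S] by blast
  let ?T = "connected_component_set (- S) z"
  have "?T \<subseteq> inside S" using z inside_same_component connected_component_sym by (metis mem_Collect_eq subsetI)
  moreover have "?T \<in> components (- S)" using zS by (auto simp: components_def)
  ultimately show "U \<inter> inside S \<noteq> {}" using meets[of ?T] by blast
qed

end

section \<open>The outer normal and the Gauss curvature\<close>

context smooth_sphere
begin

text \<open>Coordinates of space near \<open>f y0\<close>: the plane tangent to the sphere at
  \<open>y0\<close> parametrizes the surface through \<open>\<Phi>\<close>, and the height above
  that plane is spent along the normal. Being a map between open sets of equal dimension, it admits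
  invariance of domain.\<close>

definition collar :: "real^3 \<Rightarrow> real^3 \<Rightarrow> real^3" where
  "collar y0 x = \<Phi> x + (x \<bullet> y0 - 1) *\<^sub>R n x"

lemma Ck_on_collar: "Ck_on k (collar y0) (- {0})"
proof -
  have "Ck_on k (\<lambda>x. \<Phi> x + (x \<bullet> y0 + - 1) *\<^sub>R n x) (- {0})"
    by (intro Ck_on_add Ck_on_scaleR Ck_on_inner Ck_on_const Ck_on_id Ck_on_\<Phi> Ck_on_n open_punctured)
  then show ?thesis by (simp add: collar_def[abs_def])
qed

text \<open>At \<open>y0\<close> the derivative splits into the tangential part
  \<open>D y0 w\<close> and a normal part of size \<open>w \<bullet> y0\<close>; both vanish only if
  \<open>w = 0\<close>.\<close>

lemma collar_locally_injective:
  assumes y0: "norm y0 = 1"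
  obtains r where "r > 0" "ball y0 r \<subseteq> - {0}" "inj_on (collar y0) (ball y0 r)"
proof -
  have nz: "y0 \<noteq> 0" using y0 by auto
  have yy: "y0 \<bullet> y0 = 1" using y0 by (simp add: norm_eq_1)
  have "(collar y0 has_derivative (\<lambda>w. D y0 w + ((y0 \<bullet> y0 - 1) *\<^sub>R dn y0 w + (w \<bullet> y0) *\<^sub>R n y0))) (at y0)"
    unfolding collar_def
    by (intro has_derivative_add \<Phi>_has_derivative[OF nz] has_derivative_scaleR n_has_derivative[OF nz])
       (auto intro!: derivative_eq_intros)
  then have fd: "frechet_derivative (collar y0) (at y0) = (\<lambda>w. D y0 w + (w \<bullet> y0) *\<^sub>R n y0)"
    by (simp add: frechet_derivative_at[symmetric] yy)
  show thesis
  proof (rule Ck_on_locally_injective[OF open_punctured _ Ck_on_collar])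
    fix w assume "frechet_derivative (collar y0) (at y0) w = 0"
    then have 0: "D y0 w + (w \<bullet> y0) *\<^sub>R n y0 = 0" by (simp add: fd)
    then have "n y0 \<bullet> (D y0 w + (w \<bullet> y0) *\<^sub>R n y0) = 0" by simp
    then have w: "w \<bullet> y0 = 0"
      using n_dot_D[OF nz, of w] norm_n[OF nz] by (auto simp: inner_add_right)
    with 0 show "w = 0" by (intro D_eq_0[OF y0 w]) simp
  qed (use nz that in auto)
qed

text \<open>A point \<open>z\<close> of \<open>S\<close> near \<open>f y0\<close> also comes from
  the plane, namely from the central projection of \<open>g z\<close>, and local injectivity
  excludes a second preimage. Continuity of \<open>g\<close> prevents distant parts of the surface
  from returning close to \<open>f y0\<close>.\<close>

lemma collar_meets_S_only_in_plane:
  assumes y0: "norm y0 = 1"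
  obtains r where "r > 0" "ball y0 r \<subseteq> - {0}" "inj_on (collar y0) (ball y0 r)"
    "\<And>x. x \<in> ball y0 r \<Longrightarrow> collar y0 x \<in> S \<Longrightarrow> x \<bullet> y0 = 1"
proof -
  have yy: "y0 \<bullet> y0 = 1" using y0 by (simp add: norm_eq_1)
  have fS: "f y0 \<in> S" using f_image y0 by auto
  have gy: "g (f y0) = y0" using gf y0 by simp
  have cy: "collar y0 y0 = f y0" using y0 yy by (simp add: collar_def \<Phi>_sphere)
  obtain r0 where r0: "r0 > 0" "ball y0 r0 \<subseteq> - {0}" "inj_on (collar y0) (ball y0 r0)"
    by (rule collar_locally_injective[OF y0]) (rule that)
  have cg: "continuous (at (f y0) within S) g" using continuous_on_g fS by (simp add: continuous_on_eq_continuous_within)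
  then have cont: "continuous (at (f y0) within S) (\<lambda>z. (1 / (g z \<bullet> y0)) *\<^sub>R g z)"
    by (intro continuous_intros) (auto simp: gy yy)
  then have "\<forall>\<^sub>F z in at (f y0) within S. (1 / (g z \<bullet> y0)) *\<^sub>R g z \<in> ball y0 r0"
    unfolding continuous_within using r0 by (intro topological_tendstoD) (auto simp: gy yy)
  then obtain d1 where d1: "d1 > 0" "\<And>z. z \<in> S \<Longrightarrow> z \<noteq> f y0 \<Longrightarrow> dist z (f y0) < d1 \<Longrightarrow> (1 / (g z \<bullet> y0)) *\<^sub>R g z \<in> ball y0 r0"
    unfolding eventually_at by blast
  have "continuous (at (f y0) within S) (\<lambda>z. g z \<bullet> y0)" using cg by (intro continuous_intros)
  then have "\<forall>\<^sub>F z in at (f y0) within S. g z \<bullet> y0 \<in> {0<..}"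
    unfolding continuous_within by (intro topological_tendstoD) (auto simp: gy yy)
  then obtain d2 where d2: "d2 > 0" "\<And>z. z \<in> S \<Longrightarrow> z \<noteq> f y0 \<Longrightarrow> dist z (f y0) < d2 \<Longrightarrow> 0 < g z \<bullet> y0"
    unfolding eventually_at by (metis greaterThan_iff)
  have "isCont (collar y0) y0"
    using Ck_on_imp_continuous_on[OF Ck_on_collar[of 0 y0]] y0 open_punctured continuous_on_eq_continuous_at by fastforce
  then obtain r1 where r1: "r1 > 0" "\<And>x. dist x y0 < r1 \<Longrightarrow> dist (collar y0 x) (f y0) < min d1 d2"
    using d1(1) d2(1) cy unfolding continuous_at_eps_delta by (metis min_less_iff_conj)
  define r where "r = min r0 r1"
  have "x \<bullet> y0 = 1" if x: "x \<in> ball y0 r" and c: "collar y0 x \<in> S" for x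
  proof (cases "collar y0 x = f y0")
    case True
    then have "collar y0 x = collar y0 y0" by (simp add: cy)
    then have "x = y0" by (rule inj_onD[OF r0(3)]) (use r0(1) x in \<open>auto simp: r_def\<close>)
    then show ?thesis by (simp add: yy)
  next
    case False
    define z where "z = collar y0 x"
    have dz: "dist z (f y0) < min d1 d2" using r1(2)[of x] x by (auto simp: z_def r_def dist_commute)
    define x' where "x' = (1 / (g z \<bullet> y0)) *\<^sub>R g z"
    have pos: "0 < g z \<bullet> y0" and x'b: "x' \<in> ball y0 r0"
      using d1(2)[of z] d2(2)[of z] False c dz by (auto simp: z_def x'_def)
    have gz: "norm (g z) = 1" using g_image c by (auto simp: z_def)
    have "\<Phi> x' = z" using pos gz fg c by (simp add: x'_def \<Phi>_scale \<Phi>_sphere z_def)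
    moreover have x'1: "x' \<bullet> y0 = 1" using pos by (simp add: x'_def)
    ultimately have "collar y0 x' = collar y0 x" by (simp add: collar_def[of y0 x'] z_def)
    then have "x' = x" by (rule inj_onD[OF r0(3)]) (use x x'b in \<open>auto simp: r_def\<close>)
    then show ?thesis using x'1 by simp
  qed
  moreover have "r > 0" "ball y0 r \<subseteq> - {0}" "inj_on (collar y0) (ball y0 r)"
    using r0 r1 by (auto simp: r_def intro: inj_on_subset)
  ultimately show thesis using that by blast
qed

lemma connected_in_complement:
  assumes "connected C" "C \<inter> S = {}" "z \<in> C"
  shows "z \<in> outside S \<Longrightarrow> C \<subseteq> outside S" "z \<in> inside S \<Longrightarrow> C \<subseteq> inside S"
proof -
  have cl: "closed S" using compact_S compact_imp_closed by blast
  have sub: "C \<subseteq> inside S \<union> outside S" using assms(2) by auto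
  have "inside S \<inter> C = {} \<or> outside S \<inter> C = {}"
    using connectedD[OF assms(1) open_inside[OF cl] open_outside[OF cl]] sub inside_Int_outside[of S] by blast
  then show "z \<in> outside S \<Longrightarrow> C \<subseteq> outside S" "z \<in> inside S \<Longrightarrow> C \<subseteq> inside S"
    using sub assms(3) by blast+
qed

text \<open>In the chart \<open>collar\<close> the surface is a plane, and the half balls on its two sides are connected and
  avoid \<open>S\<close>; since \<open>S\<close> is the frontier of both its inside and its outside, they lie on different
  sides.\<close>

lemma collar_sides:
  assumes y0: "norm y0 = 1"
  obtains s r where "s = 1 \<or> s = -1" "r > 0" "ball y0 r \<subseteq> - {0}"
    "\<And>x. x \<in> ball y0 r \<Longrightarrow> 0 < s * (x \<bullet> y0 - 1) \<Longrightarrow> collar y0 x \<in> outside S"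
    "\<And>x. x \<in> ball y0 r \<Longrightarrow> s * (x \<bullet> y0 - 1) < 0 \<Longrightarrow> collar y0 x \<in> inside S"
proof -
  obtain r where r: "r > 0" "ball y0 r \<subseteq> - {0}" "inj_on (collar y0) (ball y0 r)"
    "\<And>x. x \<in> ball y0 r \<Longrightarrow> collar y0 x \<in> S \<Longrightarrow> x \<bullet> y0 = 1"
    by (rule collar_meets_S_only_in_plane[OF y0]) (rule that)
  have yy: "y0 \<bullet> y0 = 1" using y0 by (simp add: norm_eq_1)
  have fS: "f y0 \<in> S" using f_image y0 by auto
  have cont: "continuous_on (ball y0 r) (collar y0)"
    using continuous_on_subset[OF Ck_on_imp_continuous_on[OF Ck_on_collar] r(2)] .
  \<comment> \<open>By invariance of domain the image is a neighbourhood of \<open>f y0\<close>, so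
    it meets the inside and the outside of \<open>S\<close>, each of them in the image of a half
    ball.\<close>
  have op: "open (collar y0 ` ball y0 r)" by (rule invariance_of_domain[OF cont open_ball r(3)])
  have mem: "f y0 \<in> collar y0 ` ball y0 r"
  proof
    show "f y0 = collar y0 y0" using y0 yy by (simp add: collar_def \<Phi>_sphere)
  qed (use r(1) in simp)
  define Bp where "Bp = {x \<in> ball y0 r. 1 < x \<bullet> y0}"
  define Bm where "Bm = {x \<in> ball y0 r. x \<bullet> y0 < 1}"
  have half: "convex (ball y0 r \<inter> {x. x \<bullet> y0 > 1})" "convex (ball y0 r \<inter> {x. x \<bullet> y0 < 1})"
    using convex_halfspace_gt[of 1 y0] convex_halfspace_lt[of y0 1]
    by (auto intro!: convex_Int simp: inner_commute)
  moreover have "Bp = ball y0 r \<inter> {x. x \<bullet> y0 > 1}" "Bm = ball y0 r \<inter> {x. x \<bullet> y0 < 1}"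
    unfolding Bp_def Bm_def by blast+
  ultimately have conv: "convex Bp" "convex Bm" by simp_all
  have BB: "Bp \<subseteq> ball y0 r" "Bm \<subseteq> ball y0 r" unfolding Bp_def Bm_def by blast+
  have conn: "connected (collar y0 ` Bp)" "connected (collar y0 ` Bm)"
    by (rule connected_continuous_image[OF continuous_on_subset[OF cont BB(1)] convex_connected[OF conv(1)]],
        rule connected_continuous_image[OF continuous_on_subset[OF cont BB(2)] convex_connected[OF conv(2)]])
  have disj: "collar y0 ` Bp \<inter> S = {}" "collar y0 ` Bm \<inter> S = {}"
  proof -
    have "collar y0 x \<notin> S" if "x \<in> Bp \<or> x \<in> Bm" for x
      using r(4)[of x] that by (auto simp: Bp_def Bm_def)
    then show "collar y0 ` Bp \<inter> S = {}" "collar y0 ` Bm \<inter> S = {}" by blast+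
  qed
  have inp: "x \<in> Bp \<or> x \<in> Bm" if x: "x \<in> ball y0 r" and nS: "collar y0 x \<notin> S" for x
  proof -
    have "x \<bullet> y0 \<noteq> 1"
    proof
      assume "x \<bullet> y0 = 1"
      then have "collar y0 x = \<Phi> x" by (simp add: collar_def)
      moreover have "x \<noteq> 0" using x r(2) by blast
      ultimately show False using nS \<Phi>_in_S by simp
    qed
    then show ?thesis using x by (auto simp: Bp_def Bm_def)
  qed
  obtain xo where xo: "xo \<in> ball y0 r" "collar y0 xo \<in> outside S" using frontier_sides(1)[OF fS op mem] by blast
  obtain xi where xi: "xi \<in> ball y0 r" "collar y0 xi \<in> inside S" using frontier_sides(2)[OF fS op mem] by blast
  have nS: "collar y0 xo \<notin> S" "collar y0 xi \<notin> S" using xo xi inside_Un_outside[of S] by blast+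
  have io: "inside S \<inter> outside S = {}" by simp
  consider "xo \<in> Bp" | "xo \<in> Bm" using inp[OF xo(1) nS(1)] by blast
  then show thesis
  proof cases
    case 1
    have "collar y0 ` Bp \<subseteq> outside S"
      using connected_in_complement(1)[OF conn(1) disj(1) imageI[OF 1] xo(2)] .
    moreover have "xi \<in> Bm" using inp[OF xi(1) nS(2)] calculation xi(2) io by blast
    then have "collar y0 ` Bm \<subseteq> inside S"
      using connected_in_complement(2)[OF conn(2) disj(2) imageI xi(2)] by blast
    ultimately show thesis
      by (intro that[of 1 r] r(1,2)) (auto simp: Bp_def Bm_def image_subset_iff)
  next
    case 2
    have "collar y0 ` Bm \<subseteq> outside S"
      using connected_in_complement(1)[OF conn(2) disj(2) imageI[OF 2] xo(2)] .
    moreover have "xi \<in> Bp" using inp[OF xi(1) nS(2)] calculation xi(2) io by blast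
    then have "collar y0 ` Bp \<subseteq> inside S"
      using connected_in_complement(2)[OF conn(1) disj(1) imageI xi(2)] by blast
    ultimately show thesis
      by (intro that[of "-1" r] r(1,2)) (auto simp: Bp_def Bm_def image_subset_iff)
  qed
qed

section \<open>The sign of the outer normal and the shape operator\<close>

lemma unit_normal_unique:
  assumes y: "norm y = 1" and m: "norm m = 1" "\<forall>v\<in>tangent_space S (f y). m \<bullet> v = 0"
  shows "m = n y \<or> m = - n y"
proof -
  have "y \<noteq> 0" using y by auto
  then have nn: "norm (n y) = 1" "n y \<bullet> n y = 1" using norm_n[of y] by (simp_all add: norm_eq_1)
  define v where "v = m - (m \<bullet> n y) *\<^sub>R n y"
  have vn: "v \<bullet> n y = 0" by (simp add: v_def inner_diff_left nn)
  then have "m \<bullet> v = 0" using m(2) tangent_space_eq[OF y] by simp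
  then have "v \<bullet> v = 0" using vn by (simp add: v_def inner_diff_left inner_commute)
  then have eq: "m = (m \<bullet> n y) *\<^sub>R n y" by (simp add: v_def)
  then have "norm m = \<bar>m \<bullet> n y\<bar> * norm (n y)" by (metis norm_scaleR)
  then have "\<bar>m \<bullet> n y\<bar> = 1" using m(1) nn by simp
  then have "m \<bullet> n y = 1 \<or> m \<bullet> n y = -1" by linarith
  then show ?thesis using eq by (metis scaleR_one scaleR_minus1_left)
qed

text \<open>For \<open>y\<close> near \<open>y0\<close> the normal segment at \<open>f y\<close> is
  the collar image of a radial segment through the central projection \<open>q\<close> of
  \<open>y\<close>, with the height as parameter. The side that is outer at \<open>y0\<close> is
  therefore outer for all nearby \<open>y\<close>, with one and the same sign.\<close>

lemma outer_normal_local: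
  assumes y0: "norm y0 = 1"
  obtains s d where "s = 1 \<or> s = -1" "d > 0"
    "\<And>y. norm y = 1 \<Longrightarrow> dist y y0 < d \<Longrightarrow> outer_normal S (f y) = s *\<^sub>R n y"
proof -
  obtain s r where sr: "s = 1 \<or> s = (-1::real)" "r > 0" "ball y0 r \<subseteq> - {0}"
    "\<And>x. x \<in> ball y0 r \<Longrightarrow> 0 < s * (x \<bullet> y0 - 1) \<Longrightarrow> collar y0 x \<in> outside S"
    "\<And>x. x \<in> ball y0 r \<Longrightarrow> s * (x \<bullet> y0 - 1) < 0 \<Longrightarrow> collar y0 x \<in> inside S"
    by (rule collar_sides[OF y0]) (rule that)
  have yy: "y0 \<bullet> y0 = 1" using y0 by (simp add: norm_eq_1)
  have "isCont (\<lambda>y. (1 / (y \<bullet> y0)) *\<^sub>R y) y0" using yy by (intro continuous_intros) auto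
  from this[unfolded continuous_at_eps_delta, rule_format, OF sr(2)] yy
  obtain d1 where d1: "d1 > 0" "\<And>y. dist y y0 < d1 \<Longrightarrow> dist ((1 / (y \<bullet> y0)) *\<^sub>R y) y0 < r" by auto
  have "isCont (\<lambda>y. y \<bullet> y0) y0" by (intro continuous_intros)
  from this[unfolded continuous_at_eps_delta, rule_format, of 1] yy
  obtain d2 where d2: "d2 > 0" "\<And>y. dist y y0 < d2 \<Longrightarrow> \<bar>y \<bullet> y0 - 1\<bar> < 1" by (auto simp: dist_real_def)
  have "outer_normal S (f y) = s *\<^sub>R n y" if y: "norm y = 1" "dist y y0 < min d1 d2" for y
  proof -
    have ynz: "y \<noteq> 0" using y by auto
    have pos: "y \<bullet> y0 > 0" using d2(2)[of y] y by linarith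
    define q where "q = (1 / (y \<bullet> y0)) *\<^sub>R y"
    have q: "q \<in> ball y0 r" "q \<bullet> y0 = 1" using d1(2)[of y] y pos by (auto simp: q_def dist_commute)
    have "open (ball y0 r)" by simp
    then obtain e where e: "e > 0" "ball q e \<subseteq> ball y0 r" using q(1) open_contains_ball by blast
    \<comment> \<open>The bound 1 keeps \<open>1 + t\<close> positive, so that \<open>\<Phi>\<close>
      and \<open>n\<close> do not notice the scaling; the other bound keeps
      \<open>(1 + t) *\<^sub>R q\<close> in the ball.\<close>
    define \<epsilon> where "\<epsilon> = min 1 (e / (norm q + 1))"
    have nq: "norm q + 1 > 0" using norm_ge_zero[of q] by linarith
    have \<epsilon>: "\<epsilon> > 0" "\<epsilon> \<le> 1" using e nq by (simp_all add: \<epsilon>_def)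
    have shift: "(1 + t) *\<^sub>R q \<in> ball y0 r" "collar y0 ((1 + t) *\<^sub>R q) = f y + t *\<^sub>R n y" "(1 + t) *\<^sub>R q \<bullet> y0 - 1 = t"
      if t: "\<bar>t\<bar> < \<epsilon>" for t
    proof -
      have "dist q ((1 + t) *\<^sub>R q) = \<bar>t\<bar> * norm q" by (simp add: dist_norm algebra_simps)
      also have "\<dots> \<le> \<epsilon> * norm q" using t by (intro mult_right_mono) auto
      also have "\<dots> < \<epsilon> * (norm q + 1)" using \<epsilon> by simp
      also have "\<dots> \<le> e / (norm q + 1) * (norm q + 1)" using nq by (intro mult_right_mono) (auto simp: \<epsilon>_def)
      also have "\<dots> = e" using nq by simp
      finally show "(1 + t) *\<^sub>R q \<in> ball y0 r" using e by auto
      show tq: "(1 + t) *\<^sub>R q \<bullet> y0 - 1 = t" using q by simp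
      define k where "k = (1 + t) * (1 / (y \<bullet> y0))"
      have c: "0 < k" using t \<epsilon> pos by (simp add: k_def)
      have eqy: "(1 + t) *\<^sub>R q = k *\<^sub>R y" by (simp add: q_def k_def)
      have "\<Phi> ((1 + t) *\<^sub>R q) = f y" unfolding eqy \<Phi>_scale[OF c] using y by (simp add: \<Phi>_sphere)
      moreover have "n ((1 + t) *\<^sub>R q) = n y"
      proof -
        have "k *\<^sub>R y \<noteq> 0" using c ynz by simp
        moreover have "nrm (k *\<^sub>R y) = y" using c y by simp
        ultimately show ?thesis unfolding eqy by (metis n_nrm)
      qed
      ultimately show "collar y0 ((1 + t) *\<^sub>R q) = f y + t *\<^sub>R n y"
        unfolding collar_def tq by simp
    qed
    have out: "f y + t *\<^sub>R (s *\<^sub>R n y) \<in> outside S" if t: "0 < t" "t < \<epsilon>" for t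
    proof -
      have "\<bar>t * s\<bar> < \<epsilon>" using t sr(1) by auto
      note sh = shift[OF this]
      have "0 < s * ((1 + t * s) *\<^sub>R q \<bullet> y0 - 1)" unfolding sh(3) using t sr(1) by auto
      from sr(4)[OF sh(1) this] show ?thesis by (simp add: sh(2))
    qed
    have ins: "f y + t *\<^sub>R (- (s *\<^sub>R n y)) \<in> inside S" if t: "0 < t" "t < \<epsilon>" for t
    proof -
      have "\<bar>- t * s\<bar> < \<epsilon>" using t sr(1) by auto
      note sh = shift[OF this]
      have "s * ((1 + - t * s) *\<^sub>R q \<bullet> y0 - 1) < 0" unfolding sh(3) using t sr(1) by auto
      from sr(5)[OF sh(1) this, unfolded sh(2)] show ?thesis by simp
    qed
    show ?thesis
      unfolding outer_normal_def
    proof (rule the_equality)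
      show "norm (s *\<^sub>R n y) = 1 \<and> (\<forall>v\<in>tangent_space S (f y). s *\<^sub>R n y \<bullet> v = 0) \<and>
        (\<exists>\<epsilon>>0. \<forall>t\<in>{0<..<\<epsilon>}. f y + t *\<^sub>R s *\<^sub>R n y \<in> outside S)"
        using sr(1) norm_n[OF ynz] tangent_space_eq[OF y(1)] out \<epsilon>(1)
        by (auto simp: inner_commute intro!: exI[of _ \<epsilon>])
    next
      fix m assume m: "norm m = 1 \<and> (\<forall>v\<in>tangent_space S (f y). m \<bullet> v = 0) \<and>
        (\<exists>\<epsilon>>0. \<forall>t\<in>{0<..<\<epsilon>}. f y + t *\<^sub>R m \<in> outside S)"
      then obtain e' where e': "e' > 0" "\<And>t. 0 < t \<Longrightarrow> t < e' \<Longrightarrow> f y + t *\<^sub>R m \<in> outside S" by auto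
      define t where "t = min \<epsilon> e' / 2"
      have t: "0 < t" "t < \<epsilon>" "t < e'" using \<epsilon> e' by (auto simp: t_def min_def)
      \<comment> \<open>The opposite normal starts into the inside, at the same small
        \<open>t\<close> for which \<open>m\<close> leads outside.\<close>
      have "m \<noteq> - (s *\<^sub>R n y)"
        using e'(2)[OF t(1,3)] ins[OF t(1,2)] inside_Int_outside[of S] by blast
      moreover have "m = n y \<or> m = - n y" using unit_normal_unique[OF y(1)] m by blast
      ultimately show "m = s *\<^sub>R n y" using sr(1) by auto
    qed
  qed
  then show thesis using that[of s "min d1 d2"] sr(1) d1(1) d2(1) by auto
qed

text \<open>Near \<open>f y0\<close> the outer normal agrees on \<open>S\<close> with the smooth map
  \<open>s *\<^sub>R n (G x)\<close>, so a derivative within \<open>S\<close> exists. Composing any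
  such derivative with \<open>\<Phi>\<close>, which lives on an open set and takes values in
  \<open>S\<close>, gives an ordinary derivative and determines it on tangent vectors.\<close>

lemma shape_operator_D:
  assumes y0: "norm y0 = 1"
  obtains s where "s = 1 \<or> s = -1" "outer_normal S (f y0) = s *\<^sub>R n y0" "linear (shape_operator S (f y0))"
    "\<And>w. shape_operator S (f y0) (D y0 w) = s *\<^sub>R dn y0 w"
proof -
  have nz: "y0 \<noteq> 0" using y0 by auto
  obtain s d where sd: "s = 1 \<or> s = (-1::real)" "d > 0"
    "\<And>y. norm y = 1 \<Longrightarrow> dist y y0 < d \<Longrightarrow> outer_normal S (f y) = s *\<^sub>R n y"
    by (rule outer_normal_local[OF y0]) (rule that)
  have fS: "f y0 \<in> S" using f_image y0 by auto
  obtain W G where W: "open W" "f y0 \<in> W" "\<And>k. Ck_on k G W" "\<And>x. x \<in> S \<Longrightarrow> x \<in> W \<Longrightarrow> G x = g x"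
    by (rule g_local_extension[OF y0]) (rule that)
  let ?L = "frechet_derivative G (at (f y0))" and ?B = "shape_operator S (f y0)"
  have Gy: "G (f y0) = y0" using W(2,4) fS gf[of y0] y0 by auto
  have dG: "(G has_derivative ?L) (at (f y0))" by (rule Ck_on_has_derivative[OF W(3) W(2)])
  have "(n has_derivative dn y0) (at (G (f y0)))" using n_has_derivative[OF nz] Gy by simp
  from has_derivative_scaleR_right[OF diff_chain_at[OF dG this], of s]
  have 1: "((\<lambda>x. s *\<^sub>R n (G x)) has_derivative (\<lambda>v. s *\<^sub>R dn y0 (?L v))) (at (f y0) within S)"
    by (simp add: o_def has_derivative_at_withinI)
  have cG: "isCont G (f y0)" using dG has_derivative_continuous by blast
  have "\<exists>e>0. \<forall>x. dist x (f y0) < e \<longrightarrow> x \<in> W \<and> dist (G x) y0 < d"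
  proof -
    from cG[unfolded continuous_at_eps_delta, rule_format, OF sd(2)] Gy
    obtain e1 where e1: "e1 > 0" "\<And>x. dist x (f y0) < e1 \<Longrightarrow> dist (G x) y0 < d" by auto
    obtain e2 where e2: "e2 > 0" "\<And>x. dist x (f y0) < e2 \<Longrightarrow> x \<in> W"
      using W(1,2) open_dist by metis
    show ?thesis using e1 e2 by (intro exI[of _ "min e1 e2"]) auto
  qed
  then obtain e where e: "e > 0" "\<And>x. dist x (f y0) < e \<Longrightarrow> x \<in> W \<and> dist (G x) y0 < d" by blast
  have "(outer_normal S has_derivative (\<lambda>v. s *\<^sub>R dn y0 (?L v))) (at (f y0) within S)"
  proof (rule has_derivative_transform_within[OF 1 e(1) fS])
    fix x assume x: "x \<in> S" "dist x (f y0) < e"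
    then have gx: "G x = g x" "dist (g x) y0 < d" using e(2)[OF x(2)] W(4) by auto
    have "norm (g x) = 1" using g_image x by auto
    from sd(3)[OF this gx(2)] show "s *\<^sub>R n (G x) = outer_normal S x" using fg[OF x(1)] gx by simp
  qed
  then have B: "(outer_normal S has_derivative ?B) (at (f y0) within S)"
    unfolding shape_operator_def using frechet_derivative_works differentiableI by blast
  have "?B (D y0 w) = s *\<^sub>R dn y0 w" for w
  proof -
    have B': "(outer_normal S has_derivative ?B) (at (\<Phi> y0) within \<Phi> ` (- {0}))"
      by (rule has_derivative_subset) (use B y0 \<Phi>_in_S in \<open>auto simp: \<Phi>_sphere\<close>)
    have "(\<Phi> has_derivative D y0) (at y0 within - {0})"
      using \<Phi>_has_derivative[OF nz] by (rule has_derivative_at_withinI)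
    from diff_chain_within[OF this B']
    have 2: "((\<lambda>x. outer_normal S (\<Phi> x)) has_derivative (\<lambda>w. ?B (D y0 w))) (at y0)"
      using at_within_open[of y0 "- {0}"] nz open_punctured by (simp add: o_def)
    have 3: "((\<lambda>x. s *\<^sub>R n x) has_derivative (\<lambda>w. s *\<^sub>R dn y0 w)) (at y0)"
      by (rule has_derivative_scaleR_right[OF n_has_derivative[OF nz]])
    have "isCont nrm y0" using nz by (intro continuous_intros) auto
    from this[unfolded continuous_at_eps_delta, rule_format, OF sd(2)] y0
    obtain e1 where e1: "e1 > 0" "\<And>x. dist x y0 < e1 \<Longrightarrow> dist (nrm x) y0 < d" by auto
    have 4: "((\<lambda>x. outer_normal S (\<Phi> x)) has_derivative (\<lambda>w. s *\<^sub>R dn y0 w)) (at y0)"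
    proof (rule has_derivative_transform_within[OF 3, of "min e1 1"])
      fix x assume x: "dist x y0 < min e1 1"
      then have "x \<noteq> 0" using y0 by auto
      then show "s *\<^sub>R n x = outer_normal S (\<Phi> x)"
        using sd(3)[of "nrm x"] e1(2)[of x] x by (simp add: \<Phi>_def n_nrm)
    qed (use e1 in auto)
    from fun_cong[OF has_derivative_unique[OF 2 4]] show ?thesis .
  qed
  moreover have "outer_normal S (f y0) = s *\<^sub>R n y0" using sd y0 by auto
  moreover have "linear ?B" using B has_derivative_linear by blast
  ultimately show thesis using that[of s] sd(1) by blast
qed

text \<open>As the tangent plane is spanned by eigenvectors, the identity holds with the product of
  any pair of principal curvatures. This makes the product unique, and
  \<open>symmetric_plane_eigenvectors\<close> provides a pair. The sign of the normal enters
  squared.\<close>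

lemma gauss_curvature_cross:
  assumes y: "norm y = 1"
  shows "dn y a \<times> dn y b = gauss_curvature S (f y) *\<^sub>R (D y a \<times> D y b)"
proof -
  have nz: "y \<noteq> 0" using y by auto
  obtain s where s: "s = 1 \<or> s = -1" "outer_normal S (f y) = s *\<^sub>R n y" "linear (shape_operator S (f y))"
    "\<And>w. shape_operator S (f y) (D y w) = s *\<^sub>R dn y w"
    by (rule shape_operator_D[OF y]) (rule that)
  let ?B = "shape_operator S (f y)"
  have ss: "s * s = 1" using s(1) by auto
  have rel: "dn y a \<times> dn y b = (\<kappa>1 * \<kappa>2) *\<^sub>R (D y a \<times> D y b)" if pc: "principal_curvatures S (f y) \<kappa>1 \<kappa>2" for \<kappa>1 \<kappa>2 a b
  proof -
    obtain e1 e2 where e: "norm e1 = 1" "norm e2 = 1" "e1 \<bullet> e2 = 0" "span {e1, e2} = tangent_space S (f y)"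
      "?B e1 = \<kappa>1 *\<^sub>R e1" "?B e2 = \<kappa>2 *\<^sub>R e2"
      using pc unfolding principal_curvatures_def by blast
    have BB: "?B u \<times> ?B v = (\<kappa>1 * \<kappa>2) *\<^sub>R (u \<times> v)" if uv: "u \<in> span {e1, e2}" "v \<in> span {e1, e2}" for u v
    proof -
      obtain u1 u2 v1 v2 where *: "u = u1 *\<^sub>R e1 + u2 *\<^sub>R e2" "v = v1 *\<^sub>R e1 + v2 *\<^sub>R e2"
        using uv unfolding span_breakdown_eq by (metis add.commute diff_add_cancel eq_iff_diff_eq_0 span_empty singletonD)
      have B: "?B u = (u1 * \<kappa>1) *\<^sub>R e1 + (u2 * \<kappa>2) *\<^sub>R e2" "?B v = (v1 * \<kappa>1) *\<^sub>R e1 + (v2 * \<kappa>2) *\<^sub>R e2"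
        by (simp_all add: * linear_add[OF s(3)] linear_scale[OF s(3)] e)
      show ?thesis
        unfolding B unfolding *
        by (simp add: vec_eq_iff forall_3 cross_components algebra_simps)
    qed
    have "D y w \<in> span {e1, e2}" for w
      using n_dot_D[OF nz, of w] by (simp add: e(4) tangent_space_eq[OF y] inner_commute)
    then have "?B (D y a) \<times> ?B (D y b) = (\<kappa>1 * \<kappa>2) *\<^sub>R (D y a \<times> D y b)" by (intro BB)
    then show ?thesis using ss by (simp add: s(4) cross_mult_left cross_mult_right)
  qed
  have inv: "?B u \<bullet> n y = 0" if u: "u \<bullet> n y = 0" for u
  proof -
    obtain w where "u = D y w" by (rule D_surj_tangent[OF y u])
    then show ?thesis using n_dot_dn[OF nz, of w] by (simp add: s(4) inner_commute)
  qed
  have sym: "?B u \<bullet> v = ?B v \<bullet> u" if u: "u \<bullet> n y = 0" and v: "v \<bullet> n y = 0" for u v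
  proof -
    obtain w1 where "u = D y w1" by (rule D_surj_tangent[OF y u])
    moreover obtain w2 where "v = D y w2" by (rule D_surj_tangent[OF y v])
    ultimately show ?thesis using dn_dot_D_commute[OF nz, of w1 w2] by (simp add: s(4))
  qed
  obtain e1 e2 \<kappa>1 \<kappa>2 where "norm e1 = 1" "norm e2 = 1" "e1 \<bullet> e2 = 0" "span {e1, e2} = {v. v \<bullet> n y = 0}"
    "?B e1 = \<kappa>1 *\<^sub>R e1" "?B e2 = \<kappa>2 *\<^sub>R e2"
    by (rule symmetric_plane_eigenvectors[OF norm_n[OF nz] s(3) inv sym]) (assumption | rule that)+
  then have ex: "principal_curvatures S (f y) \<kappa>1 \<kappa>2"
    unfolding principal_curvatures_def tangent_space_eq[OF y] by blast
  obtain a0 b0 where "D y a0 \<times> D y b0 = N y" by (rule tangent_frame[OF y])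
  then have nz0: "D y a0 \<times> D y b0 \<noteq> 0" using N_nonzero[OF nz] by simp
  have "gauss_curvature S (f y) = \<kappa>1 * \<kappa>2"
    unfolding gauss_curvature_def
  proof (rule the_equality)
    fix k assume "\<exists>\<kappa>1 \<kappa>2. principal_curvatures S (f y) \<kappa>1 \<kappa>2 \<and> k = \<kappa>1 * \<kappa>2"
    then have "dn y a0 \<times> dn y b0 = k *\<^sub>R (D y a0 \<times> D y b0)" using rel by blast
    then show "k = \<kappa>1 * \<kappa>2" using rel[OF ex, of a0 b0] nz0 by simp
  qed (use ex in blast)
  then show ?thesis using rel[OF ex] by simp
qed

text \<open>A formula in \<open>y\<close> alone, without a choice of frame, from which the
  continuity of the curvature is read off later.\<close>

lemma gauss_curvature_eq:
  assumes y: "norm y = 1"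
  shows "gauss_curvature S (f y) = (cofactor3 (dn y) y \<bullet> n y) / norm (N y)"
proof -
  have nz: "y \<noteq> 0" using y by auto
  obtain a b where ab: "norm a = 1" "a \<bullet> y = 0" "b \<bullet> y = 0" "a \<times> b = y" and DN: "D y a \<times> D y b = N y"
    by (rule tangent_frame[OF y])
  have "cofactor3 (dn y) y = gauss_curvature S (f y) *\<^sub>R N y"
    using cross3_linear_image_eq_cofactor3[OF linear_dn[OF nz], of a b] gauss_curvature_cross[OF y, of a b] by (simp add: ab DN)
  then show ?thesis
    using N_nonzero[OF nz] by (simp add: n_def power2_norm_eq_inner[symmetric] power2_eq_square)
qed

end

section \<open>Calculus in two variables\<close>

definition d1 :: "(real \<times> real \<Rightarrow> 'b::euclidean_space) \<Rightarrow> real \<times> real \<Rightarrow> 'b" where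
  "d1 F z = frechet_derivative F (at z) (1, 0)"

definition d2 :: "(real \<times> real \<Rightarrow> 'b::euclidean_space) \<Rightarrow> real \<times> real \<Rightarrow> 'b" where
  "d2 F z = frechet_derivative F (at z) (0, 1)"

definition smooth :: "(real \<times> real \<Rightarrow> 'b::euclidean_space) \<Rightarrow> bool" where
  "smooth F \<longleftrightarrow> (\<forall>k. Ck_on k F UNIV)"

lemma smooth_d1: "smooth F \<Longrightarrow> smooth (d1 F)" and smooth_d2: "smooth F \<Longrightarrow> smooth (d2 F)"
  unfolding smooth_def d1_def[abs_def] d2_def[abs_def] by (metis Ck_on.simps(2))+

lemma smooth_add: "smooth F \<Longrightarrow> smooth G \<Longrightarrow> smooth (\<lambda>z. F z + G z)"
  and smooth_mult: "smooth F' \<Longrightarrow> smooth G' \<Longrightarrow> smooth (\<lambda>z. F' z * G' z :: real)"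
  and smooth_scaleR: "smooth F' \<Longrightarrow> smooth G \<Longrightarrow> smooth (\<lambda>z. F' z *\<^sub>R G z)"
  and smooth_inner: "smooth F \<Longrightarrow> smooth G \<Longrightarrow> smooth (\<lambda>z. F z \<bullet> G z)"
  and smooth_cross3: "smooth X \<Longrightarrow> smooth Y \<Longrightarrow> smooth (\<lambda>z. X z \<times> Y z)"
  by (simp_all add: smooth_def Ck_on_add Ck_on_mult Ck_on_scaleR Ck_on_inner Ck_on_cross3)

lemma smooth_inverse_norm: "smooth F \<Longrightarrow> (\<And>z. F z \<noteq> 0) \<Longrightarrow> smooth (\<lambda>z. inverse (norm (F z)))"
  by (simp add: smooth_def Ck_on_inverse_norm)

lemma smooth_continuous: "smooth F \<Longrightarrow> continuous_on S F"
  unfolding smooth_def using Ck_on_imp_continuous_on continuous_on_subset by blast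

lemma smooth_has_derivative:
  assumes "smooth F"
  shows "(F has_derivative (\<lambda>h. fst h *\<^sub>R d1 F z + snd h *\<^sub>R d2 F z)) (at z)"
proof -
  let ?F' = "frechet_derivative F (at z)"
  have d: "(F has_derivative ?F') (at z)"
    by (rule Ck_on_has_derivative[where U=UNIV and k=0]) (use assms in \<open>auto simp: smooth_def\<close>)
  have "?F' h = fst h *\<^sub>R d1 F z + snd h *\<^sub>R d2 F z" for h
  proof -
    have "h = fst h *\<^sub>R (1, 0) + snd h *\<^sub>R (0, 1)" by (simp add: prod_eq_iff)
    then have "?F' h = ?F' (fst h *\<^sub>R (1, 0) + snd h *\<^sub>R (0, 1))" by simp
    then show ?thesis
      using has_derivative_linear[OF d] by (simp only: linear_add linear_scale d1_def d2_def)
  qed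
  then show ?thesis using d by (rule has_derivative_eq_rhs[OF _ ext, rotated])
qed

lemma partials_unique:
  assumes "(F has_derivative (\<lambda>h. fst h *\<^sub>R a + snd h *\<^sub>R b)) (at z)"
  shows "d1 F z = a" "d2 F z = b"
  using fun_cong[OF frechet_derivative_at[OF assms], of "(1, 0)"] fun_cong[OF frechet_derivative_at[OF assms], of "(0, 1)"]
  by (simp_all add: d1_def d2_def)

lemma partials_bounded_bilinear:
  assumes p: "bounded_bilinear p" and FG: "smooth F" "smooth G"
  shows "d1 (\<lambda>z. p (F z) (G z)) z = p (d1 F z) (G z) + p (F z) (d1 G z)"
    "d2 (\<lambda>z. p (F z) (G z)) z = p (d2 F z) (G z) + p (F z) (d2 G z)"
proof -
  interpret bounded_bilinear p by (rule p)
  have "((\<lambda>z. p (F z) (G z)) has_derivative (\<lambda>h. fst h *\<^sub>R (p (d1 F z) (G z) + p (F z) (d1 G z))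
      + snd h *\<^sub>R (p (d2 F z) (G z) + p (F z) (d2 G z)))) (at z)"
    by (rule has_derivative_eq_rhs[OF FDERIV[OF smooth_has_derivative[OF FG(1)] smooth_has_derivative[OF FG(2)]]])
       (simp add: fun_eq_iff add_left add_right scaleR_left scaleR_right algebra_simps)
  from partials_unique[OF this]
  show "d1 (\<lambda>z. p (F z) (G z)) z = p (d1 F z) (G z) + p (F z) (d1 G z)"
    "d2 (\<lambda>z. p (F z) (G z)) z = p (d2 F z) (G z) + p (F z) (d2 G z)" .
qed

lemmas partials_inner = partials_bounded_bilinear[OF bounded_bilinear_inner]
  and partials_mult = partials_bounded_bilinear[OF bounded_bilinear_mult]
  and partials_scaleR = partials_bounded_bilinear[OF bounded_bilinear_scaleR]
  and partials_cross3 = partials_bounded_bilinear[OF bounded_bilinear_cross3]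

lemma partials_add:
  assumes "smooth F" "smooth G"
  shows "d1 (\<lambda>z. F z + G z) z = d1 F z + d1 G z" "d2 (\<lambda>z. F z + G z) z = d2 F z + d2 G z"
proof -
  have "((\<lambda>z. F z + G z) has_derivative (\<lambda>h. fst h *\<^sub>R (d1 F z + d1 G z) + snd h *\<^sub>R (d2 F z + d2 G z))) (at z)"
    by (rule has_derivative_eq_rhs[OF has_derivative_add[OF assms[THEN smooth_has_derivative]]])
       (simp add: fun_eq_iff algebra_simps)
  from partials_unique[OF this] show "d1 (\<lambda>z. F z + G z) z = d1 F z + d1 G z" "d2 (\<lambda>z. F z + G z) z = d2 F z + d2 G z" .
qed

lemma partials_commute: "smooth F \<Longrightarrow> d2 (d1 F) z = d1 (d2 F) z"
  unfolding d1_def[abs_def] d2_def[abs_def] smooth_def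
  by (rule symmetric_second_derivative[OF open_UNIV UNIV_I]) blast

lemma partials_const: "d1 (\<lambda>z. c) z = 0" "d2 (\<lambda>z. c) z = 0"
  by (simp_all add: d1_def d2_def frechet_derivative_const)

lemma has_vector_derivative_slices:
  assumes "smooth F"
  shows "((\<lambda>x. F (x, y)) has_vector_derivative d1 F (x, y)) (at x)"
    "((\<lambda>y. F (x, y)) has_vector_derivative d2 F (x, y)) (at y)"
proof -
  have "((\<lambda>x. (x, y)) has_derivative (\<lambda>h. (h, 0))) (at x)"
    by (auto intro!: derivative_eq_intros)
  from diff_chain_at[OF this smooth_has_derivative[OF assms]]
  show "((\<lambda>x. F (x, y)) has_vector_derivative d1 F (x, y)) (at x)"
    by (simp add: has_vector_derivative_def o_def)
  have "((\<lambda>y. (x, y)) has_derivative (\<lambda>h. (0, h))) (at y)"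
    by (auto intro!: derivative_eq_intros)
  from diff_chain_at[OF this smooth_has_derivative[OF assms]]
  show "((\<lambda>y. F (x, y)) has_vector_derivative d2 F (x, y)) (at y)"
    by (simp add: has_vector_derivative_def o_def)
qed

text \<open>Each term is integrated first in the variable in which it is differentiated; for the
  term with \<open>d1\<close> this requires exchanging the order of integration.\<close>

theorem green_rectangle:
  fixes A B :: "real \<times> real \<Rightarrow> real"
  assumes A: "smooth A" and B: "smooth B" and ab: "a \<le> b" and cd: "c \<le> d"
  shows "integral (cbox (a, c) (b, d)) (\<lambda>z. d1 A z - d2 B z) =
    integral {c..d} (\<lambda>y. A (b, y) - A (a, y)) - integral {a..b} (\<lambda>x. B (x, d) - B (x, c))"
proof -
  have cA: "continuous_on U (d1 A)" and cB: "continuous_on U (d2 B)" for U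
    using smooth_continuous smooth_d1[OF A] smooth_d2[OF B] by blast+
  have "integral (cbox (a, c) (b, d)) (\<lambda>z. d1 A z - d2 B z) =
    integral (cbox (a, c) (b, d)) (d1 A) - integral (cbox (a, c) (b, d)) (d2 B)"
    by (intro Henstock_Kurzweil_Integration.integral_diff integrable_continuous cA cB)
  also have "integral (cbox (a, c) (b, d)) (d2 B) = integral {a..b} (\<lambda>x. integral {c..d} (\<lambda>y. d2 B (x, y)))"
    using integral_prod_continuous[OF cB, of a c b d] by simp
  also have "\<dots> = integral {a..b} (\<lambda>x. B (x, d) - B (x, c))"
    by (intro integral_cong integral_unique[OF fundamental_theorem_of_calculus[OF cd
        has_vector_derivative_at_within[OF has_vector_derivative_slices(2)[OF B]]]])
  also have "integral (cbox (a, c) (b, d)) (d1 A) = integral {c..d} (\<lambda>y. integral {a..b} (\<lambda>x. d1 A (x, y)))"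
  proof -
    have cA': "continuous_on (cbox (a, c) (b, d)) (\<lambda>(x, y). d1 A (x, y))" using cA by simp
    have "integral (cbox (a, c) (b, d)) (d1 A) = integral {a..b} (\<lambda>x. integral {c..d} (\<lambda>y. d1 A (x, y)))"
      using integral_prod_continuous[OF cA, of a c b d] by simp
    also have "\<dots> = integral {c..d} (\<lambda>y. integral {a..b} (\<lambda>x. d1 A (x, y)))"
      using integral_swap_continuous[OF cA'] by simp
    finally show ?thesis .
  qed
  also have "\<dots> = integral {c..d} (\<lambda>y. A (b, y) - A (a, y))"
    by (intro integral_cong integral_unique[OF fundamental_theorem_of_calculus[OF ab
        has_vector_derivative_at_within[OF has_vector_derivative_slices(1)[OF A]]]])
  finally show ?thesis .
qed

text \<open>On each half turn the integrand has the primitive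
  \<open>arctan ((a \<bullet> b + (b \<bullet> b) tan t) / norm (a \<times> b))\<close>, which increases by \<open>pi\<close>.\<close>

lemma half_winding_integral:
  fixes a b :: "real^3"
  assumes ab: "a \<times> b \<noteq> 0"
  shows "((\<lambda>t. norm (a \<times> b) / (norm (cos t *\<^sub>R a + sin t *\<^sub>R b))\<^sup>2) has_integral pi) {-(pi/2)..pi/2}"
proof -
  define \<Delta> where "\<Delta> = norm (a \<times> b)"
  have \<Delta>: "\<Delta> > 0" "\<Delta>\<^sup>2 = (a \<bullet> a) * (b \<bullet> b) - (a \<bullet> b)\<^sup>2"
    using ab norm_cross[of a b] by (simp_all add: \<Delta>_def power2_norm_eq_inner)
  have bb: "b \<bullet> b > 0" using ab by auto
  let ?v = "\<lambda>t. cos t *\<^sub>R a + sin t *\<^sub>R b"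
  have v2: "(norm (?v t))\<^sup>2 = (cos t)\<^sup>2 * (a \<bullet> a) + 2 * cos t * sin t * (a \<bullet> b) + (sin t)\<^sup>2 * (b \<bullet> b)" for t
    unfolding power2_norm_eq_inner
    by (simp add: inner_add_left inner_add_right inner_commute[of b a] power2_eq_square algebra_simps)
  \<comment> \<open>At the end points \<open>tan\<close> has the default value 0 from a division by
    zero, so the limits of the primitive are put in by hand to make it continuous on the closed
    interval.\<close>
  define F where "F t = (if t \<le> -(pi/2) then -(pi/2) else if t \<ge> pi/2 then pi/2 else arctan ((a \<bullet> b + (b \<bullet> b) * tan t) / \<Delta>))" for t
  have in_F: "F t = arctan ((a \<bullet> b + (b \<bullet> b) * tan t) / \<Delta>)" if "t \<in> {-(pi/2)<..<pi/2}" for t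
    using that by (simp add: F_def)
  have in_F': "F t = arctan (inverse \<Delta> * (a \<bullet> b + (b \<bullet> b) * tan t))" if "t \<in> {-(pi/2)<..<pi/2}" for t
    unfolding in_F[OF that] by (simp only: divide_inverse mult.commute)
  have mpi: "-(pi/2) < pi/2" by simp
  have "\<not> pi/2 \<le> -(pi/2)" using mpi by (simp only: not_le)
  then have F_ends: "F (pi/2) = pi/2" "F (-(pi/2)) = -(pi/2)"
    unfolding F_def by (simp_all only: order_refl if_True if_False)
  have deriv: "(F has_vector_derivative \<Delta> / (norm (?v t))\<^sup>2) (at t)" if t: "t \<in> {-(pi/2)<..<pi/2}" for t
  proof -
    have c: "cos t > 0" using t by (intro cos_gt_zero_pi) auto
    define w where "w = (a \<bullet> b + (b \<bullet> b) * tan t) / \<Delta>"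
    have "((\<lambda>t. arctan ((a \<bullet> b + (b \<bullet> b) * tan t) / \<Delta>)) has_real_derivative
        inverse (1 + w\<^sup>2) * (((b \<bullet> b) * inverse ((cos t)\<^sup>2)) / \<Delta>)) (at t)"
      using c \<Delta> unfolding w_def
      by (intro DERIV_chain2[OF DERIV_arctan] DERIV_cdivide) (auto intro!: derivative_eq_intros)
    moreover have "inverse (1 + w\<^sup>2) * (((b \<bullet> b) * inverse ((cos t)\<^sup>2)) / \<Delta>) = \<Delta> / (norm (?v t))\<^sup>2"
    proof -
      \<comment> \<open>Completing the square; what remains is the Gram determinant
        \<open>\<Delta>\<^sup>2\<close>.\<close>
      have "(b \<bullet> b) * (norm (?v t))\<^sup>2 = (cos t)\<^sup>2 * \<Delta>\<^sup>2 + (cos t * (a \<bullet> b) + sin t * (b \<bullet> b))\<^sup>2"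
        unfolding v2 \<Delta>(2) by (simp add: power2_eq_square algebra_simps)
      also have "cos t * (a \<bullet> b) + sin t * (b \<bullet> b) = cos t * \<Delta> * w"
        using c \<Delta> by (simp add: w_def tan_def field_simps)
      also have "(cos t)\<^sup>2 * \<Delta>\<^sup>2 + (cos t * \<Delta> * w)\<^sup>2 = (cos t)\<^sup>2 * \<Delta>\<^sup>2 * (1 + w\<^sup>2)"
        by (simp add: power_mult_distrib algebra_simps)
      finally have eq: "(norm (?v t))\<^sup>2 = (cos t)\<^sup>2 * \<Delta>\<^sup>2 * (1 + w\<^sup>2) / (b \<bullet> b)"
        using bb by (simp add: field_simps)
      have "1 + w\<^sup>2 > 0" by (simp add: add_pos_nonneg)
      moreover have "inverse q * ((B * inverse (k\<^sup>2)) / \<Delta>) = \<Delta> / (k\<^sup>2 * \<Delta>\<^sup>2 * q / B)" if "q > 0" "k > 0" "B > 0" for q k B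
        using that \<Delta>(1) by (simp add: field_simps power2_eq_square)
      ultimately show ?thesis unfolding eq using c bb by blast
    qed
    ultimately have "((\<lambda>t. arctan ((a \<bullet> b + (b \<bullet> b) * tan t) / \<Delta>)) has_vector_derivative \<Delta> / (norm (?v t))\<^sup>2) (at t)"
      by (simp add: has_real_derivative_iff_has_vector_derivative)
    then show ?thesis
      by (rule has_vector_derivative_transform_within_open[OF _ open_greaterThanLessThan t]) (use in_F in auto)
  qed
  have "continuous_on {-(pi/2)..pi/2} F"
    unfolding continuous_on_eq_continuous_within
  proof
    fix t assume t: "t \<in> {-(pi/2)..pi/2}"
    consider "t = -(pi/2)" | "t = pi/2" | "t \<in> {-(pi/2)<..<pi/2}" using t by force
    then show "continuous (at t within {-(pi/2)..pi/2}) F"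
    proof cases
      case 1
      have "filterlim (\<lambda>t. (b \<bullet> b) * tan t) at_bot (at_right (-(pi/2)))"
        by (rule filterlim_tendsto_pos_mult_at_bot[OF tendsto_const bb filterlim_tan_at_right])
      then have "filterlim (\<lambda>t. a \<bullet> b + (b \<bullet> b) * tan t) at_bot (at_right (-(pi/2)))"
        unfolding filterlim_uminus_at_bot minus_add_distrib
        by (intro filterlim_tendsto_add_at_top[OF tendsto_const])
      then have "filterlim (\<lambda>t. inverse \<Delta> * (a \<bullet> b + (b \<bullet> b) * tan t)) at_bot (at_right (-(pi/2)))"
        by (rule filterlim_tendsto_pos_mult_at_bot[OF tendsto_const, rotated]) (use \<Delta>(1) in simp)
      then have "((\<lambda>t. arctan (inverse \<Delta> * (a \<bullet> b + (b \<bullet> b) * tan t))) \<longlongrightarrow> -(pi/2)) (at_right (-(pi/2)))"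
        by (rule filterlim_compose[OF tendsto_arctan_at_bot])
      moreover have "\<forall>\<^sub>F t in at_right (-(pi/2)). arctan (inverse \<Delta> * (a \<bullet> b + (b \<bullet> b) * tan t)) = F t"
        by (rule eventually_mono[OF eventually_at_right_real[OF mpi] in_F'[symmetric]])
      ultimately have "(F \<longlongrightarrow> -(pi/2)) (at_right (-(pi/2)))" by (rule Lim_transform_eventually)
      then show ?thesis
        unfolding continuous_within 1 using at_within_Icc_at_right[of "-(pi/2)" "pi/2"] by (simp add: F_ends)
    next
      case 2
      have "filterlim (\<lambda>t. (b \<bullet> b) * tan t) at_top (at_left (pi/2))"
        by (rule filterlim_tendsto_pos_mult_at_top[OF tendsto_const bb filterlim_tan_at_left])
      then have "filterlim (\<lambda>t. a \<bullet> b + (b \<bullet> b) * tan t) at_top (at_left (pi/2))"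
        using filterlim_tendsto_add_at_top[OF tendsto_const] by blast
      then have "filterlim (\<lambda>t. inverse \<Delta> * (a \<bullet> b + (b \<bullet> b) * tan t)) at_top (at_left (pi/2))"
        by (rule filterlim_tendsto_pos_mult_at_top[OF tendsto_const, rotated]) (use \<Delta>(1) in simp)
      then have "((\<lambda>t. arctan (inverse \<Delta> * (a \<bullet> b + (b \<bullet> b) * tan t))) \<longlongrightarrow> pi/2) (at_left (pi/2))"
        by (rule filterlim_compose[OF tendsto_arctan_at_top])
      moreover have "\<forall>\<^sub>F t in at_left (pi/2). arctan (inverse \<Delta> * (a \<bullet> b + (b \<bullet> b) * tan t)) = F t"
        by (rule eventually_mono[OF eventually_at_left_real[OF mpi] in_F'[symmetric]])
      ultimately have "(F \<longlongrightarrow> pi/2) (at_left (pi/2))" by (rule Lim_transform_eventually)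
      then show ?thesis
        unfolding continuous_within 2 using at_within_Icc_at_left[of "-(pi/2)" "pi/2"] by (simp add: F_ends)
    next
      case 3
      then show ?thesis using deriv has_vector_derivative_continuous continuous_at_imp_continuous_at_within by blast
    qed
  qed
  then have "((\<lambda>t. \<Delta> / (norm (?v t))\<^sup>2) has_integral F (pi/2) - F (-(pi/2))) {-(pi/2)..pi/2}"
    using deriv by (intro fundamental_theorem_of_calculus_interior) auto
  then show ?thesis by (simp add: F_ends \<Delta>_def)
qed

text \<open>The integrand is the angular speed of the ellipse
  \<open>cos t *\<^sub>R a + sin t *\<^sub>R b\<close> in its plane, and the integral is the total
  turning. A shift by \<open>pi/2\<close> exchanges the pair \<open>a\<close>, \<open>b\<close> for
  \<open>b\<close>, \<open>- a\<close>, and the integrand has period \<open>pi\<close>.\<close>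

lemma winding_integral:
  fixes a b :: "real^3"
  assumes ab: "a \<times> b \<noteq> 0"
  shows "integral {0..2 * pi} (\<lambda>t. norm (a \<times> b) / (norm (cos t *\<^sub>R a + sin t *\<^sub>R b))\<^sup>2) = 2 * pi"
proof -
  let ?f = "\<lambda>a b t. norm (a \<times> b) / (norm (cos t *\<^sub>R a + sin t *\<^sub>R b))\<^sup>2"
  have f1: "((\<lambda>t. ?f a b (t - pi/2)) has_integral pi) {0..pi}" if "a \<times> b \<noteq> 0" for a b :: "real^3"
    using has_integral_affinity[where m=1 and c="-(pi/2)", OF half_winding_integral[OF that, folded box_real(2)]]
    by (simp add: image_affinity_atLeastAtMost_diff add.commute)
  have ba: "b \<times> (- a) \<noteq> 0" "(- a) \<times> (- b) \<noteq> 0" using ab cross_skew[of a b] by auto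
  have rot: "?f b (- a) (t - pi/2) = ?f a b t" for t
  proof -
    have "cos (t - pi/2) *\<^sub>R b + sin (t - pi/2) *\<^sub>R (- a) = cos t *\<^sub>R a + sin t *\<^sub>R b"
      by (simp add: cos_diff sin_diff)
    moreover have "norm (b \<times> (- a)) = norm (a \<times> b)" by (simp add: cross_skew[of b a])
    ultimately show ?thesis by simp
  qed
  have h1: "(?f a b has_integral pi) {0..pi}" using f1[OF ba(1)] unfolding rot .
  have per: "?f a b (t - pi) = ?f a b t" for t
  proof -
    have "cos (t - pi) *\<^sub>R a + sin (t - pi) *\<^sub>R b = - (cos t *\<^sub>R a + sin t *\<^sub>R b)" by (simp add: cos_diff sin_diff)
    then show ?thesis by (simp only: norm_minus_cancel)
  qed
  have "((\<lambda>t. ?f a b (t - pi)) has_integral pi) {pi..2 * pi}"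
    using has_integral_affinity[where m=1 and c="-pi", OF h1[folded box_real(2)]]
    by (simp add: image_affinity_atLeastAtMost_diff add.commute)
  then have h2: "(?f a b has_integral pi) {pi..2 * pi}" unfolding per .
  have "(?f a b has_integral (pi + pi)) {0..2 * pi}"
    by (rule has_integral_combine[OF _ _ h1 h2]) auto
  then show ?thesis by (simp add: integral_unique)
qed

section \<open>The Gauss-Bonnet and Minkowski forms in spherical coordinates\<close>

lemma partials_inner_const:
  assumes FG: "smooth F" "smooth G" and c: "\<And>z. F z \<bullet> G z = c"
  shows "d1 F z \<bullet> G z + F z \<bullet> d1 G z = 0" "d2 F z \<bullet> G z + F z \<bullet> d2 G z = 0"
proof -
  have "(\<lambda>z. F z \<bullet> G z) = (\<lambda>z. c)" using c by (simp add: fun_eq_iff)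
  then show "d1 F z \<bullet> G z + F z \<bullet> d1 G z = 0" "d2 F z \<bullet> G z + F z \<bullet> d2 G z = 0"
    using partials_inner[OF FG, of z] partials_const[of c z] by simp_all
qed

lemma cross3_of_tangents:
  assumes v: "norm v = 1" and ab: "a \<bullet> v = 0" "b \<bullet> v = 0"
  shows "a \<times> b = (v \<bullet> (a \<times> b)) *\<^sub>R v"
proof -
  have "v \<times> (a \<times> b) = 0" using ab by (simp add: Lagrange inner_commute)
  moreover have "v \<times> (v \<times> (a \<times> b)) = (v \<bullet> (a \<times> b)) *\<^sub>R v - (v \<bullet> v) *\<^sub>R (a \<times> b)" by (rule Lagrange)
  ultimately show ?thesis using v by (simp add: norm_eq_1)
qed

text \<open>Here \<open>p1\<close>, \<open>p2\<close> stand for the partial derivatives of the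
  position and \<open>n1\<close>, \<open>n2\<close> for those of the normal. The sum of
  \<open>v \<bullet> (n1 \<times> p2)\<close> and \<open>v \<bullet> (p1 \<times> n2)\<close> is
  twice the mean curvature times the area density; it occurs with factor \<open>u\<close> from the
  first form and with factor \<open>- u\<close> from the second.\<close>

lemma minkowski_algebra:
  fixes x v p1 p2 n1 n2 :: "real^3"
  assumes v: "norm v = 1" and p: "p1 \<bullet> v = 0" "p2 \<bullet> v = 0" and n: "n1 \<bullet> v = 0" "n2 \<bullet> v = 0"
  defines "u \<equiv> x \<bullet> v"
  shows "p1 \<bullet> (v \<times> p2) - p2 \<bullet> (v \<times> p1) + (x \<bullet> (n1 \<times> p2) - x \<bullet> (n2 \<times> p1))
     + ((x \<bullet> n1) * (x \<bullet> (v \<times> n2)) - (x \<bullet> n2) * (x \<bullet> (v \<times> n1)))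
     + u * (p1 \<bullet> (v \<times> n2) - p2 \<bullet> (v \<times> n1) + (x \<bullet> (n1 \<times> n2) - x \<bullet> (n2 \<times> n1)))
   = - 2 * (v \<bullet> (p1 \<times> p2)) + (2 * u\<^sup>2 - (norm (x - u *\<^sub>R v))\<^sup>2) * (v \<bullet> (n1 \<times> n2))"
proof -
  have vv: "v \<bullet> v = 1" using v by (simp add: norm_eq_1)
  have trip: "a \<bullet> (v \<times> b) = - (v \<bullet> (a \<times> b))" for a b :: "real^3"
    by (simp add: cross3_simps)
  have tang: "x \<bullet> (a \<times> b) = u * (v \<bullet> (a \<times> b))" if "a \<bullet> v = 0" "b \<bullet> v = 0" for a b
    by (subst cross3_of_tangents[OF v that]) (simp add: u_def)
  have skew: "v \<bullet> (a \<times> b) = - (v \<bullet> (b \<times> a))" for a b :: "real^3"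
    by (subst cross_skew) simp
  have u2: "(norm (x - u *\<^sub>R v))\<^sup>2 = x \<bullet> x - u\<^sup>2"
    unfolding power2_norm_eq_inner u_def
    by (simp add: inner_diff_left inner_diff_right vv inner_commute[of v x] power2_eq_square algebra_simps)
  \<comment> \<open>Since \<open>n2 \<times> n1\<close> is a multiple of \<open>v\<close>, this
    double cross product is a multiple of the tangential part of \<open>x\<close>, and pairing it
    with \<open>x\<close> gives the squared length of that part.\<close>
  have "(x \<bullet> n1) *\<^sub>R (v \<times> n2) - (x \<bullet> n2) *\<^sub>R (v \<times> n1) = v \<times> (x \<times> (n2 \<times> n1))"
    by (simp add: Lagrange[of x n2 n1] Cross3.right_diff_distrib cross_mult_right)
  also have "n2 \<times> n1 = - (v \<bullet> (n1 \<times> n2)) *\<^sub>R v"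
    using cross3_of_tangents[OF v n(2,1)] skew[of n1 n2] by simp
  also have "v \<times> (x \<times> (- (v \<bullet> (n1 \<times> n2)) *\<^sub>R v)) = - (v \<bullet> (n1 \<times> n2)) *\<^sub>R (x - u *\<^sub>R v)"
    by (simp add: cross_mult_right Lagrange vv u_def inner_commute[of v x])
  finally have "x \<bullet> ((x \<bullet> n1) *\<^sub>R (v \<times> n2) - (x \<bullet> n2) *\<^sub>R (v \<times> n1)) = x \<bullet> (- (v \<bullet> (n1 \<times> n2)) *\<^sub>R (x - u *\<^sub>R v))"
    by (rule arg_cong)
  then have q: "(x \<bullet> n1) * (x \<bullet> (v \<times> n2)) - (x \<bullet> n2) * (x \<bullet> (v \<times> n1)) = - (norm (x - u *\<^sub>R v))\<^sup>2 * (v \<bullet> (n1 \<times> n2))"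
    unfolding u2 by (simp add: inner_diff_right u_def power2_eq_square algebra_simps)
  show ?thesis
    unfolding q
    by (simp add: trip tang p n skew[of p2 p1] skew[of n2 n1] skew[of n2 p1] skew[of p2 n1] power2_eq_square algebra_simps)
qed

text \<open>The product rule yields the terms of \<open>minkowski_algebra\<close> and, besides,
  second derivatives that cancel because mixed partials commute.\<close>

lemma minkowski_identity:
  fixes X V :: "real \<times> real \<Rightarrow> real^3"
  assumes X: "smooth X" and V: "smooth V" and n: "\<And>z. norm (V z) = 1"
    and t: "\<And>z. d1 X z \<bullet> V z = 0" "\<And>z. d2 X z \<bullet> V z = 0"
  shows "d1 (\<lambda>z. X z \<bullet> (V z \<times> d2 X z) + (X z \<bullet> V z) * (X z \<bullet> (V z \<times> d2 V z))) z
      - d2 (\<lambda>z. X z \<bullet> (V z \<times> d1 X z) + (X z \<bullet> V z) * (X z \<bullet> (V z \<times> d1 V z))) z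
    = - 2 * (V z \<bullet> (d1 X z \<times> d2 X z))
      + (2 * (X z \<bullet> V z)\<^sup>2 - (norm (X z - (X z \<bullet> V z) *\<^sub>R V z))\<^sup>2) * (V z \<bullet> (d1 V z \<times> d2 V z))"
proof -
  note sm = X V smooth_d1[OF X] smooth_d2[OF X] smooth_d1[OF V] smooth_d2[OF V]
    smooth_add smooth_mult smooth_inner smooth_cross3
  have nV: "d1 V z \<bullet> V z = 0" "d2 V z \<bullet> V z = 0"
    using partials_inner_const[OF V V, of 1 z] n by (simp_all add: norm_eq_1 inner_commute)
  have c: "d2 (d1 X) z = d1 (d2 X) z" "d2 (d1 V) z = d1 (d2 V) z"
    using partials_commute X V by blast+
  show ?thesis
    unfolding minkowski_algebra[OF n t nV, symmetric]
    by (simp add: partials_add partials_mult partials_inner partials_cross3 sm c t inner_add_right algebra_simps)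
qed

text \<open>The Gauss equation in a moving frame. The connection form is the derivative of
  \<open>E\<close> paired with the second frame vector \<open>T\<close>; in its exterior derivative
  only the components along \<open>V\<close> of the derivatives of \<open>E\<close> and
  \<open>T\<close> survive, by orthonormality, and these are entries of the second fundamental
  form.\<close>

lemma frame_identity:
  fixes E V :: "real \<times> real \<Rightarrow> real^3"
  assumes E: "smooth E" and V: "smooth V" and n: "\<And>z. norm (V z) = 1" "\<And>z. norm (E z) = 1"
    and o: "\<And>z. E z \<bullet> V z = 0"
  shows "d1 (\<lambda>z. d2 E z \<bullet> (V z \<times> E z)) z - d2 (\<lambda>z. d1 E z \<bullet> (V z \<times> E z)) z
    = - (V z \<bullet> (d1 V z \<times> d2 V z))"
proof -
  define T where "T z = V z \<times> E z" for z
  have T: "smooth T" unfolding T_def[abs_def] by (intro smooth_cross3 V E)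
  have EE: "E z \<bullet> E z = 1" and VV: "V z \<bullet> V z = 1" for z using n by (simp_all add: norm_eq_1)
  have ET: "E z \<times> T z = V z" for z
    unfolding T_def Lagrange by (simp add: EE o)
  have nT: "norm (T z) = 1" for z
    by (simp add: norm_eq_1 T_def dot_cross EE VV o inner_commute[of "V z" "E z"])
  have eT: "E z \<bullet> T z = 0" and VT: "V z \<bullet> T z = 0" for z by (simp_all add: T_def dot_cross_self)
  have TT: "T z \<bullet> T z = 1" for z using nT by (simp add: norm_eq_1)
  have ex: "w = (w \<bullet> E z) *\<^sub>R E z + (w \<bullet> T z) *\<^sub>R T z + (w \<bullet> V z) *\<^sub>R V z" for w
    using orthonormal_pair_expansion(1)[OF n(2) nT eT, of w z] by (simp add: ET)
  have dE: "d1 E z \<bullet> E z = 0" "d2 E z \<bullet> E z = 0"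
    using partials_inner_const[OF E E EE, of z] by (simp_all add: inner_commute)
  have dT: "T z \<bullet> d1 T z = 0" "T z \<bullet> d2 T z = 0"
    using partials_inner_const[OF T T TT, of z] by (simp_all add: inner_commute)
  have EV: "d1 E z \<bullet> V z = - (E z \<bullet> d1 V z)" "d2 E z \<bullet> V z = - (E z \<bullet> d2 V z)"
    using partials_inner_const[OF E V o, of z] by simp_all
  have VTd: "V z \<bullet> d1 T z = - (T z \<bullet> d1 V z)" "V z \<bullet> d2 T z = - (T z \<bullet> d2 V z)"
    using partials_inner_const[OF V T VT, of z] by (simp_all add: inner_commute)
  have dd: "d2 (d1 E) z = d1 (d2 E) z" using partials_commute E by blast
  have 1: "d2 E z \<bullet> d1 T z = (E z \<bullet> d2 V z) * (T z \<bullet> d1 V z)"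
    by (subst ex[of "d2 E z"]) (simp add: inner_add_left inner_diff_left dE dT EV VTd)
  have 2: "d1 E z \<bullet> d2 T z = (E z \<bullet> d1 V z) * (T z \<bullet> d2 V z)"
    by (subst ex[of "d1 E z"]) (simp add: inner_add_left inner_diff_left dE dT EV VTd)
  have "d1 (\<lambda>z. d2 E z \<bullet> T z) z - d2 (\<lambda>z. d1 E z \<bullet> T z) z = d2 E z \<bullet> d1 T z - d1 E z \<bullet> d2 T z"
    using smooth_d1[OF E] smooth_d2[OF E] T by (simp add: partials_inner dd)
  also have "\<dots> = - ((E z \<times> T z) \<bullet> (d1 V z \<times> d2 V z))"
    by (simp add: 1 2 dot_cross)
  finally show ?thesis unfolding ET unfolding T_def .
qed

text \<open>The first coordinate is the polar angle from the third axis, the second the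
  longitude.\<close>

definition spherical :: "real \<times> real \<Rightarrow> real^3" where
  "spherical z = (sin (fst z) * cos (snd z)) *\<^sub>R axis 1 1 + (sin (fst z) * sin (snd z)) *\<^sub>R axis 2 1 + cos (fst z) *\<^sub>R axis 3 1"

definition merid :: "real \<times> real \<Rightarrow> real^3" where
  "merid z = (cos (fst z) * cos (snd z)) *\<^sub>R axis 1 1 + (cos (fst z) * sin (snd z)) *\<^sub>R axis 2 1 + (- sin (fst z)) *\<^sub>R axis 3 1"

text \<open>The longitude derivative of \<open>spherical\<close> divided by the sine of the polar
  angle; it remains a unit vector at the poles.\<close>

definition paral :: "real \<times> real \<Rightarrow> real^3" where
  "paral z = (- sin (snd z)) *\<^sub>R axis 1 1 + cos (snd z) *\<^sub>R axis 2 1"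

lemma spherical_components:
  "spherical z $ 1 = sin (fst z) * cos (snd z)" "spherical z $ 2 = sin (fst z) * sin (snd z)" "spherical z $ 3 = cos (fst z)"
  "merid z $ 1 = cos (fst z) * cos (snd z)" "merid z $ 2 = cos (fst z) * sin (snd z)" "merid z $ 3 = - sin (fst z)"
  "paral z $ 1 = - sin (snd z)" "paral z $ 2 = cos (snd z)" "paral z $ 3 = 0"
  by (simp_all add: spherical_def merid_def paral_def axis_def)

lemma spherical_frame:
  "norm (spherical z) = 1" "norm (merid z) = 1" "merid z \<bullet> spherical z = 0" "paral z \<bullet> spherical z = 0"
  "merid z \<times> paral z = spherical z"
proof -
  obtain a b where z: "z = (a, b)" by (cases z)
  have A: "(sin a)\<^sup>2 = 1 - (cos a)\<^sup>2" "(sin b)\<^sup>2 = 1 - (cos b)\<^sup>2" by (simp_all add: sin_squared_eq)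
  have "(sin a * cos b)\<^sup>2 + (sin a * sin b)\<^sup>2 + (cos a)\<^sup>2 = 1" "(cos a * cos b)\<^sup>2 + (cos a * sin b)\<^sup>2 + (sin a)\<^sup>2 = 1"
    unfolding power_mult_distrib A by (simp_all add: algebra_simps)
  then show "norm (spherical z) = 1" "norm (merid z) = 1"
    by (simp_all add: norm_eq_1 inner_vec_def sum_3 spherical_components z power2_eq_square)
  have "ca * cb * (sa * cb) + ca * sb * (sa * sb) - sa * ca = ca * sa * (cb\<^sup>2 + sb\<^sup>2 - 1)" for ca sa cb sb :: real
    by (simp add: power2_eq_square algebra_simps)
  from this[of "cos a" "cos b" "sin a" "sin b"]
  have "cos a * cos b * (sin a * cos b) + cos a * sin b * (sin a * sin b) - sin a * cos a
     = cos a * sin a * ((cos b)\<^sup>2 + (sin b)\<^sup>2 - 1)" .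
  also have "\<dots> = 0" by simp
  finally show "merid z \<bullet> spherical z = 0"
    by (simp add: inner_vec_def sum_3 spherical_components z algebra_simps)
  show "paral z \<bullet> spherical z = 0"
    by (simp add: inner_vec_def sum_3 spherical_components z)
  have "ca * cb * cb - - sb * (ca * sb) = ca * (cb\<^sup>2 + sb\<^sup>2)" for ca cb sb :: real
    by (simp add: power2_eq_square algebra_simps)
  from this[of "cos a" "cos b" "sin b"]
  have "cos a * cos b * cos b - - sin b * (cos a * sin b) = cos a * ((cos b)\<^sup>2 + (sin b)\<^sup>2)" .
  also have "\<dots> = cos a" by simp
  finally show "merid z \<times> paral z = spherical z"
    by (simp add: vec_eq_iff forall_3 cross_components spherical_components z)
qed

lemma smooth_sin_cos_coords:
  "smooth (\<lambda>z. sin (fst z))" "smooth (\<lambda>z. cos (fst z))" "smooth (\<lambda>z. sin (snd z))" "smooth (\<lambda>z. cos (snd z))"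
proof -
  have l: "Ck_on k (fst :: real \<times> real \<Rightarrow> real) UNIV" "Ck_on k (snd :: real \<times> real \<Rightarrow> real) UNIV" for k
    by (rule Ck_on_bounded_linear; rule bounded_linear_fst bounded_linear_snd)+
  show "smooth (\<lambda>z. sin (fst z))" "smooth (\<lambda>z. cos (fst z))" "smooth (\<lambda>z. sin (snd z))" "smooth (\<lambda>z. cos (snd z))"
    unfolding smooth_def
    by (intro allI Ck_on_compose[OF open_UNIV open_UNIV l(1)] Ck_on_compose[OF open_UNIV open_UNIV l(2)];
        simp add: Ck_on_sin_cos)+
qed

lemma smooth_const: "smooth (\<lambda>z. c)" by (simp add: smooth_def Ck_on_const)

lemma smooth_spherical: "smooth spherical"
  unfolding spherical_def[abs_def]
  by (intro smooth_add smooth_scaleR smooth_mult smooth_sin_cos_coords smooth_const)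

lemma spherical_has_derivative:
  "(spherical has_derivative (\<lambda>h. fst h *\<^sub>R merid z + snd h *\<^sub>R (sin (fst z) *\<^sub>R paral z))) (at z)"
  unfolding spherical_def merid_def paral_def
  by (auto intro!: derivative_eq_intros simp: fun_eq_iff algebra_simps)

lemma spherical_surj:
  assumes y: "norm y = 1"
  obtains z where "z \<in> cbox (0, 0) (pi, 2 * pi)" "spherical z = y"
proof -
  have sq: "(y$1)\<^sup>2 + (y$2)\<^sup>2 + (y$3)\<^sup>2 = 1"
    using y by (simp add: norm_eq_1 inner_vec_def sum_3 power2_eq_square)
  have "(y$3)\<^sup>2 \<le> 1" using sq zero_le_power2[of "y$1"] zero_le_power2[of "y$2"] by linarith
  then have y3: "\<bar>y$3\<bar> \<le> 1" by (simp add: abs_square_le_1)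
  define \<theta> where "\<theta> = arccos (y$3)"
  have th: "0 \<le> \<theta>" "\<theta> \<le> pi" "cos \<theta> = y$3" using y3 by (auto simp: \<theta>_def arccos_lbound arccos_ubound cos_arccos_abs)
  have s2: "(y$1)\<^sup>2 + (y$2)\<^sup>2 = (sin \<theta>)\<^sup>2" using sq by (simp add: sin_squared_eq th)
  have "\<exists>\<phi>. 0 \<le> \<phi> \<and> \<phi> \<le> 2 * pi \<and> y$1 = sin \<theta> * cos \<phi> \<and> y$2 = sin \<theta> * sin \<phi>"
  proof (cases "sin \<theta> = 0")
    case True
    then have "y$1 = 0 \<and> y$2 = 0" using s2 by (simp add: sum_power2_eq_zero_iff)
    then show ?thesis using True by (intro exI[of _ 0]) simp
  next
    case False
    then have "(y$1 / sin \<theta>)\<^sup>2 + (y$2 / sin \<theta>)\<^sup>2 = 1"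
      using s2 by (simp add: power_divide flip: add_divide_distrib)
    then obtain \<phi> where "0 \<le> \<phi>" "\<phi> < 2 * pi" "y$1 / sin \<theta> = cos \<phi>" "y$2 / sin \<theta> = sin \<phi>"
      by (rule sincos_total_2pi)
    then show ?thesis using False by (intro exI[of _ \<phi>]) (auto simp: field_simps)
  qed
  then obtain \<phi> where \<phi>: "0 \<le> \<phi>" "\<phi> \<le> 2 * pi" "y$1 = sin \<theta> * cos \<phi>" "y$2 = sin \<theta> * sin \<phi>" by blast
  show thesis
  proof (rule that[of "(\<theta>, \<phi>)"])
    show "(\<theta>, \<phi>) \<in> cbox (0, 0) (pi, 2 * pi)" using th \<phi> by (simp add: cbox_Pair_eq)
    show "spherical (\<theta>, \<phi>) = y" using th \<phi> by (simp add: vec_eq_iff forall_3 spherical_components)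
  qed
qed

lemma inj_on_spherical: "inj_on spherical (box (0, 0) (pi, 2 * pi))"
proof (rule inj_onI)
  fix z w assume zw: "z \<in> box (0, 0) (pi, 2 * pi)" "w \<in> box (0, 0) (pi, 2 * pi)" and eq: "spherical z = spherical w"
  obtain a b a' b' where z: "z = (a, b)" "w = (a', b')" by (cases z, cases w)
  have bd: "0 < a" "a < pi" "0 < b" "b < 2 * pi" "0 < a'" "a' < pi" "0 < b'" "b' < 2 * pi"
    using zw unfolding z by (auto simp: mem_box Basis_prod_def)
  have e: "sin a * cos b = sin a' * cos b'" "sin a * sin b = sin a' * sin b'" "cos a = cos a'"
    using arg_cong[OF eq, of "\<lambda>v. v$1"] arg_cong[OF eq, of "\<lambda>v. v$2"] arg_cong[OF eq, of "\<lambda>v. v$3"]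
    by (simp_all add: spherical_components z)
  have a: "a = a'" using e(3) bd cos_inj_pi by simp
  have "sin a > 0" using bd by (simp add: sin_gt_zero)
  then have "sin b = sin b'" "cos b = cos b'" using e a by auto
  then obtain m where m: "b = b' + 2 * pi * of_int m" using sin_cos_eq_iff[of b b'] by auto
  have "\<bar>2 * pi * of_int m\<bar> < 2 * pi * 1" using m bd by linarith
  then have "\<bar>real_of_int m\<bar> < 1" by (simp add: abs_mult)
  then have "m = 0" by linarith
  then show "z = w" using m a z by simp
qed

lemma spherical_nonzero: "spherical z \<noteq> 0"
  using spherical_frame(1)[of z] by (metis norm_zero zero_neq_one)

section \<open>The surface in spherical coordinates\<close>

context smooth_sphere
begin

definition X :: "real \<times> real \<Rightarrow> real^3" where "X z = \<Phi> (spherical z)"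
definition V :: "real \<times> real \<Rightarrow> real^3" where "V z = n (spherical z)"

abbreviation Q :: "(real \<times> real) set" where "Q \<equiv> cbox (0, 0) (pi, 2 * pi)"
abbreviation R :: "(real \<times> real) set" where "R \<equiv> box (0, 0) (pi, 2 * pi)"

lemma X_eq_f: "X z = f (spherical z)"
  by (simp add: X_def \<Phi>_sphere spherical_frame)

lemma smooth_X: "smooth X" and smooth_V: "smooth V"
  using smooth_spherical spherical_nonzero unfolding smooth_def X_def[abs_def] V_def[abs_def]
  by (auto intro!: Ck_on_compose[OF open_UNIV open_punctured _ Ck_on_\<Phi>] Ck_on_compose[OF open_UNIV open_punctured _ Ck_on_n])

lemma partials_X: "d1 X z = D (spherical z) (merid z)" "d2 X z = sin (fst z) *\<^sub>R D (spherical z) (paral z)"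
  and partials_V: "d1 V z = dn (spherical z) (merid z)" "d2 V z = sin (fst z) *\<^sub>R dn (spherical z) (paral z)"
proof -
  note l = linear_D[OF spherical_nonzero, of z] linear_dn[OF spherical_nonzero, of z]
  have "(X has_derivative (\<lambda>h. D (spherical z) (fst h *\<^sub>R merid z + snd h *\<^sub>R (sin (fst z) *\<^sub>R paral z)))) (at z)"
    using diff_chain_at[OF spherical_has_derivative \<Phi>_has_derivative[OF spherical_nonzero], of z]
    by (simp add: o_def X_def[abs_def])
  then have "(X has_derivative (\<lambda>h. fst h *\<^sub>R D (spherical z) (merid z) + snd h *\<^sub>R (sin (fst z) *\<^sub>R D (spherical z) (paral z)))) (at z)"
    by (simp only: linear_add[OF l(1)] linear_scale[OF l(1)])
  from partials_unique[OF this] show "d1 X z = D (spherical z) (merid z)" "d2 X z = sin (fst z) *\<^sub>R D (spherical z) (paral z)" .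
  have "(V has_derivative (\<lambda>h. dn (spherical z) (fst h *\<^sub>R merid z + snd h *\<^sub>R (sin (fst z) *\<^sub>R paral z)))) (at z)"
    using diff_chain_at[OF spherical_has_derivative n_has_derivative[OF spherical_nonzero], of z]
    by (simp add: o_def V_def[abs_def])
  then have "(V has_derivative (\<lambda>h. fst h *\<^sub>R dn (spherical z) (merid z) + snd h *\<^sub>R (sin (fst z) *\<^sub>R dn (spherical z) (paral z)))) (at z)"
    by (simp only: linear_add[OF l(2)] linear_scale[OF l(2)])
  from partials_unique[OF this] show "d1 V z = dn (spherical z) (merid z)" "d2 V z = sin (fst z) *\<^sub>R dn (spherical z) (paral z)" .
qed

lemma norm_V: "norm (V z) = 1"
  unfolding V_def by (rule norm_n[OF spherical_nonzero])

lemma partials_X_tangent: "d1 X z \<bullet> V z = 0" "d2 X z \<bullet> V z = 0"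
  using n_dot_D[OF spherical_nonzero] by (simp_all add: partials_X V_def inner_commute)

lemma area_element: "d1 X z \<times> d2 X z = (sin (fst z) * norm (N (spherical z))) *\<^sub>R V z"
proof -
  have "D (spherical z) (merid z) \<times> D (spherical z) (paral z) = N (spherical z)"
    using D_cross[OF spherical_frame(1,3,4), of z] spherical_frame(1)[of z]
    by (simp add: spherical_frame(5) norm_eq_1)
  then show ?thesis
    using N_nonzero[OF spherical_nonzero, of z] by (simp add: partials_X cross_mult_right V_def n_def)
qed

lemma curvature_element: "d1 V z \<times> d2 V z = gauss_curvature S (X z) *\<^sub>R (d1 X z \<times> d2 X z)"
  using gauss_curvature_cross[OF spherical_frame(1), of z]
  by (simp add: partials_X partials_V cross_mult_right X_eq_f)

lemma periodic: "X (x, 2 * pi) = X (x, 0)" "V (x, 2 * pi) = V (x, 0)"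
  "d1 X (x, 2 * pi) = d1 X (x, 0)" "d1 V (x, 2 * pi) = d1 V (x, 0)"
  by (simp_all add: partials_X partials_V, simp_all add: X_def V_def spherical_def merid_def)

lemma smooths: "smooth (d1 X)" "smooth (d2 X)" "smooth (d1 V)" "smooth (d2 V)"
  using smooth_X smooth_V smooth_d1 smooth_d2 by blast+

theorem minkowski_integral:
  "integral Q (\<lambda>z. - 2 * (V z \<bullet> (d1 X z \<times> d2 X z))
      + (2 * (X z \<bullet> V z)\<^sup>2 - (norm (X z - (X z \<bullet> V z) *\<^sub>R V z))\<^sup>2) * (V z \<bullet> (d1 V z \<times> d2 V z))) = 0"
proof -
  let ?A = "\<lambda>z. X z \<bullet> (V z \<times> d2 X z) + (X z \<bullet> V z) * (X z \<bullet> (V z \<times> d2 V z))"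
  let ?B = "\<lambda>z. X z \<bullet> (V z \<times> d1 X z) + (X z \<bullet> V z) * (X z \<bullet> (V z \<times> d1 V z))"
  have A: "smooth ?A" and B: "smooth ?B"
    by (intro smooth_add smooth_mult smooth_inner smooth_cross3 smooth_X smooth_V smooths)+
  have "integral Q (\<lambda>z. d1 ?A z - d2 ?B z) =
    integral {0..2 * pi} (\<lambda>y. ?A (pi, y) - ?A (0, y)) - integral {0..pi} (\<lambda>x. ?B (x, 2 * pi) - ?B (x, 0))"
    by (rule green_rectangle[OF A B]) auto
  \<comment> \<open>The edges of longitude 0 and \<open>2 * pi\<close> cancel by periodicity. On the
    edges that collapse to the poles the longitude derivatives carry the factor
    \<open>sin (fst z)\<close>, which is 0 there.\<close>
  also have "\<dots> = 0" by (simp add: periodic, simp add: partials_X partials_V)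
  finally show ?thesis
    by (simp only: minkowski_identity[OF smooth_X smooth_V norm_V partials_X_tangent])
qed

lemma d1_X_nonzero: "d1 X z \<noteq> 0"
proof
  assume "d1 X z = 0"
  then have "merid z = 0"
    using D_eq_0[OF spherical_frame(1,3), of z] by (simp add: partials_X)
  then show False using spherical_frame(2)[of z] by simp
qed

text \<open>The image of the meridian direction, normalized. In these coordinates it is smooth up to
  the polar edges, where it still varies with the longitude and so leaves boundary terms.\<close>

definition E :: "real \<times> real \<Rightarrow> real^3" where "E z = inverse (norm (d1 X z)) *\<^sub>R d1 X z"

lemma smooth_E: "smooth E"
  unfolding E_def[abs_def] by (intro smooth_scaleR smooth_inverse_norm smooths d1_X_nonzero)

lemma norm_E: "norm (E z) = 1" and E_dot_V: "E z \<bullet> V z = 0"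
  using d1_X_nonzero[of z] by (simp_all add: E_def partials_X_tangent)

text \<open>At a pole the meridian directions sweep out the tangent plane, so \<open>E\<close> runs
  along a normalized ellipse and the connection form is its angular speed. The sign \<open>c\<close>
  is 1 at the north and -1 at the south pole, where the pair \<open>a\<close>, \<open>b\<close> is
  negatively oriented with respect to \<open>V\<close>.\<close>

lemma connection_form_pole:
  assumes \<theta>: "sin \<theta> = 0" "cos \<theta> = c" "c = 1 \<or> c = -1"
  defines "a \<equiv> D (c *\<^sub>R axis 3 1) (axis 1 1)" and "b \<equiv> D (c *\<^sub>R axis 3 1) (axis 2 1)"
  shows "a \<times> b \<noteq> 0"
    "d2 E (\<theta>, \<phi>) \<bullet> (V (\<theta>, \<phi>) \<times> E (\<theta>, \<phi>)) = c * (norm (a \<times> b) / (norm (cos \<phi> *\<^sub>R a + sin \<phi> *\<^sub>R b))\<^sup>2)"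
proof -
  let ?s = "c *\<^sub>R axis 3 1 :: real^3"
  let ?z = "(\<theta>, \<phi>)"
  let ?u = "\<lambda>\<phi>. cos \<phi> *\<^sub>R a + sin \<phi> *\<^sub>R b"
  have s: "spherical (\<theta>, \<phi>) = ?s" for \<phi> using \<theta> by (simp add: spherical_def)
  have s1: "norm ?s = 1" using \<theta>(3) by auto
  have s0: "?s \<noteq> 0" using s1 by (metis norm_zero zero_neq_one)
  have cc: "c * c = 1" using \<theta>(3) by auto
  have m: "merid (\<theta>, \<phi>) = c *\<^sub>R (cos \<phi> *\<^sub>R axis 1 1 + sin \<phi> *\<^sub>R axis 2 1)" for \<phi>
    using \<theta> by (simp add: merid_def scaleR_add_right)
  have Y: "d1 X (\<theta>, \<phi>) = c *\<^sub>R ?u \<phi>" for \<phi>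
    by (simp add: partials_X s m D_linear[OF s0] a_def b_def)
  have e12: "(axis 1 1 \<times> axis 2 1) \<bullet> ?s = c" "axis 1 1 \<bullet> ?s = 0" "axis 2 1 \<bullet> ?s = 0"
    by (simp_all add: cross_basis inner_axis_axis)
  have ab: "a \<times> b = c *\<^sub>R N ?s"
    unfolding a_def b_def using D_cross[OF s1 e12(2,3)] e12(1) by simp
  show "a \<times> b \<noteq> 0" using ab N_nonzero[OF s0] \<theta>(3) by auto
  have vd: "((\<lambda>\<phi>. c *\<^sub>R ?u \<phi>) has_vector_derivative c *\<^sub>R (- sin \<phi> *\<^sub>R a + cos \<phi> *\<^sub>R b)) (at \<phi>)"
    by (auto intro!: derivative_eq_intros simp: has_vector_derivative_def fun_eq_iff algebra_simps)
  have dY: "d2 (d1 X) ?z = c *\<^sub>R (- sin \<phi> *\<^sub>R a + cos \<phi> *\<^sub>R b)"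
    using vector_derivative_unique_at[OF has_vector_derivative_slices(2)[OF smooths(1), of \<theta> \<phi>]] vd by (simp add: Y)
  let ?w = "\<lambda>z. inverse (norm (d1 X z))"
  have sw: "smooth ?w" by (intro smooth_inverse_norm smooths d1_X_nonzero)
  have dE: "d2 E ?z = d2 ?w ?z *\<^sub>R d1 X ?z + ?w ?z *\<^sub>R d2 (d1 X) ?z"
    unfolding E_def[abs_def] by (rule partials_scaleR(2)[OF sw smooths(1)])
  have "d2 E ?z \<bullet> (V ?z \<times> E ?z) = V ?z \<bullet> (E ?z \<times> d2 E ?z)"
    using cross_triple[of "V ?z" "E ?z" "d2 E ?z"] by (simp add: inner_commute)
  \<comment> \<open>The derivative of the normalizing factor contributes a multiple of
    \<open>d1 X\<close> and drops out of the cross product.\<close>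
  also have "E ?z \<times> d2 E ?z = (?w ?z * ?w ?z) *\<^sub>R (d1 X ?z \<times> d2 (d1 X) ?z)"
    by (simp add: dE E_def cross_add_right cross_mult_left cross_mult_right)
  also have "d1 X ?z \<times> d2 (d1 X) ?z = (c * c) *\<^sub>R (?u \<phi> \<times> (- sin \<phi> *\<^sub>R a + cos \<phi> *\<^sub>R b))"
    unfolding dY Y by (simp add: cross_mult_left cross_mult_right)
  also have "?u \<phi> \<times> (- sin \<phi> *\<^sub>R a + cos \<phi> *\<^sub>R b) = (cos \<phi> * cos \<phi>) *\<^sub>R (a \<times> b) + (sin \<phi> * sin \<phi>) *\<^sub>R (a \<times> b)"
    unfolding cross_add_left cross_add_right cross_mult_left cross_mult_right by (simp add: cross_skew[of b a])
  also have "\<dots> = ((cos \<phi>)\<^sup>2 + (sin \<phi>)\<^sup>2) *\<^sub>R (a \<times> b)" by (simp only: power2_eq_square scaleR_add_left)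
  also have "\<dots> = a \<times> b" by simp
  also have "?w ?z * ?w ?z = 1 / (norm (?u \<phi>))\<^sup>2"
    using \<theta>(3) by (auto simp: Y power2_eq_square inverse_eq_divide)
  also have "V ?z \<bullet> ((1 / (norm (?u \<phi>))\<^sup>2) *\<^sub>R ((c * c) *\<^sub>R (a \<times> b))) = (V ?z \<bullet> (a \<times> b)) / (norm (?u \<phi>))\<^sup>2"
    by (simp add: cc)
  also have "V ?z \<bullet> (a \<times> b) = c * norm (a \<times> b)"
  proof -
    have "n ?s \<bullet> N ?s = norm (N ?s)"
      using N_nonzero[OF s0] by (simp add: n_def power2_norm_eq_inner[symmetric] power2_eq_square)
    then show ?thesis using \<theta>(3) by (auto simp: V_def s ab)
  qed
  finally show "d2 E ?z \<bullet> (V ?z \<times> E ?z) = c * (norm (a \<times> b) / (norm (?u \<phi>))\<^sup>2)" by simp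
qed

theorem gauss_bonnet_sphere: "integral Q (\<lambda>z. V z \<bullet> (d1 V z \<times> d2 V z)) = 4 * pi"
proof -
  let ?A = "\<lambda>z. d2 E z \<bullet> (V z \<times> E z)" and ?B = "\<lambda>z. d1 E z \<bullet> (V z \<times> E z)"
  have A: "smooth ?A" and B: "smooth ?B"
    by (intro smooth_inner smooth_cross3 smooth_E smooth_V smooth_d1[OF smooth_E] smooth_d2[OF smooth_E])+
  have perE: "E (x, 2 * pi) = E (x, 0)" for x by (simp add: E_def periodic)
  have perdE: "d1 E (x, 2 * pi) = d1 E (x, 0)" for x
    using vector_derivative_unique_at[OF has_vector_derivative_slices(1)[OF smooth_E, of "2 * pi" x]]
      has_vector_derivative_slices(1)[OF smooth_E, of 0 x] by (simp add: perE)
  have pole: "integral {0..2 * pi} (\<lambda>y. ?A (\<theta>, y)) = c * (2 * pi)" "(\<lambda>y. ?A (\<theta>, y)) integrable_on {0..2 * pi}"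
    if \<theta>: "sin \<theta> = 0" "cos \<theta> = c" "c = 1 \<or> c = -1" for \<theta> c
  proof -
    show "integral {0..2 * pi} (\<lambda>y. ?A (\<theta>, y)) = c * (2 * pi)"
      unfolding connection_form_pole(2)[OF \<theta>] integral_mult_right
      by (simp only: winding_integral[OF connection_form_pole(1)[OF \<theta>]])
    have "continuous_on {0..2 * pi} (\<lambda>y. ?A (\<theta>, y))"
      by (rule continuous_on_compose2[OF smooth_continuous[OF A, of UNIV], of _ "Pair \<theta>"]) (auto intro!: continuous_intros)
    then show "(\<lambda>y. ?A (\<theta>, y)) integrable_on {0..2 * pi}" by (rule integrable_continuous_interval)
  qed
  have "integral Q (\<lambda>z. d1 ?A z - d2 ?B z) =
    integral {0..2 * pi} (\<lambda>y. ?A (pi, y) - ?A (0, y)) - integral {0..pi} (\<lambda>x. ?B (x, 2 * pi) - ?B (x, 0))"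
    by (rule green_rectangle[OF A B]) auto
  also have "integral {0..pi} (\<lambda>x. ?B (x, 2 * pi) - ?B (x, 0)) = 0" by (simp add: periodic perE perdE)
  also have "integral {0..2 * pi} (\<lambda>y. ?A (pi, y) - ?A (0, y)) = integral {0..2 * pi} (\<lambda>y. ?A (pi, y)) - integral {0..2 * pi} (\<lambda>y. ?A (0, y))"
    using pole(2)[of pi "-1"] pole(2)[of 0 1] by (intro Henstock_Kurzweil_Integration.integral_diff) auto
  \<comment> \<open>The polar edges give \<open>- 2 * pi\<close> at \<open>pi\<close> and
    \<open>2 * pi\<close> at 0. The minus sign in \<open>frame_identity\<close> makes the curvature
    integral positive.\<close>
  also have "\<dots> = - 4 * pi" using pole(1)[of pi "-1"] pole(1)[of 0 1] by simp
  finally show ?thesis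
    by (simp add: frame_identity[OF smooth_E smooth_V norm_V norm_E E_dot_V])
qed

section \<open>Integration over the surface\<close>

sublocale immersion_parametrization X "d1 X" "d2 X" R
proof
  show "inj_on X R"
  proof (rule inj_onI)
    fix z w assume zw: "z \<in> R" "w \<in> R" "X z = X w"
    then have "g (f (spherical z)) = g (f (spherical w))" by (simp add: X_eq_f)
    then have "spherical z = spherical w" using gf spherical_frame(1) by simp
    then show "z = w" using inj_onD[OF inj_on_spherical] zw by blast
  qed
  show "(X has_derivative (\<lambda>h. fst h *\<^sub>R d1 X z + snd h *\<^sub>R d2 X z)) (at z)" for z
    by (rule smooth_has_derivative[OF smooth_X])
  show "continuous_on R (d1 X)" "continuous_on R (d2 X)" using smooth_continuous smooths by blast+
  show "d1 X z \<times> d2 X z \<noteq> 0" if z: "z \<in> R" for z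
  proof -
    have "0 < fst z" "fst z < pi" using z by (cases z; auto simp: mem_box Basis_prod_def)+
    then have "sin (fst z) > 0" by (rule sin_gt_zero)
    then show ?thesis
      using N_nonzero[OF spherical_nonzero, of z] norm_V[of z] by (auto simp: area_element)
  qed
qed (rule open_box)

lemma J_eq: assumes z: "z \<in> R" shows "norm (d1 X z \<times> d2 X z) = V z \<bullet> (d1 X z \<times> d2 X z)"
proof -
  have "0 < fst z" "fst z < pi" using z by (cases z; auto simp: mem_box Basis_prod_def)+
  then have "sin (fst z) > 0" by (rule sin_gt_zero)
  then show ?thesis using norm_V[of z, unfolded norm_eq_1] norm_V[of z] by (simp add: area_element)
qed

lemma X_image_Q: "X ` Q = S"
proof
  show "X ` Q \<subseteq> S" using \<Phi>_in_S[OF spherical_nonzero] by (auto simp: X_def)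
  show "S \<subseteq> X ` Q"
  proof
    fix x assume "x \<in> S"
    then obtain y where y: "norm y = 1" "x = f y" using f_image by auto
    obtain z where "z \<in> Q" "spherical z = y" by (rule spherical_surj[OF y(1)])
    then show "x \<in> X ` Q" using y by (auto simp: X_eq_f)
  qed
qed

text \<open>Guarantees that the edges of the rectangle are mapped to a null set.\<close>

lemma X_lipschitz: obtains L where "L > 0" "\<And>z w. z \<in> Q \<Longrightarrow> w \<in> Q \<Longrightarrow> dist (X z) (X w) \<le> L * dist z w"
proof -
  have "continuous_on Q (\<lambda>z. norm (d1 X z) + norm (d2 X z))"
    by (intro continuous_intros smooth_continuous smooths)
  then have "bounded ((\<lambda>z. norm (d1 X z) + norm (d2 X z)) ` Q)"
    by (intro compact_imp_bounded compact_continuous_image compact_cbox)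
  then obtain B where B: "\<And>z. z \<in> Q \<Longrightarrow> norm (d1 X z) + norm (d2 X z) \<le> B"
    unfolding bounded_iff by (force simp: abs_le_iff)
  have "norm (X z - X w) \<le> max B 1 * norm (z - w)" if "z \<in> Q" "w \<in> Q" for z w
  proof (rule differentiable_bound[OF convex_box(1) _ _ that])
    fix z assume z: "z \<in> Q"
    show "(X has_derivative (\<lambda>h. fst h *\<^sub>R d1 X z + snd h *\<^sub>R d2 X z)) (at z within Q)"
      by (rule has_derivative_at_withinI[OF smooth_has_derivative[OF smooth_X]])
    show "onorm (\<lambda>h. fst h *\<^sub>R d1 X z + snd h *\<^sub>R d2 X z) \<le> max B 1"
    proof (rule onorm_le)
      fix h :: "real \<times> real"
      have "norm (fst h *\<^sub>R d1 X z + snd h *\<^sub>R d2 X z) \<le> \<bar>fst h\<bar> * norm (d1 X z) + \<bar>snd h\<bar> * norm (d2 X z)"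
        using norm_triangle_ineq[of "fst h *\<^sub>R d1 X z" "snd h *\<^sub>R d2 X z"] by simp
      also have "\<dots> \<le> norm h * norm (d1 X z) + norm h * norm (d2 X z)"
        using norm_fst_le[of "fst h" "snd h"] norm_snd_le[of "snd h" "fst h"] by (intro add_mono mult_right_mono) auto
      also have "\<dots> = (norm (d1 X z) + norm (d2 X z)) * norm h" by (simp add: algebra_simps)
      also have "\<dots> \<le> max B 1 * norm h" using B[OF z] by (intro mult_right_mono) auto
      finally show "norm (fst h *\<^sub>R d1 X z + snd h *\<^sub>R d2 X z) \<le> max B 1 * norm h" .
    qed
  qed
  then show thesis by (intro that[of "max B 1"]) (auto simp: dist_norm)
qed

lemma X_R_almost_all: "S - X ` R \<in> null_sets hausdorff2"
proof -
  obtain L where L: "L > 0" "\<And>z w. z \<in> Q \<Longrightarrow> w \<in> Q \<Longrightarrow> dist (X z) (X w) \<le> L * dist z w"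
    by (rule X_lipschitz) (rule that)
  have QR: "Q - R \<in> sets borel" by simp
  have "Q - R \<in> null_sets lborel"
    using negligible_frontier_interval[of "(0, 0)" "(pi, 2 * pi)"] QR
    by (simp add: negligible_iff_null_sets null_sets_completion_iff)
  then have "hausdorff2_outer (Q - R) = 0" using hausdorff2_outer_eq_lborel[OF QR] by (simp add: null_setsD1)
  then have le0: "hausdorff2_outer (X ` (Q - R)) \<le> 0"
    using hausdorff2_outer_lipschitz[OF L(1), of "Q - R" X] L(2) by simp
  have sub: "S - X ` R \<subseteq> X ` (Q - R)" unfolding X_image_Q[symmetric] by blast
  have "hausdorff2_outer (S - X ` R) = 0"
    using order_trans[OF hausdorff2_outer_mono[OF sub] le0] by simp
  moreover have "S - X ` R \<in> sets borel"
    by (rule sets.Diff[OF borel_closed[OF compact_imp_closed[OF compact_S]] image_R_borel])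
  ultimately show ?thesis by (simp add: null_sets_def emeasure_hausdorff2)
qed

text \<open>The triple product with \<open>V\<close> agrees with the norm of the cross product on
  the open rectangle; it is continuous on the closed one and is the expression in which the forms
  are written.\<close>

theorem integral_over_S:
  fixes h :: "real^3 \<Rightarrow> real"
  assumes h: "continuous_on S h"
  shows "(LINT x:S|hausdorff2. h x) = integral Q (\<lambda>z. h (X z) * (V z \<bullet> (d1 X z \<times> d2 X z)))"
proof -
  have Sb: "S \<in> sets borel" using compact_S by (intro borel_closed compact_imp_closed)
  \<comment> \<open>Extension by zero turns \<open>h\<close>, which is continuous on
    \<open>S\<close> only, into a Borel function on all of space, as the area formula asks.\<close>
  define k where "k x = indicator S x *\<^sub>R h x" for x
  have k: "k \<in> borel_measurable borel"
    unfolding k_def[abs_def] by (rule borel_measurable_continuous_on_indicator[OF Sb h])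
  have XS: "X z \<in> S" for z using \<Phi>_in_S[OF spherical_nonzero] by (simp add: X_def)
  let ?q = "\<lambda>z. h (X z) * (V z \<bullet> (d1 X z \<times> d2 X z))"
  have qc: "continuous_on Q ?q"
    by (intro continuous_on_mult continuous_on_compose2[OF h] continuous_on_inner continuous_on_cross smooth_continuous
        smooth_X smooth_V smooths) (use XS in auto)
  have "(LINT x:S|hausdorff2. h x) = (LINT x:X ` R|hausdorff2. k x)"
    unfolding set_lebesgue_integral_def k_def[symmetric]
  proof (rule integral_cong_AE)
    show "k \<in> borel_measurable hausdorff2" using k by (simp add: measurable_cong_sets[OF sets_hausdorff2 refl])
    show "(\<lambda>x. indicator (X ` R) x *\<^sub>R k x) \<in> borel_measurable hausdorff2"
      using k image_R_borel by (simp add: measurable_cong_sets[OF sets_hausdorff2 refl])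
    show "AE x in hausdorff2. k x = indicator (X ` R) x *\<^sub>R k x"
      by (rule AE_I'[OF X_R_almost_all]) (auto simp: k_def indicator_def)
  qed
  also have "\<dots> = (LINT z:R|lborel. norm (d1 X z \<times> d2 X z) * k (X z))"
    by (rule integral_hausdorff2_image[OF borel_measurable_continuous_onI k]) (rule smooth_continuous[OF smooth_X])
  also have "\<dots> = (LINT z:R|lborel. ?q z)"
    using XS by (intro set_lebesgue_integral_cong) (auto simp: J_eq k_def)
  also have "\<dots> = integral R ?q"
  proof -
    have "set_integrable lborel Q ?q" unfolding set_integrable_def by (rule borel_integrable_compact[OF compact_cbox qc])
    then have "set_integrable lborel R ?q" by (rule set_integrable_subset) (auto simp: box_subset_cbox)
    then show ?thesis by (rule set_borel_integral_eq_integral(2))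
  qed
  also have "\<dots> = integral Q ?q" by (rule integral_open_interval)
  finally show ?thesis .
qed

definition weight :: "real^3 \<Rightarrow> real" where
  "weight x = 1 - (x \<bullet> outer_normal S x)\<^sup>2 + 1 / 2 * (norm (x - (x \<bullet> outer_normal S x) *\<^sub>R outer_normal S x))\<^sup>2"

lemma outer_normal_cases:
  assumes y: "norm y = 1"
  shows "outer_normal S (f y) = n y \<or> outer_normal S (f y) = - n y"
proof -
  obtain s d where s: "s = 1 \<or> s = (-1::real)" "d > 0"
    "\<And>z. norm z = 1 \<Longrightarrow> dist z y < d \<Longrightarrow> outer_normal S (f z) = s *\<^sub>R n z"
    by (rule outer_normal_local[OF y]) (rule that)
  have "outer_normal S (f y) = s *\<^sub>R n y" by (rule s(3)[OF y]) (simp add: s(2))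
  then show ?thesis using s(1) by auto
qed

lemma weight_f: "norm y = 1 \<Longrightarrow>
    weight (f y) = 1 - (f y \<bullet> n y)\<^sup>2 + 1 / 2 * (norm (f y - (f y \<bullet> n y) *\<^sub>R n y))\<^sup>2"
  using outer_normal_cases[of y] by (auto simp: weight_def)

text \<open>Written at the point \<open>g x\<close> in terms of \<open>n\<close>, \<open>dn\<close>
  and \<open>N\<close>, the integrand is continuous by composition, and no statement about the
  continuity of \<open>outer_normal\<close> is involved.\<close>

lemma continuous_on_weight_curvature: "continuous_on S (\<lambda>x. weight x * gauss_curvature S x)"
proof -
  let ?H = "\<lambda>x y. (1 - (x \<bullet> n y)\<^sup>2 + 1 / 2 * (norm (x - (x \<bullet> n y) *\<^sub>R n y))\<^sup>2) * ((cofactor3 (dn y) y \<bullet> n y) / norm (N y))"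
  have gy: "norm (g x) = 1" if "x \<in> S" for x using g_image that by auto
  have c: "continuous_on (- {0}) n" "continuous_on (- {0}) N" "continuous_on (- {0}) (\<lambda>y. cofactor3 (dn y) y)"
  proof -
    show "continuous_on (- {0}) n" "continuous_on (- {0}) N"
      using Ck_on_imp_continuous_on Ck_on_n Ck_on_N by blast+
    have "Ck_on 0 (\<lambda>y. dn y v) (- {0})" for v
      using Ck_on_n[of "Suc 0"] by (simp add: dn_def)
    then have "continuous_on (- {0}) (\<lambda>y. dn y v)" for v by simp
    then show "continuous_on (- {0}) (\<lambda>y. cofactor3 (dn y) y)"
      unfolding cofactor3_def by (intro continuous_intros continuous_on_cross)
  qed
  have sub: "g ` S \<subseteq> - {0}" using gy by force
  then have Ng: "N (g x) \<noteq> 0" if "x \<in> S" for x using N_nonzero[of "g x"] that by blast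
  note cc = c[THEN continuous_on_compose2, OF continuous_on_g sub]
  have "continuous_on S (\<lambda>x. ?H x (g x))"
    using Ng by (intro continuous_intros cc) auto
  then show ?thesis
  proof (rule continuous_on_eq)
    fix x assume x: "x \<in> S"
    show "?H x (g x) = weight x * gauss_curvature S x"
      using weight_f[OF gy[OF x]] gauss_curvature_eq[OF gy[OF x]] by (simp add: fg[OF x])
  qed
qed

theorem area_formula:
  "area S - 4 * pi = - (LINT x:S|hausdorff2. weight x * gauss_curvature S x)"
proof -
  let ?p = "\<lambda>z. V z \<bullet> (d1 X z \<times> d2 X z)" and ?k = "\<lambda>z. V z \<bullet> (d1 V z \<times> d2 V z)"
  let ?u = "\<lambda>z. X z \<bullet> V z" and ?t = "\<lambda>z. (norm (X z - (X z \<bullet> V z) *\<^sub>R V z))\<^sup>2"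
  let ?w = "\<lambda>z. 1 - (?u z)\<^sup>2 + 1 / 2 * ?t z"
  have c: "continuous_on Q X" "continuous_on Q V" "continuous_on Q (d1 X)" "continuous_on Q (d2 X)"
    "continuous_on Q (d1 V)" "continuous_on Q (d2 V)"
    using smooth_continuous smooth_X smooth_V smooths by blast+
  have ip: "?p integrable_on Q" and ik: "?k integrable_on Q" and iw: "(\<lambda>z. ?w z * ?k z) integrable_on Q"
    by (intro integrable_continuous continuous_intros continuous_on_cross c)+
  have "area S = (LINT x:S|hausdorff2. 1)" by (simp add: set_lebesgue_integral_def)
  also have "\<dots> = integral Q ?p" using integral_over_S[of "\<lambda>x. 1"] by simp
  finally have ar: "area S = integral Q ?p" .
  have "weight (X z) * gauss_curvature S (X z) * ?p z = ?w z * ?k z" for z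
    using weight_f[OF spherical_frame(1), of z] by (simp add: curvature_element X_eq_f V_def)
  then have rhs: "(LINT x:S|hausdorff2. weight x * gauss_curvature S x) = integral Q (\<lambda>z. ?w z * ?k z)"
    using integral_over_S[OF continuous_on_weight_curvature] by simp
  have "0 = integral Q (\<lambda>z. - 2 * ?p z + (2 * (?u z)\<^sup>2 - ?t z) * ?k z)"
    using minkowski_integral by simp
  \<comment> \<open>For the weight \<open>w = 1 - u\<^sup>2 + t / 2\<close> one has
    \<open>2 * u\<^sup>2 - t = 2 * (1 - w)\<close>.\<close>
  also have "\<dots> = integral Q (\<lambda>z. 2 * (?k z - ?p z - ?w z * ?k z))"
    by (intro integral_cong) (simp add: algebra_simps)
  also have "\<dots> = 2 * (integral Q ?k - integral Q ?p - integral Q (\<lambda>z. ?w z * ?k z))"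
    using ip ik iw by (simp add: Henstock_Kurzweil_Integration.integral_diff integrable_diff)
  finally show ?thesis by (simp add: ar rhs gauss_bonnet_sphere)
qed

end

section \<open>The identity and the area bound\<close>

theorem proposition3:
  fixes a :: real and S :: "(real^3) set"
  assumes "a > 0" and "S \<in> confined_spheres a"
  shows "area S - 4 * pi =
      - (LINT x:S|hausdorff2.
           (1 - (x \<bullet> outer_normal S x)\<^sup>2
              + 1 / 2 * (norm (x - (x \<bullet> outer_normal S x) *\<^sub>R outer_normal S x))\<^sup>2)
           * gauss_curvature S x)
    \<and> ((\<forall>x\<in>S. gauss_curvature S x \<ge> 0) \<longrightarrow> area S \<le> 4 * pi)"
proof -
  have S: "S \<subseteq> cball 0 1" "diffeomorphic (sphere (0 :: real^3) 1) S"
    using assms(2) by (auto simp: confined_spheres_def)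
  obtain f g where "smooth_on f (sphere (0 :: real^3) 1)" "smooth_on g S" "f ` sphere 0 1 = S" "g ` S = sphere 0 1"
    "\<forall>x\<in>sphere 0 1. g (f x) = x" "\<forall>y\<in>S. f (g y) = y"
    using S(2) unfolding diffeomorphic_def by blast
  then interpret smooth_sphere f g S by unfold_locales auto
  \<comment> \<open>Confinement to the unit ball bounds the normal component of the position by 1,
    so that \<open>1 - u\<^sup>2\<close> is nonnegative.\<close>
  have "0 \<le> weight x" if x: "x \<in> S" for x
  proof -
    obtain y where y: "norm y = 1" "x = f y" using f_image x by auto
    then have "norm (n y) = 1" by (intro norm_n) auto
    moreover have "norm x \<le> 1" using S(1) x by auto
    ultimately have "\<bar>f y \<bullet> n y\<bar> \<le> 1"
      using Cauchy_Schwarz_ineq2[of "f y" "n y"] y by simp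
    then have "(f y \<bullet> n y)\<^sup>2 \<le> 1" by (simp add: abs_square_le_1)
    then show ?thesis using weight_f[OF y(1)] y(2) by simp
  qed
  then have "0 \<le> (LINT x:S|hausdorff2. weight x * gauss_curvature S x)" if "\<forall>x\<in>S. gauss_curvature S x \<ge> 0"
    unfolding set_lebesgue_integral_def using that
    by (intro integral_nonneg_AE AE_I2) (auto simp: indicator_def)
  then have "area S \<le> 4 * pi" if "\<forall>x\<in>S. gauss_curvature S x \<ge> 0"
    using area_formula that by simp
  then show ?thesis using area_formula unfolding weight_def by blast
qed

end
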